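(* Let $A$ be a closed symmetric relation in a separable Hilbert space $\mathcal H$ and let $\{\mathcal G,\Gamma_0,\Gamma_1\}$ be a quasi boundary triple for $A^*$ with $A_0=\ker\Gamma_0$, $\gamma$-field $\gamma$ and Weyl function $M$. Let $\mathfrak B$ be a class of operator ideals, let $\Theta_1$ and $\Theta_2$ be two self-adjoint bounded operators in $\mathcal G$ and assume that the following conditions hold: (i) $\overline{M(\lambda_0)}\in\mathfrak S_\infty(\mathcal G)$ for some $\lambda_0\in\rho(A_0)$; (ii) $0\notin\sigma_{\rm ess}(\Theta_i)$ and $A_{\Theta_i}=A_{\Theta_i}^*$ for $i=1,2$; (iii) $\Theta_1-\Theta_2\in\mathfrak B(\mathcal G)$. Then $$(A_{\Theta_1}-\lambda)^{-1}-(A_{\Theta_2}-\lambda)^{-1}\in\mathfrak B(\mathcal H)$$ holds for all $\lambda\in\rho(A_{\Theta_1})\cap\rho(A_{\Theta_2})$. If, in addition, $\mathfrak A$ is another class of operator ideals and $\gamma(\lambda_1)^*\in\mathfrak A^*(\mathcal H,\mathcal G)$ for some $\lambda_1\in\rho(A_0)$, then $$(A_{\Theta_1}-\lambda)^{-1}-(A_{\Theta_2}-\lambda)^{-1}\in(\mathfrak A\cdot\mathfrak B\cdot\mathfrak A^* )(\mathcal H)$$ for all $\lambda\in\rho(A_{\Theta_1})\cap\rho(A_{\Theta_2})$.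
   Context: Linear relations. A (closed) linear relation in a Hilbert space $\mathcal H$ is a (closed) linear subspace of $\mathcal H\times\mathcal H$; elements are written $\hat f=\binom{f}{f'}$, and operators are identified with their graphs. $\ker S=\{f:\binom f0\in S\}$, $S-\lambda=\{\binom{f}{f'-\lambda f}:\binom f{f'}\in S\}$. For closed $S$, $\rho(S)$ is the set of $\lambda\in\mathbb C$ such that $(S-\lambda)^{-1}$ is a bounded everywhere defined operator. The adjoint is $S^*=\{\binom g{g'}:(f',g)=(f,g')\text{ for all }\binom f{f'}\in S\}$; $S$ is symmetric if $S\subset S^*$ and self-adjoint if $S=S^*$. The essential spectrum $\sigma_{\rm ess}(R)$ of a closed operator $R$ is the set of $\lambda$ such that $R-\lambda$ is not Fredholm. Quasi boundary triples. Let $A$ be a closed symmetric relation in $\mathcal H$. $\{\mathcal G,\Gamma_0,\Gamma_1\}$ is a quasi boundary triple for $A^*$ if $\mathcal G$ is a Hilbert space and $\Gamma_0,\Gamma_1:T\to\mathcal G$ are linear mappings defined on a dense subspace $T$ of $A^*$ (dense in $A^*$ with respect to the topology of $\mathcal H\times\mathcal H$) such that $\Gamma=\binom{\Gamma_0}{\Gamma_1}:T\to\mathcal G\times\mathcal G$ has dense range, $\ker\Gamma_0$ is a self-adjoint relation in $\mathcal H$, and $(f',g)-(f,g')=(\Gamma_1\hat f,\Gamma_0\hat g)-(\Gamma_0\hat f,\Gamma_1\hat g)$ for all $\hat f=\binom f{f'},\hat g=\binom g{g'}\in T$. If $\mathcal H$ is separable, so is $\mathcal G$. For an operator $\Theta$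 in $\mathcal G$ put $A_\Theta=\{\hat f\in T:\Gamma\hat f\in\Theta\}=\ker(\Gamma_1-\Theta\Gamma_0)$. $\gamma$-field and Weyl function. Let $A_0=\ker\Gamma_0$ and $\mathcal G_0=\operatorname{ran}\Gamma_0$ (dense in $\mathcal G$). For $\lambda\in\rho(A_0)$ let $\hat{\mathcal N}_{\lambda,T}=\{\binom{f}{\lambda f}: f\in\ker(T-\lambda)\}$; then $\Gamma_0$ restricted to $\hat{\mathcal N}_{\lambda,T}$ is a bijection onto $\mathcal G_0$. With $\pi_1$ the projection of $\mathcal H\times\mathcal H$ onto the first component, define $\gamma(\lambda)=\pi_1(\Gamma_0\upharpoonright\hat{\mathcal N}_{\lambda,T})^{-1}:\mathcal G_0\to\mathcal H$ and $M(\lambda)=\Gamma_1(\Gamma_0\upharpoonright\hat{\mathcal N}_{\lambda,T})^{-1}:\mathcal G_0\to\mathcal G$, regarded as densely defined operators with domain $\mathcal G_0\subset\mathcal G$. $\gamma(\lambda)$ is bounded, so $\gamma(\lambda)^*\in\mathcal B(\mathcal H,\mathcal G)$; $M(\lambda)$ is closable in $\mathcal G$ with closure $\overline{M(\lambda)}$. Operator ideals. All Hilbert spaces here are separable; $\mathcal B(\mathcal H,\mathcal K)$ are the bounded, $\mathfrak S_\infty(\mathcal H,\mathcal K)$ the compact operators, $\mathfrak S_\infty(\mathcal H)=\mathfrak S_\infty(\mathcal H,\mathcal H)$. A class of operator ideals $\mathfrak A$ consists of subsets $\mathfrak A(\mathcal H,\mathcal K)\subset\mathfrak S_\infty(\mathcal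 H,\mathcal K)$ for every pair of Hilbert spaces, such that: rank-one operators $x\mapsto(x,u)v$ lie in $\mathfrak A(\mathcal H,\mathcal K)$; $\mathfrak A(\mathcal H,\mathcal K)$ is closed under addition; $CAB\in\mathfrak A(\mathcal H_1,\mathcal K_1)$ for $A\in\mathfrak A(\mathcal H,\mathcal K)$, $B\in\mathcal B(\mathcal H_1,\mathcal H)$, $C\in\mathcal B(\mathcal K,\mathcal K_1)$. $\mathfrak A^*(\mathcal K,\mathcal H)=\{A^*:A\in\mathfrak A(\mathcal H,\mathcal K)\}$; $(\mathfrak A\cdot\mathfrak B)(\mathcal H,\mathcal K)$ is the set of products $AB$ with $A\in\mathfrak A(\mathcal G',\mathcal K)$, $B\in\mathfrak B(\mathcal H,\mathcal G')$ for some Hilbert space $\mathcal G'$ (again a class of operator ideals); $\mathfrak A(\mathcal H)=\mathfrak A(\mathcal H,\mathcal H)$, and similarly for products. *)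

theory Defs
  imports "HOL-Analysis.Analysis"
begin

section \<open>Complex inner product spaces\<close>

text \<open>
  The real inner product, and with it norm and topology, are inherited from \<^class>\<open>real_inner\<close>;
  the complex inner product is linear in its first argument.  Positivity and definiteness of
  \<open>cinner\<close> follow from \<open>inner_Re_cinner\<close>.
\<close>

class complex_inner = real_inner +
  fixes scaleC :: "complex \<Rightarrow> 'a \<Rightarrow> 'a"  (infixr \<open>*\<^sub>C\<close> 75)
    and cinner :: "'a \<Rightarrow> 'a \<Rightarrow> complex"
  assumes scaleC_add_right: "c *\<^sub>C (x + y) = c *\<^sub>C x + c *\<^sub>C y"
    and scaleC_add_left: "(c + d) *\<^sub>C x = c *\<^sub>C x + d *\<^sub>C x"
    and scaleC_scaleC: "c *\<^sub>C (d *\<^sub>C x) = (c * d) *\<^sub>C x"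
    and scaleR_scaleC: "scaleR r x = complex_of_real r *\<^sub>C x"
    and cinner_commute: "cinner x y = cnj (cinner y x)"
    and cinner_add_left: "cinner (x + y) z = cinner x z + cinner y z"
    and cinner_scaleC_left: "cinner (c *\<^sub>C x) y = c * cinner x y"
    and inner_Re_cinner: "inner x y = Re (cinner x y)"

lemma scaleC_one: "1 *\<^sub>C x = (x :: 'a::complex_inner)"
  using scaleR_scaleC[of 1 x] by simp

global_interpretation complex_vector:
  vector_space "scaleC :: complex \<Rightarrow> 'a \<Rightarrow> 'a::complex_inner"
  by unfold_locales (simp_all add: scaleC_add_right scaleC_add_left scaleC_scaleC scaleC_one)

instantiation complex :: complex_inner
begin

definition scaleC_complex :: "complex \<Rightarrow> complex \<Rightarrow> complex"
  where "scaleC_complex c x = c * x"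

definition cinner_complex :: "complex \<Rightarrow> complex \<Rightarrow> complex"
  where "cinner_complex x y = x * cnj y"

instance
  by standard
    (simp_all add: scaleC_complex_def cinner_complex_def algebra_simps scaleR_conv_of_real
      inner_complex_def)

end

instantiation prod :: (complex_inner, complex_inner) complex_inner
begin

definition scaleC_prod :: "complex \<Rightarrow> 'a \<times> 'b \<Rightarrow> 'a \<times> 'b"
  where "scaleC_prod c x = (c *\<^sub>C fst x, c *\<^sub>C snd x)"

definition cinner_prod :: "'a \<times> 'b \<Rightarrow> 'a \<times> 'b \<Rightarrow> complex"
  where "cinner_prod x y = cinner (fst x) (fst y) + cinner (snd x) (snd y)"

instance
proof
  fix x y :: "'a \<times> 'b"
  show "cinner x y = cnj (cinner y x)"
    using cinner_commute[of "fst x" "fst y"] cinner_commute[of "snd x" "snd y"]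
    by (simp add: cinner_prod_def)
qed (simp_all add: scaleC_prod_def cinner_prod_def inner_prod_def scaleC_add_right
      scaleC_add_left scaleC_scaleC scaleR_scaleC[symmetric] scaleR_prod_def cinner_add_left
      cinner_scaleC_left inner_Re_cinner algebra_simps)

end


section \<open>Hilbert spaces\<close>

text \<open>
  A statement about a class of operator ideals quantifies over all Hilbert spaces, so Hilbert
  spaces cannot be types here.  They are the complete complex subspaces of an inner product space
  \<open>'u\<close>, which is arbitrary and need not be complete.  This covers every set-indexed family of
  Hilbert spaces up to unitary equivalence: take for \<open>'u\<close> their algebraic direct sum, which
  contains each of them as a complete subspace.
\<close>

definition hilbert_space :: "'u::complex_inner set \<Rightarrow> bool"
  where "hilbert_space H \<longleftrightarrow> complex_vector.subspace H \<and> complete H"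

definition separable_hilbert_space :: "'u::complex_inner set \<Rightarrow> bool"
  where "separable_hilbert_space H \<longleftrightarrow>
    hilbert_space H \<and> (\<exists>D. countable D \<and> D \<subseteq> H \<and> H \<subseteq> closure D)"


section \<open>Linear relations\<close>

text \<open>
  Operators are identified with their graphs: an operator from \<open>H\<close> to \<open>K\<close> is a single-valued
  linear relation.  With this convention the operator product \<open>A B\<close> is \<open>B O A\<close>, the inverse is
  the converse relation, domain and range are \<^const>\<open>Domain\<close> and \<^const>\<open>Range\<close>, and the closure of
  a closable operator is the topological closure of its graph.
\<close>

type_synonym 'u lrel = "('u \<times> 'u) set"

definition linear_relation :: "'u::complex_inner set \<Rightarrow> 'u set \<Rightarrow> 'u lrel \<Rightarrow> bool"
  where "linear_relation H K S \<longleftrightarrow> S \<subseteq> H \<times> K \<and> complex_vector.subspace S"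

definition rel_ker :: "'u::complex_inner lrel \<Rightarrow> 'u set"
  where "rel_ker S = {f. (f, 0) \<in> S}"

text \<open>\<open>rel_shift S l\<close> is \<open>S - l\<close>.\<close>

definition rel_shift :: "'u::complex_inner lrel \<Rightarrow> complex \<Rightarrow> 'u lrel"
  where "rel_shift S l = {(f, f' - l *\<^sub>C f) | f f'. (f, f') \<in> S}"

definition rel_add :: "'u::complex_inner lrel \<Rightarrow> 'u lrel \<Rightarrow> 'u lrel"
  where "rel_add S R = {(f, g + h) | f g h. (f, g) \<in> S \<and> (f, h) \<in> R}"

definition rel_diff :: "'u::complex_inner lrel \<Rightarrow> 'u lrel \<Rightarrow> 'u lrel"
  where "rel_diff S R = {(f, g - h) | f g h. (f, g) \<in> S \<and> (f, h) \<in> R}"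

text \<open>The adjoint of \<open>S \<subseteq> H \<times> K\<close> is a subset of \<open>K \<times> H\<close>.\<close>

definition rel_adjoint :: "'u::complex_inner set \<Rightarrow> 'u set \<Rightarrow> 'u lrel \<Rightarrow> 'u lrel"
  where "rel_adjoint H K S =
    {(g, g'). g \<in> K \<and> g' \<in> H \<and> (\<forall>(f, f') \<in> S. cinner f' g = cinner f g')}"

definition symmetric_relation :: "'u::complex_inner set \<Rightarrow> 'u lrel \<Rightarrow> bool"
  where "symmetric_relation H S \<longleftrightarrow> linear_relation H H S \<and> S \<subseteq> rel_adjoint H H S"

definition self_adjoint_relation :: "'u::complex_inner set \<Rightarrow> 'u lrel \<Rightarrow> bool"
  where "self_adjoint_relation H S \<longleftrightarrow> linear_relation H H S \<and> S = rel_adjoint H H S"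

definition bounded_ops :: "'u::complex_inner set \<Rightarrow> 'u set \<Rightarrow> 'u lrel set"
  where "bounded_ops H K =
    {S. linear_relation H K S \<and> single_valued S \<and> Domain S = H \<and>
        (\<exists>C. \<forall>(f, f') \<in> S. norm f' \<le> C * norm f)}"

definition compact_ops :: "'u::complex_inner set \<Rightarrow> 'u set \<Rightarrow> 'u lrel set"
  where "compact_ops H K = {S \<in> bounded_ops H K. compact (closure (S `` cball 0 1))}"

definition resolvent :: "'u::complex_inner lrel \<Rightarrow> complex \<Rightarrow> 'u lrel"
  where "resolvent S l = (rel_shift S l)\<inverse>"

definition resolvent_set :: "'u::complex_inner set \<Rightarrow> 'u lrel \<Rightarrow> complex set"
  where "resolvent_set H S = {l. resolvent S l \<in> bounded_ops H H}"

definition fredholm :: "'u::complex_inner set \<Rightarrow> 'u set \<Rightarrow> 'u lrel \<Rightarrow> bool"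
  where "fredholm H K S \<longleftrightarrow>
    linear_relation H K S \<and> single_valued S \<and> closed S \<and>
    (\<exists>B. finite B \<and> rel_ker S \<subseteq> complex_vector.span B) \<and>
    closed (Range S) \<and>
    (\<exists>B. finite B \<and> B \<subseteq> K \<and> K = complex_vector.span (Range S \<union> B))"

definition ess_spectrum :: "'u::complex_inner set \<Rightarrow> 'u lrel \<Rightarrow> complex set"
  where "ess_spectrum H R = {l. \<not> fredholm H H (rel_shift R l)}"


section \<open>Quasi boundary triples\<close>

definition clinear_on :: "'a::complex_inner set \<Rightarrow> ('a \<Rightarrow> 'b::complex_inner) \<Rightarrow> bool"
  where "clinear_on S f \<longleftrightarrow>
    (\<forall>x\<in>S. \<forall>y\<in>S. f (x + y) = f x + f y) \<and> (\<forall>c. \<forall>x\<in>S. f (c *\<^sub>C x) = c *\<^sub>C f x)"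

text \<open>
  The boundary maps \<open>\<Gamma>0\<close>, \<open>\<Gamma>1\<close> are total functions in HOL; only their values on \<open>T\<close> matter.
\<close>

definition ker_on :: "'u::complex_inner lrel \<Rightarrow> ('u \<times> 'u \<Rightarrow> 'u) \<Rightarrow> 'u lrel"
  where "ker_on T \<Gamma>0 = {f \<in> T. \<Gamma>0 f = 0}"

definition quasi_boundary_triple ::
  "'u::complex_inner set \<Rightarrow> 'u lrel \<Rightarrow> 'u set \<Rightarrow> 'u lrel \<Rightarrow>
    ('u \<times> 'u \<Rightarrow> 'u) \<Rightarrow> ('u \<times> 'u \<Rightarrow> 'u) \<Rightarrow> bool"
  where "quasi_boundary_triple H A G T \<Gamma>0 \<Gamma>1 \<longleftrightarrow>
    hilbert_space G \<and>
    linear_relation H H T \<and> T \<subseteq> rel_adjoint H H A \<and> rel_adjoint H H A \<subseteq> closure T \<and>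
    \<Gamma>0 ` T \<subseteq> G \<and> \<Gamma>1 ` T \<subseteq> G \<and> clinear_on T \<Gamma>0 \<and> clinear_on T \<Gamma>1 \<and>
    G \<times> G \<subseteq> closure ((\<lambda>f. (\<Gamma>0 f, \<Gamma>1 f)) ` T) \<and>
    self_adjoint_relation H (ker_on T \<Gamma>0) \<and>
    (\<forall>(f, f') \<in> T. \<forall>(g, g') \<in> T.
      cinner f' g - cinner f g' =
        cinner (\<Gamma>1 (f, f')) (\<Gamma>0 (g, g')) - cinner (\<Gamma>0 (f, f')) (\<Gamma>1 (g, g')))"

text \<open>\<open>extension T \<Gamma>0 \<Gamma>1 \<Theta>\<close> is \<open>A\<^sub>\<Theta> = ker (\<Gamma>1 - \<Theta> \<Gamma>0)\<close>.\<close>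

definition extension ::
  "'u::complex_inner lrel \<Rightarrow> ('u \<times> 'u \<Rightarrow> 'u) \<Rightarrow> ('u \<times> 'u \<Rightarrow> 'u) \<Rightarrow> 'u lrel \<Rightarrow> 'u lrel"
  where "extension T \<Gamma>0 \<Gamma>1 \<Theta> = {f \<in> T. (\<Gamma>0 f, \<Gamma>1 f) \<in> \<Theta>}"

definition defect_graph :: "'u::complex_inner lrel \<Rightarrow> complex \<Rightarrow> 'u lrel"
  where "defect_graph T l = {(f, l *\<^sub>C f) | f. f \<in> rel_ker (rel_shift T l)}"

text \<open>
  For \<open>l \<in> \<rho>(ker \<Gamma>0)\<close> the map \<open>\<Gamma>0\<close> is injective on \<open>defect_graph T l\<close> with range \<open>\<Gamma>0 ` T\<close>, so
  these are the graphs of the gamma field and the Weyl function at \<open>l\<close>, i.e. of the first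
  projection and of \<open>\<Gamma>1\<close> composed with the inverse of that restriction.
\<close>

definition gamma_field ::
  "'u::complex_inner lrel \<Rightarrow> ('u \<times> 'u \<Rightarrow> 'u) \<Rightarrow> complex \<Rightarrow> 'u lrel"
  where "gamma_field T \<Gamma>0 l = (\<lambda>f. (\<Gamma>0 f, fst f)) ` defect_graph T l"

definition weyl_function ::
  "'u::complex_inner lrel \<Rightarrow> ('u \<times> 'u \<Rightarrow> 'u) \<Rightarrow> ('u \<times> 'u \<Rightarrow> 'u) \<Rightarrow> complex \<Rightarrow> 'u lrel"
  where "weyl_function T \<Gamma>0 \<Gamma>1 l = (\<lambda>f. (\<Gamma>0 f, \<Gamma>1 f)) ` defect_graph T l"


section \<open>Classes of operator ideals\<close>

text \<open>
  The values of such a family matter only at pairs of separable Hilbert spaces.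
\<close>

type_synonym 'u op_class = "'u set \<Rightarrow> 'u set \<Rightarrow> 'u lrel set"

definition operator_ideal_class :: "'u::complex_inner op_class \<Rightarrow> bool"
  where "operator_ideal_class \<AA> \<longleftrightarrow>
    (\<forall>H K. separable_hilbert_space H \<longrightarrow> separable_hilbert_space K \<longrightarrow>
      \<AA> H K \<subseteq> compact_ops H K \<and>
      (\<forall>u\<in>H. \<forall>v\<in>K. {(x, cinner x u *\<^sub>C v) | x. x \<in> H} \<in> \<AA> H K) \<and>
      (\<forall>S\<in>\<AA> H K. \<forall>R\<in>\<AA> H K. rel_add S R \<in> \<AA> H K) \<and>
      (\<forall>H1 K1. separable_hilbert_space H1 \<longrightarrow> separable_hilbert_space K1 \<longrightarrow>
        (\<forall>S\<in>\<AA> H K. \<forall>B\<in>bounded_ops H1 H. \<forall>C\<in>bounded_ops K K1. B O S O C \<in> \<AA> H1 K1)))"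

definition ideal_adjoint :: "'u::complex_inner op_class \<Rightarrow> 'u op_class"
  where "ideal_adjoint \<AA> K H = rel_adjoint H K ` \<AA> H K"

definition ideal_prod :: "'u::complex_inner op_class \<Rightarrow> 'u op_class \<Rightarrow> 'u op_class"
  where "ideal_prod \<AA> \<BB> H K =
    {B O A | A B G. separable_hilbert_space G \<and> A \<in> \<AA> G K \<and> B \<in> \<BB> H G}"

end

(*
  Write P_i(l) h = Gamma0 (R_i h, h + l R_i h) with R_i = (A_{Theta_i} - l)^{-1}. Applying Green's
  identity to an element of A_{Theta_1} and to the difference of the graph elements of R_1 and R_2
  gives a Krein formula that involves neither A_0 nor the Weyl function:
    R_1 - R_2 = P_1(conj l)^* (Theta_2 - Theta_1) P_2(l).
  Since Gamma is closable, its restriction to a closed subspace of T is bounded, so P_1 and P_2 are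
  bounded, and the first claim follows from the ideal property.

  For the second claim it suffices that P_i(l) = X gamma(l1)^* Y with bounded X and Y. For nonreal mu,
  the element f of A_Theta splits as f = u + f0 with u in the defect space at mu and f0 in A_0, and
    (Theta - M(mu)) Gamma0 f = Gamma1 f0 = gamma(l1)^* h',  where h' depends boundedly on h.
  So one needs Theta - M(mu) to be bounded below at one nonreal mu. Near l0 the operator
  Theta - M(mu) is a norm-small perturbation of the compact perturbation Theta - M(l0) of a Fredholm
  operator, so an approximate null sequence has a limit point x; Green's identity forces the
  corresponding defect elements to tend to 0, and closability of Gamma gives x = 0.
*)
theory Submission
  imports Defs
begin

section \<open>Complex Hilbert spaces\<close>

text \<open>Two obstacles shape the argument. The boundary maps live on a subspace \<open>T\<close>
  that is only dense in the adjoint of \<open>A\<close>, so nothing about them is closed or bounded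
  by definition; each bound is extracted from Green's identity, the density of the boundary range
  and a Baire argument on a closed subspace of \<open>T\<close>. And \<open>l0\<close> may be real,
  where Theta - M(l0) can have a kernel. A nonreal \<mu> near \<open>l0\<close> serves three
  purposes: A_0 has a resolvent there by self-adjointness; for a null vector, symmetry of Theta
  turns Green's identity into (\<mu> - cnj \<mu>) |u|^2 = 0; and \<mu> is still close enough for the
  perturbation estimate. The Fredholm hypothesis is used in two halves: closed range gives a lower
  bound off the kernel of Theta, and finite dimension of that kernel gives convergent subsequences
  inside it. Ideals speak of separable spaces only, so separability of \<open>G\<close> has to be
  derived before any ideal property can be applied.\<close>

lemma cinner_add_right: "cinner x (y + z) = cinner x y + cinner x (z :: 'a::complex_inner)"
  by (metis cinner_add_left cinner_commute complex_cnj_add)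

lemma cinner_scaleC_right: "cinner x (c *\<^sub>C y) = cnj c * cinner x (y :: 'a::complex_inner)"
  by (metis cinner_scaleC_left cinner_commute complex_cnj_mult)

lemma cinner_self: "cinner x x = complex_of_real ((norm (x :: 'a::complex_inner))\<^sup>2)"
proof -
  have "cinner x x = cnj (cinner x x)" by (rule cinner_commute)
  then have "Im (cinner x x) = 0" by (simp add: complex_eq_iff)
  moreover have "Re (cinner x x) = (norm x)\<^sup>2"
    by (simp add: inner_Re_cinner[symmetric] power2_norm_eq_inner)
  ultimately show ?thesis by (simp add: complex_eq_iff)
qed

lemma norm_scaleC: "norm (c *\<^sub>C x) = cmod c * norm (x :: 'a::complex_inner)"
proof -
  have "complex_of_real ((norm (c *\<^sub>C x))\<^sup>2) = c * cnj c * complex_of_real ((norm x)\<^sup>2)"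
    by (metis cinner_self cinner_scaleC_left cinner_scaleC_right mult.assoc)
  also have "\<dots> = complex_of_real ((cmod c * norm x)\<^sup>2)"
    by (simp only: complex_norm_square[symmetric] of_real_mult power_mult_distrib)
  finally have "(norm (c *\<^sub>C x))\<^sup>2 = (cmod c * norm x)\<^sup>2"
    using of_real_eq_iff by blast
  then show ?thesis by (simp add: power2_eq_iff_nonneg)
qed

lemma norm_cinner_le: "cmod (cinner x y) \<le> norm x * norm (y :: 'a::complex_inner)"
proof (cases "cinner x y = 0")
  case False
  \<comment> \<open>A unimodular factor rotating \<open>cinner x y\<close> onto its modulus; this
    reduces the claim to the Cauchy-Schwarz inequality of the real inner product.\<close>
  define c where "c = cnj (cinner x y) / complex_of_real (cmod (cinner x y))"
  have c: "cmod c = 1" using False by (simp add: c_def norm_divide)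
  have "cinner (c *\<^sub>C x) y = complex_of_real (cmod (cinner x y))"
    using False complex_norm_square[of "cinner x y"]
    by (simp add: cinner_scaleC_left c_def field_simps power2_eq_square)
  then have "cmod (cinner x y) = inner (c *\<^sub>C x) y"
    by (simp add: inner_Re_cinner)
  also have "\<dots> \<le> norm (c *\<^sub>C x) * norm y" by (rule norm_cauchy_schwarz)
  finally show ?thesis by (simp add: norm_scaleC c)
qed simp

lemma bounded_bilinear_cinner: "bounded_bilinear (cinner :: 'a::complex_inner \<Rightarrow> 'a \<Rightarrow> complex)"
proof
  show "\<exists>K. \<forall>a b. norm (cinner a b :: complex) \<le> norm (a::'a) * norm b * K"
    by (intro exI[of _ 1]) (simp add: norm_cinner_le)
qed (simp_all add: cinner_add_left cinner_add_right scaleR_scaleC cinner_scaleC_left scaleC_complex_def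
    cinner_scaleC_right scaleR_conv_of_real)

lemma bounded_bilinear_scaleC:
  "bounded_bilinear ((*\<^sub>C) :: complex \<Rightarrow> 'a::complex_inner \<Rightarrow> 'a)"
proof
  show "\<exists>K. \<forall>a (b::'a). norm (a *\<^sub>C b) \<le> norm a * norm b * K"
    by (intro exI[of _ 1]) (simp add: norm_scaleC)
qed (simp_all add: scaleC_add_left scaleC_add_right scaleR_scaleC scaleR_conv_of_real
    scaleC_scaleC scaleC_complex_def mult.commute)

lemmas cinner_zero_left [simp] = bounded_bilinear.zero_left [OF bounded_bilinear_cinner]
  and cinner_zero_right [simp] = bounded_bilinear.zero_right [OF bounded_bilinear_cinner]
  and cinner_diff_left = bounded_bilinear.diff_left [OF bounded_bilinear_cinner]
  and cinner_diff_right = bounded_bilinear.diff_right [OF bounded_bilinear_cinner]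
  and cinner_minus_left = bounded_bilinear.minus_left [OF bounded_bilinear_cinner]
  and tendsto_cinner = bounded_bilinear.tendsto [OF bounded_bilinear_cinner]
  and tendsto_scaleC = bounded_bilinear.tendsto [OF bounded_bilinear_scaleC]

lemma cinner_self_eq_0 [simp]: "cinner x x = 0 \<longleftrightarrow> x = (0 :: 'a::complex_inner)"
  by (simp add: cinner_self)

lemma cinner_eq_0_commute: "cinner x y = 0 \<longleftrightarrow> cinner y x = (0 :: complex)"
  by (metis cinner_commute complex_cnj_zero)

lemma subspace_closure:
  assumes "complex_vector.subspace (S :: 'a::complex_inner set)"
  shows "complex_vector.subspace (closure S)"
proof (rule complex_vector.subspaceI)
  show "0 \<in> closure S"
    using assms closure_subset complex_vector.subspace_0 by blast
  fix x y assume "x \<in> closure S" "y \<in> closure S"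
  then obtain f g where "\<forall>n. f n \<in> S" "f \<longlonglongrightarrow> x" "\<forall>n. g n \<in> S" "g \<longlonglongrightarrow> y"
    unfolding closure_sequential by blast
  then have "\<forall>n. f n + g n \<in> S" "(\<lambda>n. f n + g n) \<longlonglongrightarrow> x + y"
    by (auto intro: tendsto_add complex_vector.subspace_add[OF assms])
  then show "x + y \<in> closure S"
    unfolding closure_sequential by (intro exI[of _ "\<lambda>n. f n + g n"] conjI)
next
  fix c x assume "x \<in> closure S"
  then obtain f where "\<forall>n. f n \<in> S" "f \<longlonglongrightarrow> x"
    unfolding closure_sequential by blast
  then have "\<forall>n. c *\<^sub>C f n \<in> S" "(\<lambda>n. c *\<^sub>C f n) \<longlonglongrightarrow> c *\<^sub>C x"
    by (auto intro: tendsto_scaleC complex_vector.subspace_scale[OF assms])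
  then show "c *\<^sub>C x \<in> closure S"
    unfolding closure_sequential by (intro exI[of _ "\<lambda>n. c *\<^sub>C f n"] conjI)
qed

lemma hilbert_space_closed_subspace:
  assumes "hilbert_space H" "W \<subseteq> H" "complex_vector.subspace W" "closed W"
  shows "hilbert_space W"
  using assms complete_closed_subset unfolding hilbert_space_def by blast

lemma hilbert_space_closure:
  assumes "hilbert_space H" "W \<subseteq> H" "complex_vector.subspace W"
  shows "hilbert_space (closure W)"
proof (rule hilbert_space_closed_subspace[OF assms(1)])
  show "closure W \<subseteq> H"
    using assms closure_minimal complete_imp_closed unfolding hilbert_space_def by blast
qed (use assms subspace_closure in auto)

lemma hilbert_space_Times:
  assumes "hilbert_space H" "hilbert_space K"
  shows "hilbert_space (H \<times> K)"
  unfolding hilbert_space_def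
proof
  show "complex_vector.subspace (H \<times> K)"
    using assms unfolding hilbert_space_def complex_vector.subspace_def
    by (auto simp: scaleC_prod_def zero_prod_def)
  show "complete (H \<times> K)"
    unfolding complete_def
  proof (intro allI impI)
    fix f :: "nat \<Rightarrow> 'a \<times> 'b" assume f: "(\<forall>n. f n \<in> H \<times> K) \<and> Cauchy f"
    then have "Cauchy (\<lambda>n. fst (f n))" "Cauchy (\<lambda>n. snd (f n))"
      by (auto intro: Cauchy_fst Cauchy_snd)
    moreover have "\<forall>n. fst (f n) \<in> H" "\<forall>n. snd (f n) \<in> K" using f by (auto simp: mem_Times_iff)
    ultimately obtain a b where "a \<in> H" "(\<lambda>n. fst (f n)) \<longlonglongrightarrow> a" "b \<in> K" "(\<lambda>n. snd (f n)) \<longlonglongrightarrow> b"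
      using assms unfolding hilbert_space_def complete_def by meson
    then show "\<exists>l\<in>H \<times> K. f \<longlonglongrightarrow> l"
      using tendsto_Pair[of "\<lambda>n. fst (f n)" a sequentially "\<lambda>n. snd (f n)" b] by auto
  qed
qed

section \<open>Orthogonal projection and Riesz representation\<close>

lemma parallelogram_midpoint:
  fixes a b x :: "'a::real_inner"
  shows "(norm (a - b))\<^sup>2 =
    2 * (norm (x - a))\<^sup>2 + 2 * (norm (x - b))\<^sup>2 - 4 * (norm (x - (1/2) *\<^sub>R (a + b)))\<^sup>2"
  by (simp add: power2_norm_eq_inner inner_diff_left inner_diff_right inner_add_left
      inner_add_right inner_commute algebra_simps)

lemma closest_point_orthogonal:
  fixes W :: "'a::complex_inner set"
  assumes W: "complex_vector.subspace W" and w: "w \<in> W"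
    and min: "\<And>v. v \<in> W \<Longrightarrow> norm (x - w) \<le> norm (x - v)" and v: "v \<in> W"
  shows "cinner (x - w) v = 0"
proof (cases "v = 0")
  case False
  define a where "a = cinner (x - w) v"
  \<comment> \<open>The coefficient of \<open>x - w\<close> along \<open>v\<close>: moving
    \<open>w\<close> by \<open>c *\<^sub>C v\<close> lowers the squared distance by |a|^2 / |v|^2,
    so minimality forces \<open>a = 0\<close>.\<close>
  define c where "c = a / complex_of_real ((norm v)\<^sup>2)"
  have nv: "complex_of_real ((norm v)\<^sup>2) \<noteq> 0" using False by simp
  have "w + c *\<^sub>C v \<in> W" using W w v
    by (simp add: complex_vector.subspace_add complex_vector.subspace_scale)
  then have "norm (x - w) \<le> norm (x - w - c *\<^sub>C v)"
    using min by (metis diff_diff_eq)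
  then have le: "(norm (x - w))\<^sup>2 \<le> (norm (x - w - c *\<^sub>C v))\<^sup>2"
    by (simp add: power_mono)
  have va: "cinner v (x - w) = cnj a"
    unfolding a_def by (rule cinner_commute)
  have "cinner (x - w - c *\<^sub>C v) (x - w - c *\<^sub>C v) =
      cinner (x - w) (x - w) - cnj c * a - (c * cnj a - c * cnj c * complex_of_real ((norm v)\<^sup>2))"
    unfolding cinner_diff_left[of "x - w"] cinner_diff_right[of _ "x - w"]
      cinner_scaleC_left cinner_scaleC_right va a_def[symmetric] cinner_self[of v]
    by (simp add: algebra_simps)
  also have "\<dots> = cinner (x - w) (x - w) - a * cnj a / complex_of_real ((norm v)\<^sup>2)"
    using nv by (simp add: c_def field_simps)
  also have "\<dots> = complex_of_real ((norm (x - w))\<^sup>2 - (cmod a)\<^sup>2 / (norm v)\<^sup>2)"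
    by (simp add: cinner_self complex_norm_square[symmetric])
  finally have "(norm (x - w - c *\<^sub>C v))\<^sup>2 = (norm (x - w))\<^sup>2 - (cmod a)\<^sup>2 / (norm v)\<^sup>2"
    unfolding cinner_self using of_real_eq_iff by blast
  with le have "(cmod a)\<^sup>2 / (norm v)\<^sup>2 \<le> 0" by simp
  then show ?thesis
    using False by (simp add: a_def divide_le_0_iff)
qed simp

text \<open>The ambient space may be incomplete, so the foot of the perpendicular comes from
  completeness of \<open>W\<close>: a minimizing sequence is Cauchy because midpoints stay in
  \<open>W\<close>.\<close>

lemma hilbert_space_projection:
  assumes "hilbert_space W"
  obtains w where "w \<in> W" "\<And>v. v \<in> W \<Longrightarrow> cinner (x - w) v = 0"
proof -
  have W: "complex_vector.subspace W" and cW: "complete W"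
    using assms by (auto simp: hilbert_space_def)
  have W0: "W \<noteq> {}" using W complex_vector.subspace_0 by blast
  define d where "d = infdist x W"
  have d0: "0 \<le> d" by (simp add: d_def infdist_nonneg)
  have dle: "d \<le> norm (x - w)" if "w \<in> W" for w
    using infdist_le[OF that, of x] by (simp add: d_def dist_norm)
  have "\<exists>w\<in>W. dist x w < d + 1 / real (Suc n)" for n
    using cInf_lessD[of "dist x ` W" "d + 1 / real (Suc n)"] W0
    by (auto simp: d_def infdist_notempty)
  then obtain w where w: "\<And>n. w n \<in> W" "\<And>n. dist x (w n) < d + 1 / real (Suc n)"
    by metis
  have mid: "(1/2) *\<^sub>R (w n + w m) \<in> W" for n m
    unfolding scaleR_scaleC using w(1) W
    by (simp add: complex_vector.subspace_add complex_vector.subspace_scale)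
  have lim: "(\<lambda>n. norm (x - w n)) \<longlonglongrightarrow> d"
  proof (rule real_tendsto_sandwich)
    show "\<forall>\<^sub>F n in sequentially. d \<le> norm (x - w n)" using dle w by simp
    show "\<forall>\<^sub>F n in sequentially. norm (x - w n) \<le> d + 1 / real (Suc n)"
      using w(2) by (simp add: dist_norm less_imp_le)
    show "(\<lambda>n. d + 1 / real (Suc n)) \<longlonglongrightarrow> d"
      using tendsto_add[OF tendsto_const LIMSEQ_inverse_real_of_nat, of d]
      by (simp add: inverse_eq_divide)
  qed simp
  then have lim2: "(\<lambda>n. (norm (x - w n))\<^sup>2) \<longlonglongrightarrow> d\<^sup>2"
    by (rule tendsto_power)
  have "Cauchy w"
  proof (rule metric_CauchyI)
    fix e :: real assume e: "e > 0"
    \<comment> \<open>The parallelogram identity doubles both squared distances, so two surpluses of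
      e^2/4 add up to e^2.\<close>
    then have "e\<^sup>2 / 4 > 0" by simp
    then have "\<forall>\<^sub>F n in sequentially. (norm (x - w n))\<^sup>2 < d\<^sup>2 + e\<^sup>2 / 4"
      using lim2 by (intro order_tendstoD) auto
    then obtain M where M: "\<And>n. n \<ge> M \<Longrightarrow> (norm (x - w n))\<^sup>2 < d\<^sup>2 + e\<^sup>2 / 4"
      unfolding eventually_sequentially by blast
    show "\<exists>M. \<forall>m\<ge>M. \<forall>n\<ge>M. dist (w m) (w n) < e"
    proof (intro exI allI impI)
      fix m n assume mn: "m \<ge> M" "n \<ge> M"
      have "d\<^sup>2 \<le> (norm (x - (1/2) *\<^sub>R (w m + w n)))\<^sup>2"
        using dle[OF mid] d0 by (simp add: power_mono)
      then have "(norm (w m - w n))\<^sup>2 < e\<^sup>2"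
        unfolding parallelogram_midpoint[of "w m" "w n" x] using M[OF mn(1)] M[OF mn(2)] by linarith
      then show "dist (w m) (w n) < e"
        using e by (simp add: dist_norm power2_less_imp_less)
    qed
  qed
  then obtain l where l: "l \<in> W" "w \<longlonglongrightarrow> l"
    using cW w(1) unfolding complete_def by blast
  have "(\<lambda>n. norm (x - w n)) \<longlonglongrightarrow> norm (x - l)"
    by (intro tendsto_intros l)
  then have "norm (x - l) = d" using lim LIMSEQ_unique by blast
  then have "cinner (x - l) v = 0" if "v \<in> W" for v
    using closest_point_orthogonal[OF W l(1) _ that] dle by simp
  with l that show ?thesis by blast
qed

lemma clinear_on_zero:
  assumes "clinear_on S f" "complex_vector.subspace S"
  shows "f 0 = 0"
proof -
  have "f ((0::complex) *\<^sub>C 0) = 0 *\<^sub>C f 0"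
    using assms complex_vector.subspace_0 unfolding clinear_on_def by blast
  then show ?thesis by simp
qed

lemma clinear_on_diff:
  assumes "clinear_on S f" "complex_vector.subspace S" "x \<in> S" "y \<in> S"
  shows "f (x - y) = f x - f y"
proof -
  have my: "(-1) *\<^sub>C y \<in> S" using assms complex_vector.subspace_scale by blast
  have "f (x + (-1) *\<^sub>C y) = f x + f ((-1) *\<^sub>C y)"
    using assms my unfolding clinear_on_def by blast
  also have "f ((-1) *\<^sub>C y) = (-1) *\<^sub>C f y"
    using assms unfolding clinear_on_def by blast
  finally show ?thesis by (simp add: complex_vector.scale_minus_left scaleC_one)
qed

text \<open>The representing vector is a multiple of a vector \<open>z\<close> orthogonal to the
  kernel \<open>N\<close>. The identity at \<open>x\<close> is read off by pairing
  \<open>\<phi> z *\<^sub>C x - \<phi> x *\<^sub>C z\<close>, an element of \<open>N\<close>, with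
  \<open>z\<close>.\<close>

lemma riesz_representation:
  fixes \<phi> :: "'a::complex_inner \<Rightarrow> complex"
  assumes V: "hilbert_space V" and lin: "clinear_on V \<phi>"
    and bd: "\<And>x. x \<in> V \<Longrightarrow> cmod (\<phi> x) \<le> C * norm x"
  obtains y where "y \<in> V" "\<And>x. x \<in> V \<Longrightarrow> \<phi> x = cinner x y"
proof (cases "\<forall>x\<in>V. \<phi> x = 0")
  case True
  then show ?thesis
    using that[of 0] V complex_vector.subspace_0 unfolding hilbert_space_def by auto
next
  case False
  have sV: "complex_vector.subspace V" using V by (simp add: hilbert_space_def)
  obtain x0 where x0: "x0 \<in> V" "\<phi> x0 \<noteq> 0" using False by blast
  define N where "N = {x \<in> V. \<phi> x = 0}"
  have sN: "complex_vector.subspace N"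
    using sV lin clinear_on_zero[OF lin sV]
    unfolding N_def complex_vector.subspace_def clinear_on_def by (auto simp: scaleC_complex_def)
  have "closed N"
    unfolding closed_sequential_limits
  proof (intro allI impI)
    fix f l assume fl: "(\<forall>n. f n \<in> N) \<and> f \<longlonglongrightarrow> l"
    then have l: "l \<in> V"
      using V complete_imp_closed closed_sequentially unfolding hilbert_space_def N_def by blast
    have "cmod (\<phi> l) \<le> C * norm (l - f n)" for n
    proof -
      have "\<phi> (l - f n) = \<phi> l"
        using clinear_on_diff[OF lin sV l, of "f n"] fl by (simp add: N_def)
      then show ?thesis
        using bd[of "l - f n"] l fl sV by (simp add: N_def complex_vector.subspace_diff)
    qed
    moreover have "(\<lambda>n. C * norm (l - f n)) \<longlonglongrightarrow> C * norm (l - l)"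
      by (intro tendsto_intros) (use fl in blast)
    ultimately have "cmod (\<phi> l) \<le> C * norm (l - l)"
      by (intro LIMSEQ_le_const) auto
    then show "l \<in> N" using l by (simp add: N_def)
  qed
  then have "hilbert_space N"
    using hilbert_space_closed_subspace[OF V _ sN] by (auto simp: N_def)
  then obtain w where w: "w \<in> N" "\<And>v. v \<in> N \<Longrightarrow> cinner (x0 - w) v = 0"
    using hilbert_space_projection by blast
  define z where "z = x0 - w"
  have zV: "z \<in> V" using x0 w sV by (simp add: z_def N_def complex_vector.subspace_diff)
  have \<phi>z: "\<phi> z = \<phi> x0"
    using clinear_on_diff[OF lin sV x0(1), of w] w by (simp add: z_def N_def)
  have z0: "z \<noteq> 0" using \<phi>z x0 clinear_on_zero[OF lin sV] by auto
  define y where "y = cnj (\<phi> z / complex_of_real ((norm z)\<^sup>2)) *\<^sub>C z"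
  have "\<phi> x = cinner x y" if x: "x \<in> V" for x
  proof -
    have xz: "\<phi> x *\<^sub>C z \<in> V" "\<phi> z *\<^sub>C x \<in> V"
      using sV x zV by (auto simp: complex_vector.subspace_scale)
    have "\<phi> (\<phi> z *\<^sub>C x - \<phi> x *\<^sub>C z) = 0"
      using clinear_on_diff[OF lin sV xz(2,1)] lin x zV
      by (simp add: clinear_on_def scaleC_complex_def)
    then have "\<phi> z *\<^sub>C x - \<phi> x *\<^sub>C z \<in> N"
      using xz sV by (simp add: N_def complex_vector.subspace_diff)
    then have "cinner (\<phi> z *\<^sub>C x - \<phi> x *\<^sub>C z) z = 0"
      using w(2) cinner_eq_0_commute by (metis z_def)
    then have "\<phi> z * cinner x z = \<phi> x * complex_of_real ((norm z)\<^sup>2)"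
      by (simp add: cinner_diff_left cinner_scaleC_left cinner_self)
    then show ?thesis
      using z0 by (simp add: y_def cinner_scaleC_right field_simps)
  qed
  moreover have "y \<in> V" using zV sV by (simp add: y_def complex_vector.subspace_scale)
  ultimately show ?thesis using that by blast
qed


section \<open>Bounded operators\<close>

text \<open>Two sequences instead of a map: in the applications \<open>s n\<close> and
  \<open>a n\<close> are linked only through a linear relation, for instance defect vectors and
  their boundary values.\<close>

lemma Cauchy_of_Lipschitz:
  fixes s :: "nat \<Rightarrow> 'a::real_normed_vector" and a :: "nat \<Rightarrow> 'b::real_normed_vector"
  assumes a: "Cauchy a" and le: "\<And>m n. norm (s m - s n) \<le> B * norm (a m - a n)"
  shows "Cauchy s"
proof (rule metric_CauchyI)
  fix e :: real assume "e > 0"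
  then have "e / (\<bar>B\<bar> + 1) > 0" by simp
  then obtain N where N: "\<And>m n. m \<ge> N \<Longrightarrow> n \<ge> N \<Longrightarrow> dist (a m) (a n) < e / (\<bar>B\<bar> + 1)"
    using a unfolding Cauchy_def by blast
  have "dist (s m) (s n) < e" if "m \<ge> N" "n \<ge> N" for m n
  proof -
    have "dist (s m) (s n) \<le> (\<bar>B\<bar> + 1) * norm (a m - a n)"
      using order_trans[OF le[of m n] mult_right_mono[of B "\<bar>B\<bar> + 1"]] by (simp add: dist_norm)
    also have "\<dots> < e" using N[OF that] by (simp add: dist_norm field_simps)
    finally show ?thesis .
  qed
  then show "\<exists>N. \<forall>m\<ge>N. \<forall>n\<ge>N. dist (s m) (s n) < e" by blast
qed

text \<open>By Baire some sublevel set contains a ball, and homogeneity spreads the bound. This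
  takes the place of the closed graph theorem, for the boundary maps and for the inverse of a
  symmetric operator on its range.\<close>

lemma seminorm_bounded_of_closed_sublevels:
  fixes V :: "'a::complex_inner set" and p :: "'a \<Rightarrow> real"
  assumes V: "hilbert_space V"
    and diff: "\<And>x y. x \<in> V \<Longrightarrow> y \<in> V \<Longrightarrow> p (x - y) \<le> p x + p y"
    and scale: "\<And>r x. x \<in> V \<Longrightarrow> p (r *\<^sub>R x) = \<bar>r\<bar> * p x"
    and cl: "\<And>n::nat. closed {x \<in> V. p x \<le> real n}"
  obtains C where "C \<ge> 0" "\<And>x. x \<in> V \<Longrightarrow> p x \<le> C * norm x"
proof -
  \<comment> \<open>Baire is applied inside the carrier \<open>V\<close>, since the whole type need
    not be complete.\<close>
  interpret V: Metric_space V dist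
    by unfold_locales (auto simp: dist_commute dist_triangle)
  have sV: "complex_vector.subspace V" and cV: "complete V"
    using V by (auto simp: hilbert_space_def)
  have mc: "V.mcomplete"
    unfolding V.mcomplete_def
  proof (intro allI impI)
    fix s :: "nat \<Rightarrow> 'a" assume s: "V.MCauchy s"
    then have "\<forall>n. s n \<in> V" "Cauchy s" by (auto simp: V.MCauchy_def Cauchy_def)
    then obtain l where "l \<in> V" "s \<longlonglongrightarrow> l" using cV unfolding complete_def by blast
    then show "\<exists>x. limitin V.mtopology s x sequentially"
      using \<open>\<forall>n. s n \<in> V\<close> by (auto simp: V.limitin_metric tendsto_iff)
  qed
  define B where "B n = {x \<in> V. p x \<le> real n}" for n :: nat
  have clB: "closedin V.mtopology (B n)" for n
  proof -
    have "l \<in> B n" if "range s \<subseteq> B n" "limitin V.mtopology s l sequentially" for s l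
    proof -
      have "s \<longlonglongrightarrow> l"
        using that(2) by (auto simp: V.limitin_metric tendsto_iff elim: eventually_mono)
      then show ?thesis
        using cl[of n] that(1) unfolding closed_sequential_limits B_def[symmetric] by blast
    qed
    moreover have "B n \<subseteq> V" by (auto simp: B_def)
    ultimately show ?thesis
      unfolding V.metric_closedin_iff_sequentially_closed by blast
  qed
  have UB: "\<Union>(range B) = V"
    using real_arch_simple by (fastforce simp: B_def)
  have "V.mtopology interior_of V \<noteq> {}"
    using sV complex_vector.subspace_0 interior_of_topspace[of V.mtopology] by auto
  then have "\<not> (\<forall>n. V.mtopology interior_of (B n) = {})"
    using V.metric_Baire_category_alt[of "range B", OF mc] clB unfolding UB by auto
  then obtain n where "V.mtopology interior_of (B n) \<noteq> {}" by blast
  then obtain a where a: "a \<in> V.mtopology interior_of (B n)" by blast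
  have "openin V.mtopology (V.mtopology interior_of (B n))" by simp
  then obtain r where "r > 0" "V.mball a r \<subseteq> V.mtopology interior_of (B n)" "a \<in> V"
    using a unfolding V.openin_mtopology by blast
  then have r: "r > 0" "V.mball a r \<subseteq> B n" "a \<in> V"
    using interior_of_subset[of V.mtopology "B n"] by auto
  have "p x \<le> (4 * real n / r) * norm x" if x: "x \<in> V" for x
  proof (cases "x = 0")
    case True
    then show ?thesis using scale[OF x, of 0] by simp
  next
    case False
    \<comment> \<open>Scaling \<open>x\<close> to length r/2 keeps \<open>a + c *\<^sub>R x\<close>
      in the ball; subtracting the centre costs a second \<open>n\<close>, whence the constant
      4n/r.\<close>
    define c where "c = r / (2 * norm x)"
    have c: "c > 0" using False r by (simp add: c_def)
    have cx: "c *\<^sub>R x \<in> V"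
      unfolding scaleR_scaleC using sV x by (rule complex_vector.subspace_scale)
    then have ac: "a + c *\<^sub>R x \<in> V"
      using sV r by (simp add: complex_vector.subspace_add)
    have "dist a (a + c *\<^sub>R x) = r / 2" using False r by (simp add: dist_norm c_def)
    then have "a + c *\<^sub>R x \<in> B n" "a \<in> B n" using r ac by auto
    then have "p (a + c *\<^sub>R x - a) \<le> 2 * real n"
      using diff[OF ac r(3)] by (simp add: B_def)
    then have "c * p x \<le> 2 * real n" using scale[OF x] c by simp
    then show ?thesis using c False r by (simp add: c_def field_simps)
  qed
  then show ?thesis using that[of "4 * real n / r"] r by simp
qed

text \<open>Estimates are carried out with functions, whose values off \<open>H\<close> are
  irrelevant; \<open>graph_on\<close> turns them back into the relations of the statement.\<close>

definition bounded_on :: "'a::complex_inner set \<Rightarrow> 'b::complex_inner set \<Rightarrow> ('a \<Rightarrow> 'b) \<Rightarrow> bool"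
  where "bounded_on H K f \<longleftrightarrow>
    clinear_on H f \<and> f ` H \<subseteq> K \<and> (\<exists>C. \<forall>x\<in>H. norm (f x) \<le> C * norm x)"

definition graph_on :: "'a set \<Rightarrow> ('a \<Rightarrow> 'b) \<Rightarrow> ('a \<times> 'b) set"
  where "graph_on H f = (\<lambda>x. (x, f x)) ` H"

lemma bounded_onI:
  assumes "\<And>x y. x \<in> H \<Longrightarrow> y \<in> H \<Longrightarrow> f (x + y) = f x + f y"
    and "\<And>c x. x \<in> H \<Longrightarrow> f (c *\<^sub>C x) = c *\<^sub>C f x"
    and "\<And>x. x \<in> H \<Longrightarrow> f x \<in> K" and "\<And>x. x \<in> H \<Longrightarrow> norm (f x) \<le> C * norm x"
  shows "bounded_on H K f"
  using assms unfolding bounded_on_def clinear_on_def by blast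

lemma bounded_onD:
  assumes "bounded_on H K f"
  shows "clinear_on H f" "\<And>x. x \<in> H \<Longrightarrow> f x \<in> K"
    "\<And>x y. x \<in> H \<Longrightarrow> y \<in> H \<Longrightarrow> f (x + y) = f x + f y"
    "\<And>c x. x \<in> H \<Longrightarrow> f (c *\<^sub>C x) = c *\<^sub>C f x"
  using assms by (auto simp: bounded_on_def clinear_on_def)

lemma bounded_on_bound:
  assumes "bounded_on H K f"
  obtains C where "C > 0" "\<And>x. x \<in> H \<Longrightarrow> norm (f x) \<le> C * norm x"
proof -
  obtain C where C: "\<forall>x\<in>H. norm (f x) \<le> C * norm x" using assms by (auto simp: bounded_on_def)
  have "norm (f x) \<le> max C 1 * norm x" if "x \<in> H" for x
    using order_trans[OF C[rule_format, OF that] mult_right_mono[of C "max C 1" "norm x"]] by simp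
  then show ?thesis using that[of "max C 1"] by auto
qed

lemma subspace_image:
  assumes S: "complex_vector.subspace S" and f: "clinear_on S f"
  shows "complex_vector.subspace (f ` S)"
proof (rule complex_vector.subspaceI)
  show "0 \<in> f ` S"
    using clinear_on_zero[OF f S] complex_vector.subspace_0[OF S] by force
  fix x y assume "x \<in> f ` S" "y \<in> f ` S"
  then obtain a b where ab: "x = f a" "y = f b" "a \<in> S" "b \<in> S" by blast
  then have "x + y = f (a + b)" using f by (simp add: clinear_on_def)
  then show "x + y \<in> f ` S" using complex_vector.subspace_add[OF S ab(3,4)] by blast
next
  fix c x assume "x \<in> f ` S"
  then obtain a where a: "x = f a" "a \<in> S" by blast
  then have "c *\<^sub>C x = f (c *\<^sub>C a)" using f by (simp add: clinear_on_def)
  then show "c *\<^sub>C x \<in> f ` S" using complex_vector.subspace_scale[OF S a(2)] by blast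
qed

lemma bounded_on_comp:
  assumes "bounded_on H K f" "bounded_on K L g"
  shows "bounded_on H L (\<lambda>x. g (f x))"
proof -
  obtain C where C: "\<And>x. x \<in> H \<Longrightarrow> norm (f x) \<le> C * norm x"
    using bounded_on_bound[OF assms(1)] by blast
  obtain D where D: "D > 0" "\<And>x. x \<in> K \<Longrightarrow> norm (g x) \<le> D * norm x"
    using bounded_on_bound[OF assms(2)] by blast
  have "norm (g (f x)) \<le> (D * C) * norm x" if "x \<in> H" for x
    using order_trans[OF D(2)[OF bounded_onD(2)[OF assms(1) that]]]
      mult_left_mono[OF C[OF that], of D] D(1)
    by (simp add: mult.assoc)
  then show ?thesis
    by (intro bounded_onI[where C = "D * C"])
      (simp_all add: bounded_onD[OF assms(1)] bounded_onD[OF assms(2)])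
qed

lemma bounded_on_add:
  assumes "bounded_on H K f" "bounded_on H K g" "complex_vector.subspace K"
  shows "bounded_on H K (\<lambda>x. f x + g x)"
proof -
  obtain C where C: "\<And>x. x \<in> H \<Longrightarrow> norm (f x) \<le> C * norm x"
    using bounded_on_bound[OF assms(1)] by blast
  obtain D where D: "\<And>x. x \<in> H \<Longrightarrow> norm (g x) \<le> D * norm x"
    using bounded_on_bound[OF assms(2)] by blast
  have "norm (f x + g x) \<le> (C + D) * norm x" if "x \<in> H" for x
    using norm_triangle_le[OF add_mono[OF C[OF that] D[OF that]]] by (simp add: algebra_simps)
  then show ?thesis
    by (intro bounded_onI[where C = "C + D"])
      (simp_all add: bounded_onD[OF assms(1)] bounded_onD[OF assms(2)]
        scaleC_add_right complex_vector.subspace_add assms(3))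
qed

lemma bounded_on_scaleC:
  assumes "bounded_on H K f" "complex_vector.subspace K"
  shows "bounded_on H K (\<lambda>x. c *\<^sub>C f x)"
proof -
  obtain C where C: "\<And>x. x \<in> H \<Longrightarrow> norm (f x) \<le> C * norm x"
    using bounded_on_bound[OF assms(1)] by blast
  have "norm (c *\<^sub>C f x) \<le> (cmod c * C) * norm x" if "x \<in> H" for x
    using mult_left_mono[OF C[OF that], of "cmod c"] by (simp add: norm_scaleC mult.assoc)
  then show ?thesis
    by (intro bounded_onI[where C = "cmod c * C"]) (simp_all add: bounded_onD[OF assms(1)] scaleC_add_right scaleC_scaleC
        mult.commute complex_vector.subspace_scale assms(2))
qed

lemma bounded_on_ident: "bounded_on H H (\<lambda>x. x)"
  unfolding bounded_on_def clinear_on_def by (auto intro: exI[of _ 1])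

lemma graph_on_bounded_ops:
  assumes H: "complex_vector.subspace H" and f: "bounded_on H K f"
  shows "graph_on H f \<in> bounded_ops H K"
proof -
  have "complex_vector.subspace (graph_on H f)"
  proof (rule complex_vector.subspaceI)
    show "0 \<in> graph_on H f"
      using complex_vector.subspace_0[OF H] clinear_on_zero[OF bounded_onD(1)[OF f] H]
      unfolding graph_on_def zero_prod_def by force
    fix x y assume "x \<in> graph_on H f" "y \<in> graph_on H f"
    then obtain a b where "x = (a, f a)" "y = (b, f b)" "a \<in> H" "b \<in> H"
      unfolding graph_on_def by auto
    then show "x + y \<in> graph_on H f"
      using bounded_onD(1)[OF f] complex_vector.subspace_add[OF H]
      unfolding graph_on_def clinear_on_def by (intro image_eqI[of _ _ "a + b"]) auto
  next
    fix c x assume "x \<in> graph_on H f"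
    then obtain a where "x = (a, f a)" "a \<in> H" unfolding graph_on_def by auto
    then show "c *\<^sub>C x \<in> graph_on H f"
      using bounded_onD(1)[OF f] complex_vector.subspace_scale[OF H]
      unfolding graph_on_def clinear_on_def
      by (intro image_eqI[of _ _ "c *\<^sub>C a"]) (auto simp: scaleC_prod_def)
  qed
  then show ?thesis
    using f unfolding bounded_ops_def linear_relation_def graph_on_def bounded_on_def
    by (auto simp: single_valued_def)
qed

lemma bounded_opsE:
  assumes "S \<in> bounded_ops H K"
  obtains f where "bounded_on H K f" "S = graph_on H f"
proof -
  have S: "S \<subseteq> H \<times> K" "complex_vector.subspace S" "single_valued S" "Domain S = H"
    using assms by (auto simp: bounded_ops_def linear_relation_def)
  obtain C where C: "\<And>x y. (x, y) \<in> S \<Longrightarrow> norm y \<le> C * norm x"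
    using assms by (auto simp: bounded_ops_def)
  have "\<forall>x\<in>H. \<exists>y. (x, y) \<in> S" using S(4) by blast
  then obtain f where f: "\<And>x. x \<in> H \<Longrightarrow> (x, f x) \<in> S" by metis
  have Sf: "y = f x" if "(x, y) \<in> S" for x y
    using that f S unfolding single_valued_def by blast
  have "f (x + y) = f x + f y" if "x \<in> H" "y \<in> H" for x y
    using complex_vector.subspace_add[OF S(2) f[OF that(1)] f[OF that(2)]] Sf by simp
  moreover have "f (c *\<^sub>C x) = c *\<^sub>C f x" if "x \<in> H" for c x
    using complex_vector.subspace_scale[OF S(2) f[OF that], of c] Sf by (simp add: scaleC_prod_def)
  ultimately have "bounded_on H K f"
    using f S(1) C unfolding bounded_on_def clinear_on_def by blast
  moreover have "S = graph_on H f"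
    using S f Sf unfolding graph_on_def by auto
  ultimately show ?thesis using that by blast
qed

lemma graph_on_relcomp:
  assumes "f ` H \<subseteq> K"
  shows "graph_on H f O graph_on K g = graph_on H (\<lambda>x. g (f x))"
  using assms unfolding graph_on_def by force

lemma rel_diff_graph_on: "rel_diff (graph_on H f) (graph_on H g) = graph_on H (\<lambda>x. f x - g x)"
  unfolding graph_on_def rel_diff_def by auto

lemma graph_on_cong: "(\<And>x. x \<in> H \<Longrightarrow> f x = g x) \<Longrightarrow> graph_on H f = graph_on H g"
  unfolding graph_on_def by (rule image_cong) auto

lemma hilbert_space_separation:
  assumes "complex_vector.subspace H" "x \<in> H" "y \<in> H" "\<And>z. z \<in> H \<Longrightarrow> cinner z x = cinner z y"
  shows "x = y"
proof -
  have "x - y \<in> H" using assms by (simp add: complex_vector.subspace_diff)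
  then have "cinner (x - y) (x - y) = 0" using assms(4) by (simp add: cinner_diff_right)
  then show ?thesis by simp
qed

text \<open>Riesz gives each \<open>g y\<close> separately; uniqueness of the representing vector
  makes \<open>g\<close> linear, and testing with \<open>x = g y\<close> bounds it.\<close>

lemma bounded_on_adjoint:
  assumes H: "hilbert_space H" and K: "complex_vector.subspace K" and f: "bounded_on H K f"
  obtains g where "bounded_on K H g" "\<And>x y. x \<in> H \<Longrightarrow> y \<in> K \<Longrightarrow> cinner (f x) y = cinner x (g y)"
proof -
  have sH: "complex_vector.subspace H" using H by (simp add: hilbert_space_def)
  obtain C where C: "C > 0" "\<And>x. x \<in> H \<Longrightarrow> norm (f x) \<le> C * norm x"
    using bounded_on_bound[OF f] by blast
  have cC: "cmod (cinner (f x) y) \<le> (C * norm y) * norm x" if "x \<in> H" for x y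
    using norm_cinner_le[of "f x" y] mult_right_mono[OF C(2)[OF that], of "norm y"]
    by (simp add: mult_ac)
  have "\<exists>z\<in>H. \<forall>x\<in>H. cinner (f x) y = cinner x z" for y
  proof -
    have "clinear_on H (\<lambda>x. cinner (f x) y)"
      using bounded_onD(1)[OF f] unfolding clinear_on_def
      by (simp add: cinner_add_left cinner_scaleC_left scaleC_complex_def)
    then show ?thesis using riesz_representation[OF H _ cC, of y] by metis
  qed
  then obtain g where g: "\<And>y. g y \<in> H" "\<And>x y. x \<in> H \<Longrightarrow> cinner (f x) y = cinner x (g y)"
    by metis
  have "norm (g y) \<le> C * norm y" for y
  proof (cases "g y = 0")
    case False
    have "complex_of_real ((norm (g y))\<^sup>2) = cinner (f (g y)) y"
      using g by (simp add: cinner_self)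
    then have "(norm (g y))\<^sup>2 = cmod (cinner (f (g y)) y)"
      by (metis abs_of_nonneg norm_of_real zero_le_power2)
    also have "\<dots> \<le> (C * norm y) * norm (g y)" using cC[OF g(1)] .
    finally show ?thesis using False by (simp add: power2_eq_square)
  qed (use C in simp)
  moreover have "g (x + y) = g x + g y" for x y
    by (rule hilbert_space_separation[OF sH])
      (use g sH in \<open>auto simp: complex_vector.subspace_add cinner_add_right simp flip: g(2)\<close>)
  moreover have "g (c *\<^sub>C x) = c *\<^sub>C g x" for c x
    by (rule hilbert_space_separation[OF sH])
      (use g sH in \<open>auto simp: complex_vector.subspace_scale cinner_scaleC_right simp flip: g(2)\<close>)
  ultimately have "bounded_on K H g"
    using g(1) unfolding bounded_on_def clinear_on_def by blast
  then show ?thesis using g(2) that by blast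
qed

lemma rel_adjoint_graph_on:
  assumes "complex_vector.subspace H" "f ` H \<subseteq> K" "g ` K \<subseteq> H"
    and "\<And>x y. x \<in> H \<Longrightarrow> y \<in> K \<Longrightarrow> cinner (f x) y = cinner x (g y)"
  shows "rel_adjoint H K (graph_on H f) = graph_on K g"
proof
  show "graph_on K g \<subseteq> rel_adjoint H K (graph_on H f)"
    using assms unfolding graph_on_def rel_adjoint_def by auto
  show "rel_adjoint H K (graph_on H f) \<subseteq> graph_on K g"
  proof
    fix z assume "z \<in> rel_adjoint H K (graph_on H f)"
    then obtain y x where z: "z = (y, x)" "y \<in> K" "x \<in> H" "\<And>u. u \<in> H \<Longrightarrow> cinner (f u) y = cinner u x"
      unfolding rel_adjoint_def graph_on_def by auto
    have "x = g y"
    proof (rule hilbert_space_separation[OF assms(1) z(3)])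
      show "g y \<in> H" using z(2) assms(3) by blast
      show "cinner u x = cinner u (g y)" if "u \<in> H" for u
        using z(4)[OF that] assms(4)[OF that z(2)] by simp
    qed
    then show "z \<in> graph_on K g" using z unfolding graph_on_def by auto
  qed
qed


section \<open>Self-adjoint relations\<close>

lemma dense_of_orthogonal_trivial:
  assumes H: "hilbert_space H" and W: "W \<subseteq> H" "complex_vector.subspace W"
    and triv: "\<And>y. y \<in> H \<Longrightarrow> (\<And>w. w \<in> W \<Longrightarrow> cinner w y = 0) \<Longrightarrow> y = 0"
  shows "H \<subseteq> closure W"
proof
  fix x assume x: "x \<in> H"
  have cW: "hilbert_space (closure W)" by (rule hilbert_space_closure[OF H W])
  have cWH: "closure W \<subseteq> H"
    using H W closure_minimal complete_imp_closed unfolding hilbert_space_def by blast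
  obtain w where w: "w \<in> closure W" "\<And>v. v \<in> closure W \<Longrightarrow> cinner (x - w) v = 0"
    using hilbert_space_projection[OF cW] by blast
  have "x - w \<in> H"
    using H x w cWH by (auto simp: hilbert_space_def intro: complex_vector.subspace_diff)
  then have "x - w = 0"
    using w(2) closure_subset cinner_eq_0_commute by (intro triv) blast+
  then show "x \<in> closure W" using w by simp
qed

lemma subspace_Domain:
  fixes L :: "('a::complex_inner \<times> 'b::complex_inner) set"
  assumes sL: "complex_vector.subspace L"
  shows "complex_vector.subspace (Domain L)"
proof (rule complex_vector.subspaceI)
  show "0 \<in> Domain L" using complex_vector.subspace_0[OF sL] unfolding zero_prod_def by blast
  fix x y assume "x \<in> Domain L" "y \<in> Domain L"
  then obtain a b where "(x, a) \<in> L" "(y, b) \<in> L" by blast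
  then have "(x + y, a + b) \<in> L"
    using complex_vector.subspace_add[OF sL, of "(x, a)" "(y, b)"] by simp
  then show "x + y \<in> Domain L" by blast
next
  fix c x assume "x \<in> Domain L"
  then obtain a where "(x, a) \<in> L" by blast
  then have "(c *\<^sub>C x, c *\<^sub>C a) \<in> L"
    using complex_vector.subspace_scale[OF sL, of "(x, a)" c] by (simp add: scaleC_prod_def)
  then show "c *\<^sub>C x \<in> Domain L" by blast
qed

text \<open>The bound makes the closure of \<open>L\<close> an operator on a closed domain
  \<open>D\<close>; composing with the orthogonal projection onto \<open>D\<close> defines it
  everywhere, also when \<open>D\<close> is a proper subspace. The last clause recovers
  \<open>L\<close> itself when \<open>L\<close> is closed with dense domain.\<close>

lemma bounded_extension:
  fixes L :: "('a::complex_inner \<times> 'b::complex_inner) set"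
  assumes G: "hilbert_space G" and K: "hilbert_space K" and L: "L \<subseteq> G \<times> K" "complex_vector.subspace L"
    and bd: "\<And>x y. (x, y) \<in> L \<Longrightarrow> norm y \<le> C * norm x"
  obtains X where "bounded_on G K X" "\<And>x y. (x, y) \<in> L \<Longrightarrow> X x = y"
    "\<And>x. x \<in> closure (Domain L) \<Longrightarrow> (x, X x) \<in> closure L"
proof -
  define D where "D = Domain (closure L)"
  \<comment> \<open>\<open>y\<close> is the value of the closure of \<open>L\<close> at the
    orthogonal projection \<open>d\<close> of \<open>x\<close> onto \<open>D\<close>.\<close>
  define E where "E x y \<longleftrightarrow> (\<exists>d. (d, y) \<in> closure L \<and> (\<forall>v\<in>D. cinner (x - d) v = 0))" for x y
  have hGK: "hilbert_space (G \<times> K)" using G K by (rule hilbert_space_Times)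
  have hL: "hilbert_space (closure L)" by (rule hilbert_space_closure[OF hGK L])
  have sL: "complex_vector.subspace (closure L)" using hL by (simp add: hilbert_space_def)
  have LGK: "closure L \<subseteq> G \<times> K"
    using hGK L(1) closure_minimal complete_imp_closed unfolding hilbert_space_def by blast
  define C' where "C' = max C 0"
  have C': "C' \<ge> 0" "C \<le> C'" by (auto simp: C'_def)
  have bd': "norm y \<le> C' * norm x" if "(x, y) \<in> closure L" for x y
  proof -
    have "closed {z :: 'a \<times> 'b. norm (snd z) \<le> C' * norm (fst z)}"
      by (intro closed_Collect_le continuous_intros)
    moreover have "L \<subseteq> {z. norm (snd z) \<le> C' * norm (fst z)}"
      using bd order_trans[OF _ mult_right_mono[OF C'(2)]] by fastforce
    ultimately have "closure L \<subseteq> {z. norm (snd z) \<le> C' * norm (fst z)}"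
      by (rule closure_minimal[rotated])
    then show ?thesis using that by auto
  qed
  have sD: "complex_vector.subspace D"
    unfolding D_def by (rule subspace_Domain[OF sL])
  \<comment> \<open>The bound turns Cauchy first components into Cauchy pairs, so completeness of
    the graph passes to its domain.\<close>
  have "complete D"
    unfolding complete_def
  proof (intro allI impI)
    fix s assume s: "(\<forall>n. s n \<in> D) \<and> Cauchy s"
    then have "\<forall>n. \<exists>y. (s n, y) \<in> closure L" unfolding D_def by blast
    then obtain t where t: "\<And>n. (s n, t n) \<in> closure L" by metis
    have "Cauchy (\<lambda>n. (s n, t n))"
    proof (rule Cauchy_of_Lipschitz[where B = "1 + C'"])
      show "Cauchy s" using s by blast
      fix m n
      have "(s m - s n, t m - t n) \<in> closure L"
        using complex_vector.subspace_diff[OF sL t[of m] t[of n]] by simp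
      then have "norm (t m - t n) \<le> C' * norm (s m - s n)" by (rule bd')
      then show "norm ((s m, t m) - (s n, t n)) \<le> (1 + C') * norm (s m - s n)"
        using norm_Pair_le[of "s m - s n" "t m - t n"] by (simp add: algebra_simps)
    qed
    then obtain l where l: "l \<in> closure L" "(\<lambda>n. (s n, t n)) \<longlonglongrightarrow> l"
      using hL t unfolding hilbert_space_def complete_def by meson
    then have "s \<longlonglongrightarrow> fst l" using tendsto_fst[OF l(2)] by simp
    moreover have "fst l \<in> D" using l(1) unfolding D_def by (metis Domain.DomainI prod.collapse)
    ultimately show "\<exists>l\<in>D. s \<longlonglongrightarrow> l" by blast
  qed
  then have hD: "hilbert_space D" using sD by (simp add: hilbert_space_def)
  have ex: "\<exists>y. E x y" for x
  proof -
    obtain d where "d \<in> D" "\<And>v. v \<in> D \<Longrightarrow> cinner (x - d) v = 0"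
      using hilbert_space_projection[OF hD] by blast
    then show ?thesis unfolding E_def D_def by blast
  qed
  have uniq: "y = y'" if e: "E x y" "E x y'" for x y y'
  proof -
    obtain d d' where d: "(d, y) \<in> closure L" "\<And>v. v \<in> D \<Longrightarrow> cinner (x - d) v = 0"
      "(d', y') \<in> closure L" "\<And>v. v \<in> D \<Longrightarrow> cinner (x - d') v = 0"
      using e unfolding E_def by blast
    have dd: "(d - d', y - y') \<in> closure L"
      using complex_vector.subspace_diff[OF sL d(1,3)] by simp
    then have "d - d' \<in> D" unfolding D_def by blast
    then have "cinner (x - d') (d - d') - cinner (x - d) (d - d') = 0" using d by simp
    then have "cinner (d - d') (d - d') = 0" by (simp flip: cinner_diff_left)
    then show ?thesis using bd'[OF dd] by simp
  qed
  obtain X where X: "\<And>x. E x (X x)" using ex by metis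
  have XE: "X x = y" if "E x y" for x y using uniq[OF X that] .
  have EL: "E x y" if "(x, y) \<in> closure L" for x y
    using that unfolding E_def by (intro exI[of _ x]) simp
  have "bounded_on G K X"
  proof (rule bounded_onI[where C = C'])
    fix x z
    obtain d e where d: "(d, X x) \<in> closure L" "\<And>v. v \<in> D \<Longrightarrow> cinner (x - d) v = 0"
      "(e, X z) \<in> closure L" "\<And>v. v \<in> D \<Longrightarrow> cinner (z - e) v = 0"
      using X[of x] X[of z] unfolding E_def by blast
    have "(d + e, X x + X z) \<in> closure L"
      using complex_vector.subspace_add[OF sL d(1,3)] by simp
    moreover have "cinner (x + z - (d + e)) v = 0" if "v \<in> D" for v
      using d(2,4)[OF that] by (simp add: cinner_diff_left cinner_add_left)
    ultimately have "E (x + z) (X x + X z)" unfolding E_def by blast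
    then show "X (x + z) = X x + X z" by (rule XE)
  next
    fix c x
    obtain d where d: "(d, X x) \<in> closure L" "\<And>v. v \<in> D \<Longrightarrow> cinner (x - d) v = 0"
      using X[of x] unfolding E_def by blast
    have "(c *\<^sub>C d, c *\<^sub>C X x) \<in> closure L"
      using complex_vector.subspace_scale[OF sL d(1), of c] by (simp add: scaleC_prod_def)
    moreover have "cinner (c *\<^sub>C x - c *\<^sub>C d) v = 0" if "v \<in> D" for v
      using d(2)[OF that] by (simp add: cinner_diff_left cinner_scaleC_left)
    ultimately have "E (c *\<^sub>C x) (c *\<^sub>C X x)" unfolding E_def by blast
    then show "X (c *\<^sub>C x) = c *\<^sub>C X x" by (rule XE)
  next
    fix x
    obtain d where d: "(d, X x) \<in> closure L" "\<And>v. v \<in> D \<Longrightarrow> cinner (x - d) v = 0"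
      using X[of x] unfolding E_def by blast
    show "X x \<in> K" using d(1) LGK by blast
    have "d \<in> D" using d(1) unfolding D_def by blast
    then have "cinner d d = cinner x d" using d(2)[of d] by (simp add: cinner_diff_left)
    then have "(norm d)\<^sup>2 = cmod (cinner x d)"
      unfolding cinner_self by (metis abs_of_nonneg norm_of_real zero_le_power2)
    also have "\<dots> \<le> norm x * norm d" by (rule norm_cinner_le)
    finally have "norm d \<le> norm x" by (cases "d = 0") (auto simp: power2_eq_square)
    then show "norm (X x) \<le> C' * norm x"
      using bd'[OF d(1)] mult_left_mono[of "norm d" "norm x" C'] C'(1) by linarith
  qed
  moreover have "X x = y" if "(x, y) \<in> L" for x y
    using that closure_subset[of L] by (intro XE EL) blast
  moreover have "(x, X x) \<in> closure L" if "x \<in> closure (Domain L)" for x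
  proof -
    have "Domain L \<subseteq> D" using closure_subset[of L] unfolding D_def by blast
    moreover have "closed D" using hD complete_imp_closed unfolding hilbert_space_def by blast
    ultimately have "x \<in> D" using that closure_minimal by blast
    then obtain y where "(x, y) \<in> closure L" unfolding D_def by blast
    then show ?thesis using XE[OF EL] by simp
  qed
  ultimately show ?thesis using that by blast
qed

text \<open>The two clauses say that \<open>R\<close> inverts \<open>S - l\<close> from both sides,
  in a form that makes sense for multivalued \<open>S\<close>.\<close>

definition is_resolvent :: "'u::complex_inner set \<Rightarrow> 'u lrel \<Rightarrow> complex \<Rightarrow> ('u \<Rightarrow> 'u) \<Rightarrow> bool"
  where "is_resolvent H S l R \<longleftrightarrow> bounded_on H H R \<and> (\<forall>h\<in>H. (R h, h + l *\<^sub>C R h) \<in> S) \<and>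
    (\<forall>f f'. (f, f') \<in> S \<longrightarrow> R (f' - l *\<^sub>C f) = f)"

lemma resolvent_iff: "(h, f) \<in> resolvent S l \<longleftrightarrow> (f, h + l *\<^sub>C f) \<in> S"
  unfolding resolvent_def rel_shift_def by (auto intro: exI[of _ "h + l *\<^sub>C f"])

lemma resolvent_setE:
  assumes "l \<in> resolvent_set H S"
  obtains R where "is_resolvent H S l R" "resolvent S l = graph_on H R"
proof -
  obtain R where R: "bounded_on H H R" "resolvent S l = graph_on H R"
    using assms bounded_opsE unfolding resolvent_set_def by blast
  have "(R h, h + l *\<^sub>C R h) \<in> S" if "h \<in> H" for h
    using that R(2) unfolding resolvent_iff[symmetric] by (auto simp: graph_on_def)
  moreover have "R (f' - l *\<^sub>C f) = f" if "(f, f') \<in> S" for f f'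
  proof -
    have "(f' - l *\<^sub>C f, f) \<in> resolvent S l" using that by (simp add: resolvent_iff)
    then show ?thesis unfolding R(2) graph_on_def by auto
  qed
  ultimately show ?thesis using R that unfolding is_resolvent_def by blast
qed

lemma self_adjointD:
  assumes "self_adjoint_relation H S"
  shows "S \<subseteq> H \<times> H" "complex_vector.subspace S"
    "\<And>f f' g g'. (f, f') \<in> S \<Longrightarrow> (g, g') \<in> S \<Longrightarrow> cinner f' g = cinner f g'"
    "\<And>g g'. g \<in> H \<Longrightarrow> g' \<in> H \<Longrightarrow> (\<And>f f'. (f, f') \<in> S \<Longrightarrow> cinner f' g = cinner f g') \<Longrightarrow> (g, g') \<in> S"
proof -
  have eq: "S = rel_adjoint H H S" and "S \<subseteq> H \<times> H" "complex_vector.subspace S"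
    using assms by (auto simp only: self_adjoint_relation_def linear_relation_def)
  then show "S \<subseteq> H \<times> H" "complex_vector.subspace S" by blast+
  have iff: "(g, g') \<in> S \<longleftrightarrow>
      g \<in> H \<and> g' \<in> H \<and> (\<forall>(f, f')\<in>S. cinner f' g = cinner f g')" for g g'
    using arg_cong[OF eq, of "\<lambda>X. (g, g') \<in> X"] by (simp add: rel_adjoint_def)
  show "cinner f' g = cinner f g'" if "(f, f') \<in> S" "(g, g') \<in> S" for f f' g g'
    using that(1) that(2)[unfolded iff] by blast
  show "(g, g') \<in> S"
    if "g \<in> H" "g' \<in> H" "\<And>f f'. (f, f') \<in> S \<Longrightarrow> cinner f' g = cinner f g'" for g g'
    unfolding iff using that by blast
qed

text \<open>The adjoint is cut out by conditions that are continuous in the pair. Completeness of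
  A_0 and of the extensions is what lets the Baire argument run on them.\<close>

lemma self_adjoint_closed:
  assumes H: "hilbert_space H" and S: "self_adjoint_relation H S"
  shows "hilbert_space S"
proof (rule hilbert_space_closed_subspace[OF hilbert_space_Times[OF H H]])
  show "closed S"
    unfolding closed_sequential_limits
  proof (intro allI impI)
    fix s l assume s: "(\<forall>n. s n \<in> S) \<and> s \<longlonglongrightarrow> l"
    have l1: "(\<lambda>n. fst (s n)) \<longlonglongrightarrow> fst l" and l2: "(\<lambda>n. snd (s n)) \<longlonglongrightarrow> snd l"
      using s by (auto intro: tendsto_fst tendsto_snd)
    have "closed H" using H by (simp add: hilbert_space_def complete_imp_closed)
    moreover have "fst (s n) \<in> H" "snd (s n) \<in> H" for n
      using s self_adjointD(1)[OF S] by (metis mem_Times_iff subsetD)+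
    ultimately have lH: "fst l \<in> H" "snd l \<in> H"
      using closed_sequentially[OF _ _ l1] closed_sequentially[OF _ _ l2] by simp_all
    have "(fst l, snd l) \<in> S"
    proof (rule self_adjointD(4)[OF S lH])
      fix f f' assume f: "(f, f') \<in> S"
      have "(\<lambda>n. cinner f' (fst (s n))) \<longlonglongrightarrow> cinner f' (fst l)"
        "(\<lambda>n. cinner f (snd (s n))) \<longlonglongrightarrow> cinner f (snd l)"
        using l1 l2 by (auto intro: tendsto_cinner)
      moreover have "cinner f' (fst (s n)) = cinner f (snd (s n))" for n
        using self_adjointD(3)[OF S f, of "fst (s n)" "snd (s n)"] s by simp
      ultimately show "cinner f' (fst l) = cinner f (snd l)"
        using LIMSEQ_unique by fastforce
    qed
    then show "l \<in> S" by simp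
  qed
qed (use self_adjointD[OF S] in auto)

text \<open>The Hilbert space adjoint of \<open>R\<close> is the resolvent at the conjugate point.
  Conjugate points enter because Green's identity pairs elements at \<open>l\<close> with elements
  at \<open>cnj l\<close>.\<close>

lemma self_adjoint_resolvent_cnj:
  assumes H: "hilbert_space H" and S: "self_adjoint_relation H S" and R: "is_resolvent H S l R"
  obtains R' where "is_resolvent H S (cnj l) R'"
proof -
  have sH: "complex_vector.subspace H" using H by (simp add: hilbert_space_def)
  have R1: "bounded_on H H R" "\<And>h. h \<in> H \<Longrightarrow> (R h, h + l *\<^sub>C R h) \<in> S"
    "\<And>f f'. (f, f') \<in> S \<Longrightarrow> R (f' - l *\<^sub>C f) = f"
    using R unfolding is_resolvent_def by auto
  obtain Q where Q: "bounded_on H H Q" "\<And>x y. x \<in> H \<Longrightarrow> y \<in> H \<Longrightarrow> cinner (R x) y = cinner x (Q y)"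
    using bounded_on_adjoint[OF H sH R1(1)] by blast
  have "(Q k, k + cnj l *\<^sub>C Q k) \<in> S" if k: "k \<in> H" for k
  proof (rule self_adjointD(4)[OF S])
    show Qk: "Q k \<in> H" using bounded_onD(2)[OF Q(1)] k by blast
    then show "k + cnj l *\<^sub>C Q k \<in> H"
      using sH k by (simp add: complex_vector.subspace_add complex_vector.subspace_scale)
    fix f f' assume f: "(f, f') \<in> S"
    then have "f \<in> H" "f' \<in> H" using self_adjointD(1)[OF S] by auto
    then have "f' - l *\<^sub>C f \<in> H"
      using sH by (simp add: complex_vector.subspace_diff complex_vector.subspace_scale)
    then have "cinner f k = cinner (f' - l *\<^sub>C f) (Q k)"
      using Q(2)[OF _ k] R1(3)[OF f] by metis
    then show "cinner f' (Q k) = cinner f (k + cnj l *\<^sub>C Q k)"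
      by (simp add: cinner_diff_left cinner_scaleC_left cinner_add_right cinner_scaleC_right)
  qed
  moreover have "Q (g' - cnj l *\<^sub>C g) = g" if g: "(g, g') \<in> S" for g g'
  proof (rule hilbert_space_separation[OF sH])
    have gH: "g \<in> H" "g' \<in> H" using g self_adjointD(1)[OF S] by auto
    then have *: "g' - cnj l *\<^sub>C g \<in> H"
      using sH by (simp add: complex_vector.subspace_diff complex_vector.subspace_scale)
    then show "Q (g' - cnj l *\<^sub>C g) \<in> H" using bounded_onD(2)[OF Q(1)] by blast
    show "g \<in> H" by fact
    fix z assume z: "z \<in> H"
    have "cinner z (Q (g' - cnj l *\<^sub>C g)) = cinner (R z) (g' - cnj l *\<^sub>C g)"
      using Q(2)[OF z *] by simp
    also have "\<dots> = cinner (z + l *\<^sub>C R z) g - l * cinner (R z) g"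
      using self_adjointD(3)[OF S R1(2)[OF z] g]
      by (simp add: cinner_diff_right cinner_scaleC_right)
    also have "\<dots> = cinner z g" by (simp add: cinner_add_left cinner_scaleC_left)
    finally show "cinner z (Q (g' - cnj l *\<^sub>C g)) = cinner z g" .
  qed
  ultimately have "is_resolvent H S (cnj l) Q" using Q(1) unfolding is_resolvent_def by blast
  then show ?thesis using that by blast
qed

text \<open>Symmetry makes \<open>cinner f' f\<close> real, so
  \<open>cinner (f' - l *\<^sub>C f) f\<close> has imaginary part \<open>- Im l\<close> times the
  squared norm of \<open>f\<close>.\<close>

lemma self_adjoint_nonreal_bound:
  assumes S: "self_adjoint_relation H S" and f: "(f, f') \<in> S"
  shows "\<bar>Im l\<bar> * norm f \<le> norm (f' - l *\<^sub>C f)"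
proof (cases "f = 0")
  case False
  let ?g = "f' - l *\<^sub>C f"
  have "cinner f f' - cinner f ?g = cnj l * complex_of_real ((norm f)\<^sup>2)"
    by (simp add: cinner_diff_right cinner_scaleC_right cinner_self)
  moreover have "cinner f' f - cinner ?g f = l * complex_of_real ((norm f)\<^sup>2)"
    by (simp add: cinner_diff_left cinner_scaleC_left cinner_self)
  ultimately have "cinner f ?g - cinner ?g f = (l - cnj l) * complex_of_real ((norm f)\<^sup>2)"
    using self_adjointD(3)[OF S f f] by (simp add: algebra_simps)
  then have "cmod (cinner f ?g - cinner ?g f) = cmod (l - cnj l) * (norm f)\<^sup>2"
    by (simp add: norm_mult norm_power)
  moreover have "cmod (l - cnj l) = 2 * \<bar>Im l\<bar>"
    by (simp add: complex_diff_cnj norm_mult)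
  moreover have "cmod (cinner f ?g - cinner ?g f) \<le> 2 * (norm ?g * norm f)"
    using norm_triangle_ineq4[of "cinner f ?g" "cinner ?g f"] norm_cinner_le[of f ?g]
      norm_cinner_le[of ?g f] by (simp add: mult.commute)
  ultimately have "\<bar>Im l\<bar> * norm f * norm f \<le> norm ?g * norm f"
    by (simp add: power2_eq_square)
  then show ?thesis using False by simp
qed simp

text \<open>The lower bound makes the inverse of \<open>S - l\<close> a bounded closed operator. Its
  domain is dense: a nonzero vector orthogonal to it would be an eigenvector of \<open>S\<close> at
  \<open>cnj l\<close>, which the same bound excludes.\<close>

lemma self_adjoint_nonreal_resolvent:
  assumes H: "hilbert_space H" and S: "self_adjoint_relation H S" and l: "Im l \<noteq> 0"
  obtains R where "is_resolvent H S l R"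
proof -
  have sH: "complex_vector.subspace H" using H by (simp add: hilbert_space_def)
  define L where "L = {(g, f). (f, g + l *\<^sub>C f) \<in> S}"
  have LH: "L \<subseteq> H \<times> H"
  proof
    fix z assume "z \<in> L"
    then obtain g f where z: "z = (g, f)" "(f, g + l *\<^sub>C f) \<in> S" unfolding L_def by auto
    then have "f \<in> H" "g + l *\<^sub>C f \<in> H" using self_adjointD(1)[OF S] by auto
    then have "(g + l *\<^sub>C f) - l *\<^sub>C f \<in> H"
      using sH complex_vector.subspace_diff complex_vector.subspace_scale by blast
    then show "z \<in> H \<times> H" using z \<open>f \<in> H\<close> by simp
  qed
  have sL: "complex_vector.subspace L"
  proof (rule complex_vector.subspaceI)
    show "0 \<in> L" using complex_vector.subspace_0[OF self_adjointD(2)[OF S]]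
      unfolding L_def zero_prod_def by simp
    fix x y assume "x \<in> L" "y \<in> L"
    then obtain a b c d where "x = (a, b)" "y = (c, d)" "(b, a + l *\<^sub>C b) \<in> S" "(d, c + l *\<^sub>C d) \<in> S"
      unfolding L_def by auto
    then show "x + y \<in> L"
      using complex_vector.subspace_add[OF self_adjointD(2)[OF S], of "(b, a + l *\<^sub>C b)" "(d, c + l *\<^sub>C d)"]
      unfolding L_def by (simp add: scaleC_add_right add_ac)
  next
    fix c x assume "x \<in> L"
    then obtain a b where "x = (a, b)" "(b, a + l *\<^sub>C b) \<in> S"
      unfolding L_def by auto
    then show "c *\<^sub>C x \<in> L"
      using complex_vector.subspace_scale[OF self_adjointD(2)[OF S], of "(b, a + l *\<^sub>C b)" c]
      unfolding L_def by (simp add: scaleC_add_right scaleC_scaleC scaleC_prod_def mult.commute)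
  qed
  have "norm f \<le> (1 / \<bar>Im l\<bar>) * norm g" if "(g, f) \<in> L" for g f
    using self_adjoint_nonreal_bound[OF S, of f "g + l *\<^sub>C f" l] that l
    by (simp add: L_def field_simps)
  then obtain X where X: "bounded_on H H X" "\<And>x y. (x, y) \<in> L \<Longrightarrow> X x = y"
    "\<And>x. x \<in> closure (Domain L) \<Longrightarrow> (x, X x) \<in> closure L"
    using bounded_extension[OF H H LH sL] by blast
  have "closed L"
  proof -
    have "L = (\<lambda>z. (snd z, fst z + l *\<^sub>C snd z)) -` S" by (auto simp: L_def)
    moreover have "closed S"
      using self_adjoint_closed[OF H S] by (simp add: hilbert_space_def complete_imp_closed)
    moreover have "continuous_on UNIV (\<lambda>z :: 'a \<times> 'a. (snd z, fst z + l *\<^sub>C snd z))"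
      by (intro continuous_intros bounded_bilinear.continuous_on[OF bounded_bilinear_scaleC])
    ultimately show ?thesis using closed_vimage by metis
  qed
  have sD: "complex_vector.subspace (Domain L)" by (rule subspace_Domain[OF sL])
  have "H \<subseteq> closure (Domain L)"
  proof (rule dense_of_orthogonal_trivial[OF H _ sD])
    show "Domain L \<subseteq> H" using LH by auto
    fix y assume y: "y \<in> H" "\<And>w. w \<in> Domain L \<Longrightarrow> cinner w y = 0"
    have "(y, cnj l *\<^sub>C y) \<in> S"
    proof (rule self_adjointD(4)[OF S y(1)])
      show "cnj l *\<^sub>C y \<in> H" using sH y(1) by (rule complex_vector.subspace_scale)
      fix f f' assume "(f, f') \<in> S"
      then have "(f' - l *\<^sub>C f, f) \<in> L" by (simp add: L_def)
      then have "cinner (f' - l *\<^sub>C f) y = 0" using y(2) by blast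
      then show "cinner f' y = cinner f (cnj l *\<^sub>C y)"
        by (simp add: cinner_diff_left cinner_scaleC_left cinner_scaleC_right)
    qed
    then show "y = 0" using self_adjoint_nonreal_bound[OF S, of y "cnj l *\<^sub>C y" "cnj l"] l
      by (simp add: mult_le_0_iff)
  qed
  then have "(h, X h) \<in> L" if "h \<in> H" for h
    using X(3) that \<open>closed L\<close> by (metis closure_closed subsetD)
  moreover have "X (f' - l *\<^sub>C f) = f" if "(f, f') \<in> S" for f f'
    using that by (intro X(2)) (simp add: L_def)
  ultimately have "is_resolvent H S l X" using X(1) unfolding is_resolvent_def L_def by auto
  then show ?thesis using that by blast
qed


section \<open>Quasi boundary triples\<close>

text \<open>When \<open>R\<close> is the resolvent of \<open>S\<close> at \<open>l\<close>, this is
  the element of \<open>S\<close> whose shift by \<open>l\<close> has value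
  \<open>h\<close>.\<close>

definition res_hat :: "complex \<Rightarrow> ('u::complex_inner \<Rightarrow> 'u) \<Rightarrow> 'u \<Rightarrow> 'u \<times> 'u"
  where "res_hat l R h = (R h, h + l *\<^sub>C R h)"

lemma res_hat_in: "is_resolvent H S l R \<Longrightarrow> h \<in> H \<Longrightarrow> res_hat l R h \<in> S"
  by (simp add: is_resolvent_def res_hat_def)

lemma res_hat_bounded:
  assumes R: "is_resolvent H S l R"
  shows "bounded_on H S (res_hat l R)"
proof -
  have b: "bounded_on H H R" using R by (simp add: is_resolvent_def)
  then obtain C where C: "\<And>h. h \<in> H \<Longrightarrow> norm (R h) \<le> C * norm h"
    using bounded_on_bound by blast
  show ?thesis
  proof (rule bounded_onI[where C = "C + (1 + cmod l * C)"])
    fix h assume h: "h \<in> H"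
    have "norm (res_hat l R h) \<le> norm (R h) + (norm h + cmod l * norm (R h))"
      unfolding res_hat_def
      using norm_Pair_le[of "R h" "h + l *\<^sub>C R h"] norm_triangle_ineq[of h "l *\<^sub>C R h"]
      by (simp add: norm_scaleC)
    also have "\<dots> \<le> C * norm h + (norm h + cmod l * (C * norm h))"
      by (intro add_mono mult_left_mono C h) auto
    finally show "norm (res_hat l R h) \<le> (C + (1 + cmod l * C)) * norm h"
      by (simp add: algebra_simps)
    show "res_hat l R h \<in> S" by (rule res_hat_in[OF R h])
  qed (simp_all add: res_hat_def bounded_onD[OF b] scaleC_add_right scaleC_prod_def scaleC_scaleC
      mult.commute)
qed

locale quasi_triple =
  fixes H :: "'u::complex_inner set" and A :: "'u lrel" and G :: "'u set" and T :: "'u lrel"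
    and \<Gamma>0 \<Gamma>1 :: "'u \<times> 'u \<Rightarrow> 'u"
  assumes hilbert_H: "hilbert_space H" and qbt: "quasi_boundary_triple H A G T \<Gamma>0 \<Gamma>1"
begin

abbreviation "A0 \<equiv> ker_on T \<Gamma>0"

lemma hilbert_G: "hilbert_space G"
  and T_subset: "T \<subseteq> H \<times> H"
  and subspace_T: "complex_vector.subspace T"
  and Gamma0_in: "f \<in> T \<Longrightarrow> \<Gamma>0 f \<in> G"
  and Gamma1_in: "f \<in> T \<Longrightarrow> \<Gamma>1 f \<in> G"
  and clinear_Gamma0: "clinear_on T \<Gamma>0"
  and clinear_Gamma1: "clinear_on T \<Gamma>1"
  and Gamma_dense: "G \<times> G \<subseteq> closure ((\<lambda>f. (\<Gamma>0 f, \<Gamma>1 f)) ` T)"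
  and self_adjoint_A0: "self_adjoint_relation H A0"
  using qbt unfolding quasi_boundary_triple_def linear_relation_def by (simp_all add: image_subset_iff)

lemma A0_subset: "A0 \<subseteq> T"
  by (auto simp: ker_on_def)

lemma subspace_G: "complex_vector.subspace G" and subspace_H: "complex_vector.subspace H"
  using hilbert_G hilbert_H by (auto simp: hilbert_space_def)

lemma T_mem: "(f, f') \<in> T \<Longrightarrow> f \<in> H \<and> f' \<in> H"
  using T_subset by blast

lemmas T_add = complex_vector.subspace_add[OF subspace_T]
  and T_diff = complex_vector.subspace_diff[OF subspace_T]
  and T_scale = complex_vector.subspace_scale[OF subspace_T]
  and Gamma0_diff = clinear_on_diff[OF clinear_Gamma0 subspace_T]
  and Gamma1_diff = clinear_on_diff[OF clinear_Gamma1 subspace_T]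

section \<open>Green's identity, closability and boundedness of the boundary maps\<close>

lemma green:
  assumes "(f, f') \<in> T" "(g, g') \<in> T"
  shows "cinner f' g - cinner f g' =
    cinner (\<Gamma>1 (f, f')) (\<Gamma>0 (g, g')) - cinner (\<Gamma>0 (f, f')) (\<Gamma>1 (g, g'))"
  using qbt assms unfolding quasi_boundary_triple_def by blast

text \<open>Rotating the boundary pair preserves its norm and merges the boundary terms into one
  inner product, ready for testing against the dense boundary range.\<close>

lemma green_pair:
  assumes "f \<in> T" "g \<in> T"
  shows "cinner (\<Gamma>1 f, - \<Gamma>0 f) (\<Gamma>0 g, \<Gamma>1 g) = cinner (snd f) (fst g) - cinner (fst f) (snd g)"
  using green[of "fst f" "snd f" "fst g" "snd g"] assms
  by (simp add: cinner_prod_def cinner_minus_left)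

lemma Gamma_range_sequence:
  assumes "a \<in> G" "b \<in> G"
  obtains g where "\<And>n. g n \<in> T" "(\<lambda>n. \<Gamma>0 (g n)) \<longlonglongrightarrow> a" "(\<lambda>n. \<Gamma>1 (g n)) \<longlonglongrightarrow> b"
proof -
  have "(a, b) \<in> closure ((\<lambda>f. (\<Gamma>0 f, \<Gamma>1 f)) ` T)" using assms Gamma_dense by auto
  then obtain s where s: "\<And>n. s n \<in> (\<lambda>f. (\<Gamma>0 f, \<Gamma>1 f)) ` T" "s \<longlonglongrightarrow> (a, b)"
    unfolding closure_sequential by blast
  then have "\<forall>n. \<exists>f\<in>T. s n = (\<Gamma>0 f, \<Gamma>1 f)" by blast
  then obtain g where g: "\<And>n. g n \<in> T" "\<And>n. s n = (\<Gamma>0 (g n), \<Gamma>1 (g n))" by metis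
  show ?thesis
    using that[OF g(1)] tendsto_fst[OF s(2)] tendsto_snd[OF s(2)] by (simp add: g(2))
qed

lemma Gamma_range_orthogonal_trivial:
  assumes "a \<in> G" "b \<in> G" and orth: "\<And>g. g \<in> T \<Longrightarrow> cinner b (\<Gamma>0 g) = cinner a (\<Gamma>1 g)"
  shows "a = 0" "b = 0"
proof -
  have "- a \<in> G" using assms subspace_G complex_vector.subspace_neg by blast
  \<comment> \<open>Boundary pairs approximating \<open>(b, - a)\<close> make the vanishing
    expression tend to |b|^2 + |a|^2.\<close>
  then obtain g where g: "\<And>n. g n \<in> T" "(\<lambda>n. \<Gamma>0 (g n)) \<longlonglongrightarrow> b" "(\<lambda>n. \<Gamma>1 (g n)) \<longlonglongrightarrow> - a"
    using Gamma_range_sequence assms(2) by blast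
  have "(\<lambda>n. cinner b (\<Gamma>0 (g n)) - cinner a (\<Gamma>1 (g n))) \<longlonglongrightarrow> cinner b b - cinner a (- a)"
    by (intro tendsto_intros tendsto_cinner g)
  moreover have "cinner b (\<Gamma>0 (g n)) - cinner a (\<Gamma>1 (g n)) = 0" for n
    using orth[OF g(1)] by simp
  ultimately have "cinner b b - cinner a (- a) = 0"
    using LIMSEQ_unique by (metis (no_types, lifting) LIMSEQ_const_iff ext)
  then have "cinner b b + cinner a a = 0"
    using cinner_diff_right[of a 0 a] by simp
  then have "complex_of_real ((norm b)\<^sup>2 + (norm a)\<^sup>2) = 0" by (simp add: cinner_self)
  then have "(norm b)\<^sup>2 + (norm a)\<^sup>2 = 0" using of_real_eq_0_iff by blast
  then show "a = 0" "b = 0" by (auto simp: sum_power2_eq_zero_iff)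
qed

text \<open>In Green's identity with a fixed \<open>g\<close> the inner products in \<open>H\<close>
  tend to 0, so the rotated limit pair is orthogonal to the dense boundary range.\<close>

lemma Gamma_closable:
  assumes f: "\<And>n. f n \<in> T" "(\<lambda>n. fst (f n)) \<longlonglongrightarrow> 0" "(\<lambda>n. snd (f n)) \<longlonglongrightarrow> 0"
    and lim: "(\<lambda>n. \<Gamma>0 (f n)) \<longlonglongrightarrow> a" "(\<lambda>n. \<Gamma>1 (f n)) \<longlonglongrightarrow> b"
  shows "a = 0" "b = 0"
proof -
  have "closed G" using hilbert_G by (simp add: hilbert_space_def complete_imp_closed)
  then have ab: "a \<in> G" "b \<in> G"
    using closed_sequentially[OF _ _ lim(1)] closed_sequentially[OF _ _ lim(2)]
      f(1) Gamma0_in Gamma1_in by simp_all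
  have "cinner b (\<Gamma>0 g) = cinner a (\<Gamma>1 g)" if g: "g \<in> T" for g
  proof -
    have "(\<lambda>n. cinner (\<Gamma>1 (f n)) (\<Gamma>0 g) - cinner (\<Gamma>0 (f n)) (\<Gamma>1 g))
        \<longlonglongrightarrow> cinner b (\<Gamma>0 g) - cinner a (\<Gamma>1 g)"
      by (intro tendsto_intros tendsto_cinner lim)
    moreover have "(\<lambda>n. cinner (snd (f n)) (fst g) - cinner (fst (f n)) (snd g))
        \<longlonglongrightarrow> cinner 0 (fst g) - cinner 0 (snd g)"
      by (intro tendsto_intros tendsto_cinner f)
    moreover have "cinner (\<Gamma>1 (f n)) (\<Gamma>0 g) - cinner (\<Gamma>0 (f n)) (\<Gamma>1 g) =
        cinner (snd (f n)) (fst g) - cinner (fst (f n)) (snd g)" for n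
      using green[of "fst (f n)" "snd (f n)" "fst g" "snd g"] f(1) g by simp
    ultimately show ?thesis using LIMSEQ_unique by fastforce
  qed
  then show "a = 0" "b = 0" using Gamma_range_orthogonal_trivial[OF ab] by blast+
qed

text \<open>By Green's identity \<open>\<Gamma>\<close> is the supremum of the continuous functionals
  \<open>f \<mapsto> (f', g) - (f, g')\<close> with \<open>\<parallel>\<Gamma> g\<parallel> \<le> 1\<close>, so the Baire argument applies.\<close>

lemma Gamma_bounded:
  assumes V: "V \<subseteq> T" "hilbert_space V"
  obtains C where "C \<ge> 0" "\<And>f. f \<in> V \<Longrightarrow> norm (\<Gamma>0 f) \<le> C * norm f"
    "\<And>f. f \<in> V \<Longrightarrow> norm (\<Gamma>1 f) \<le> C * norm f"
proof -
  let ?p = "\<lambda>f. norm (\<Gamma>0 f, \<Gamma>1 f)"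
  have "closed {f \<in> V. ?p f \<le> real n}" for n :: nat
    unfolding closed_sequential_limits
  proof (intro allI impI)
    fix s l assume s: "(\<forall>k. s k \<in> {f \<in> V. ?p f \<le> real n}) \<and> s \<longlonglongrightarrow> l"
    have "closed V" using V by (simp add: hilbert_space_def complete_imp_closed)
    then have l: "l \<in> V" using s closed_sequentially[of V s l] by blast
    have sT: "s k \<in> T" "l \<in> T" for k using s V l by blast+
    have le: "cmod (cinner (\<Gamma>1 l, - \<Gamma>0 l) (\<Gamma>0 g, \<Gamma>1 g)) \<le> real n * ?p g" if g: "g \<in> T" for g
    proof -
      have "(\<lambda>k. cmod (cinner (snd (s k)) (fst g) - cinner (fst (s k)) (snd g)))
          \<longlonglongrightarrow> cmod (cinner (snd l) (fst g) - cinner (fst l) (snd g))"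
        by (intro tendsto_intros tendsto_cinner) (use s in blast)+
      then have "(\<lambda>k. cmod (cinner (\<Gamma>1 (s k), - \<Gamma>0 (s k)) (\<Gamma>0 g, \<Gamma>1 g)))
          \<longlonglongrightarrow> cmod (cinner (\<Gamma>1 l, - \<Gamma>0 l) (\<Gamma>0 g, \<Gamma>1 g))"
        unfolding green_pair[OF sT(1) g] green_pair[OF sT(2) g] .
      moreover have "cmod (cinner (\<Gamma>1 (s k), - \<Gamma>0 (s k)) (\<Gamma>0 g, \<Gamma>1 g)) \<le> real n * ?p g" for k
      proof -
        have "norm (\<Gamma>1 (s k), - \<Gamma>0 (s k)) = ?p (s k)" by (simp add: norm_Pair)
        also have "\<dots> \<le> real n" using s by blast
        finally show ?thesis
          using norm_cinner_le[of "(\<Gamma>1 (s k), - \<Gamma>0 (s k))" "(\<Gamma>0 g, \<Gamma>1 g)"]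
            mult_right_mono[of "norm (\<Gamma>1 (s k), - \<Gamma>0 (s k))" "real n" "?p g"] by simp
      qed
      ultimately show ?thesis by (intro LIMSEQ_le_const2) auto
    qed
    \<comment> \<open>The rotated pair of \<open>l\<close> need not be a boundary value, so it is
      approximated by such; in the limit the squared norm of the pair is at most \<open>n\<close>
      times its norm.\<close>
    have "- \<Gamma>0 l \<in> G" using sT Gamma0_in subspace_G complex_vector.subspace_neg by blast
    then obtain g where g: "\<And>n. g n \<in> T" "(\<lambda>n. \<Gamma>0 (g n)) \<longlonglongrightarrow> \<Gamma>1 l" "(\<lambda>n. \<Gamma>1 (g n)) \<longlonglongrightarrow> - \<Gamma>0 l"
      using Gamma_range_sequence[OF Gamma1_in[OF sT(2)]] by blast
    have "(\<lambda>k. cmod (cinner (\<Gamma>1 l, - \<Gamma>0 l) (\<Gamma>0 (g k), \<Gamma>1 (g k))))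
        \<longlonglongrightarrow> cmod (cinner (\<Gamma>1 l, - \<Gamma>0 l) (\<Gamma>1 l, - \<Gamma>0 l))"
      by (intro tendsto_intros tendsto_cinner g)
    moreover have "(\<lambda>k. real n * ?p (g k)) \<longlonglongrightarrow> real n * norm (\<Gamma>1 l, - \<Gamma>0 l)"
      by (intro tendsto_intros g)
    ultimately have "cmod (cinner (\<Gamma>1 l, - \<Gamma>0 l) (\<Gamma>1 l, - \<Gamma>0 l)) \<le> real n * norm (\<Gamma>1 l, - \<Gamma>0 l)"
      using le[OF g(1)] by (intro LIMSEQ_le[where X = "\<lambda>k. cmod (cinner (\<Gamma>1 l, - \<Gamma>0 l) (\<Gamma>0 (g k), \<Gamma>1 (g k)))"]) auto
    moreover have "norm (\<Gamma>1 l, - \<Gamma>0 l) = ?p l" by (simp add: norm_Pair)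
    ultimately have "(?p l)\<^sup>2 \<le> real n * ?p l"
      by (simp only: cinner_self norm_of_real abs_power2)
    then have "?p l \<le> real n"
      by (cases "?p l = 0") (simp_all add: power2_eq_square)
    then show "l \<in> {f \<in> V. ?p f \<le> real n}" using l by simp
  qed
  moreover have "?p (x - y) \<le> ?p x + ?p y" if "x \<in> V" "y \<in> V" for x y
  proof -
    have "(\<Gamma>0 (x - y), \<Gamma>1 (x - y)) = (\<Gamma>0 x, \<Gamma>1 x) - (\<Gamma>0 y, \<Gamma>1 y)"
      using that V Gamma0_diff[of x y] Gamma1_diff[of x y] by auto
    then show ?thesis by (metis norm_triangle_ineq4)
  qed
  moreover have "?p (r *\<^sub>R x) = \<bar>r\<bar> * ?p x" if "x \<in> V" for r x
  proof -
    have "(\<Gamma>0 (r *\<^sub>R x), \<Gamma>1 (r *\<^sub>R x)) = r *\<^sub>R (\<Gamma>0 x, \<Gamma>1 x)"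
      using that V clinear_Gamma0 clinear_Gamma1 unfolding clinear_on_def
      by (auto simp: scaleR_scaleC scaleC_prod_def)
    then show ?thesis by (metis norm_scaleR)
  qed
  ultimately obtain C where C: "C \<ge> 0" "\<And>x. x \<in> V \<Longrightarrow> ?p x \<le> C * norm x"
    using seminorm_bounded_of_closed_sublevels[OF V(2), of ?p] by blast
  have "norm (\<Gamma>0 x) \<le> C * norm x" "norm (\<Gamma>1 x) \<le> C * norm x" if "x \<in> V" for x
    using order_trans[OF norm_fst_le C(2)[OF that]] order_trans[OF norm_snd_le C(2)[OF that]]
    by blast+
  then show ?thesis using that C(1) by blast
qed

text \<open>A self-adjoint \<open>S\<close> inside \<open>T\<close> is closed, so the boundary maps
  are bounded on it even though \<open>T\<close> itself may fail to be closed.\<close>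

lemma boundary_map_bounded:
  assumes S: "S \<subseteq> T" "self_adjoint_relation H S" and R: "is_resolvent H S l R"
  shows "bounded_on H G (\<lambda>h. \<Gamma>0 (res_hat l R h))" "bounded_on H G (\<lambda>h. \<Gamma>1 (res_hat l R h))"
proof -
  obtain C where "C \<ge> 0" and C: "\<And>f. f \<in> S \<Longrightarrow> norm (\<Gamma>0 f) \<le> C * norm f"
    "\<And>f. f \<in> S \<Longrightarrow> norm (\<Gamma>1 f) \<le> C * norm f"
    by (rule Gamma_bounded[OF S(1) self_adjoint_closed[OF hilbert_H S(2)]]) (rule that)
  have "bounded_on S G \<Gamma>0"
    using S(1) C(1) Gamma0_in clinear_Gamma0 unfolding clinear_on_def
    by (intro bounded_onI[where C = C]) blast+
  then show "bounded_on H G (\<lambda>h. \<Gamma>0 (res_hat l R h))"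
    by (rule bounded_on_comp[OF res_hat_bounded[OF R]])
  have "bounded_on S G \<Gamma>1"
    using S(1) C(2) Gamma1_in clinear_Gamma1 unfolding clinear_on_def
    by (intro bounded_onI[where C = C]) blast+
  then show "bounded_on H G (\<lambda>h. \<Gamma>1 (res_hat l R h))"
    by (rule bounded_on_comp[OF res_hat_bounded[OF R]])
qed

text \<open>\<open>Q\<close> enters through its duality with the boundary map at
  \<open>cnj l\<close>, so the same formula serves a merely bounded adjoint and one that lies in the
  ideal.\<close>

lemma resolvent_diff_factorization:
  assumes th1: "bounded_on G G \<theta>1" "\<And>x y. x \<in> G \<Longrightarrow> y \<in> G \<Longrightarrow> cinner (\<theta>1 x) y = cinner x (\<theta>1 y)"
    and S1: "S1 = {f \<in> T. \<Gamma>1 f = \<theta>1 (\<Gamma>0 f)}" and S2: "S2 = {f \<in> T. \<Gamma>1 f = \<theta>2 (\<Gamma>0 f)}"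
    and R1: "is_resolvent H S1 l R1" and R1': "is_resolvent H S1 (cnj l) R1'"
    and R2: "is_resolvent H S2 l R2"
    and th2: "\<theta>2 ` G \<subseteq> G"
    and Q: "Q ` G \<subseteq> H"
      "\<And>h z. h \<in> H \<Longrightarrow> z \<in> G \<Longrightarrow> cinner (\<Gamma>0 (res_hat (cnj l) R1' h)) z = cinner h (Q z)"
    and k: "k \<in> H"
  shows "R1 k - R2 k = Q (\<theta>2 (\<Gamma>0 (res_hat l R2 k)) - \<theta>1 (\<Gamma>0 (res_hat l R2 k)))"
proof (rule hilbert_space_separation[OF subspace_H])
  define f1 where "f1 = res_hat l R1 k"
  define f2 where "f2 = res_hat l R2 k"
  define u where "u = R1 k - R2 k"
  have f1: "f1 \<in> T" "\<Gamma>1 f1 = \<theta>1 (\<Gamma>0 f1)" and f2: "f2 \<in> T" "\<Gamma>1 f2 = \<theta>2 (\<Gamma>0 f2)"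
    using res_hat_in[OF R1 k] res_hat_in[OF R2 k] unfolding f1_def f2_def S1 S2 by auto
  have g: "\<Gamma>0 f1 \<in> G" "\<Gamma>0 f2 \<in> G" using f1 f2 Gamma0_in by auto
  have f12: "f1 - f2 = (u, l *\<^sub>C u)"
    by (simp add: f1_def f2_def res_hat_def u_def complex_vector.scale_right_diff_distrib)
  then have uT: "(u, l *\<^sub>C u) \<in> T" using T_diff[OF f1(1) f2(1)] by simp
  then show uH: "R1 k - R2 k \<in> H" using T_mem by (auto simp: u_def)
  have zG: "\<theta>2 (\<Gamma>0 f2) - \<theta>1 (\<Gamma>0 f2) \<in> G"
    using th1(1) th2 g subspace_G by (auto simp: bounded_on_def intro!: complex_vector.subspace_diff)
  then show "Q (\<theta>2 (\<Gamma>0 (res_hat l R2 k)) - \<theta>1 (\<Gamma>0 (res_hat l R2 k))) \<in> H"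
    using Q(1) by (auto simp: f2_def)
  fix h assume h: "h \<in> H"
  define f where "f = R1' h"
  define x where "x = \<Gamma>0 (res_hat (cnj l) R1' h)"
  have fS: "res_hat (cnj l) R1' h \<in> T" "\<Gamma>1 (res_hat (cnj l) R1' h) = \<theta>1 x"
    using res_hat_in[OF R1' h] unfolding S1 x_def by auto
  have xG: "x \<in> G" using Gamma0_in[OF fS(1)] by (simp add: x_def)
  have e0: "\<Gamma>0 (u, l *\<^sub>C u) = \<Gamma>0 f1 - \<Gamma>0 f2" using Gamma0_diff[OF f1(1) f2(1)] by (simp add: f12)
  have e1: "\<Gamma>1 (u, l *\<^sub>C u) = \<theta>1 (\<Gamma>0 f1) - \<theta>2 (\<Gamma>0 f2)"
    using Gamma1_diff[OF f1(1) f2(1)] f1 f2 by (simp add: f12)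
  \<comment> \<open>The conjugate spectral point makes the terms with \<open>l\<close> cancel,
    leaving exactly the left side of Green's identity.\<close>
  have "cinner h u = cinner (h + cnj l *\<^sub>C f) u - cinner f (l *\<^sub>C u)"
    by (simp add: cinner_add_left cinner_scaleC_left cinner_scaleC_right)
  also have "\<dots> = cinner (\<theta>1 x) (\<Gamma>0 f1 - \<Gamma>0 f2) - cinner x (\<theta>1 (\<Gamma>0 f1) - \<theta>2 (\<Gamma>0 f2))"
    using green[OF _ uT, of f "h + cnj l *\<^sub>C f"] fS unfolding e0 e1
    by (simp add: f_def res_hat_def x_def)
  \<comment> \<open>Moving \<theta>1 across by symmetry cancels the contribution of
    \<open>f1\<close>; only the boundary value of \<open>f2\<close> survives.\<close>
  also have "cinner (\<theta>1 x) (\<Gamma>0 f1 - \<Gamma>0 f2) = cinner x (\<theta>1 (\<Gamma>0 f1)) - cinner x (\<theta>1 (\<Gamma>0 f2))"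
    using th1(2)[OF xG] g by (simp add: cinner_diff_right)
  finally have "cinner h u = cinner x (\<theta>2 (\<Gamma>0 f2) - \<theta>1 (\<Gamma>0 f2))"
    by (simp add: cinner_diff_right)
  also have "\<dots> = cinner h (Q (\<theta>2 (\<Gamma>0 f2) - \<theta>1 (\<Gamma>0 f2)))"
    using Q(2)[OF h zG] by (simp add: x_def)
  finally show "cinner h (R1 k - R2 k) =
      cinner h (Q (\<theta>2 (\<Gamma>0 (res_hat l R2 k)) - \<theta>1 (\<Gamma>0 (res_hat l R2 k))))"
    by (simp add: u_def f2_def)
qed

text \<open>On A_0 one boundary term of Green's identity vanishes. This identifies
  \<open>\<Gamma>1 (res_hat (cnj l) R h)\<close> as the value at \<open>h\<close> of the adjoint of
  the gamma field at \<open>l\<close>.\<close>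

lemma gamma_field_green:
  assumes R: "is_resolvent H A0 (cnj l) R" and h: "h \<in> H" and u: "(u, l *\<^sub>C u) \<in> T"
  shows "cinner h u = cinner (\<Gamma>1 (res_hat (cnj l) R h)) (\<Gamma>0 (u, l *\<^sub>C u))"
proof -
  have f: "(R h, h + cnj l *\<^sub>C R h) \<in> A0" using res_hat_in[OF R h] by (simp add: res_hat_def)
  then have "(R h, h + cnj l *\<^sub>C R h) \<in> T" "\<Gamma>0 (R h, h + cnj l *\<^sub>C R h) = 0"
    by (auto simp: ker_on_def)
  then have "cinner (h + cnj l *\<^sub>C R h) u - cinner (R h) (l *\<^sub>C u) =
      cinner (\<Gamma>1 (R h, h + cnj l *\<^sub>C R h)) (\<Gamma>0 (u, l *\<^sub>C u))"
    using green[OF _ u] by simp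
  then show ?thesis
    by (simp add: res_hat_def cinner_add_left cinner_scaleC_left cinner_scaleC_right)
qed

text \<open>The adjoint is bounded by \<open>boundary_map_bounded\<close>; testing the duality with
  \<open>h = u\<close> transfers the bound to the gamma field.\<close>

lemma gamma_field_bounded:
  assumes R: "is_resolvent H A0 l R"
  obtains C where "C > 0" "\<And>u. (u, l *\<^sub>C u) \<in> T \<Longrightarrow> norm u \<le> C * norm (\<Gamma>0 (u, l *\<^sub>C u))"
proof -
  obtain R' where R': "is_resolvent H A0 (cnj l) R'"
    using self_adjoint_resolvent_cnj[OF hilbert_H self_adjoint_A0 R] by blast
  obtain C where C: "C > 0" "\<And>h. h \<in> H \<Longrightarrow> norm (\<Gamma>1 (res_hat (cnj l) R' h)) \<le> C * norm h"
    using bounded_on_bound[OF boundary_map_bounded(2)[OF A0_subset self_adjoint_A0 R']] by blast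
  have "norm u \<le> C * norm (\<Gamma>0 (u, l *\<^sub>C u))" if u: "(u, l *\<^sub>C u) \<in> T" for u
  proof (cases "u = 0")
    case False
    have uH: "u \<in> H" using T_mem[OF u] by blast
    have "(norm u)\<^sup>2 = cmod (cinner u u)" by (simp add: cinner_self norm_power)
    also have "\<dots> \<le> norm (\<Gamma>1 (res_hat (cnj l) R' u)) * norm (\<Gamma>0 (u, l *\<^sub>C u))"
      unfolding gamma_field_green[OF R' uH u] by (rule norm_cinner_le)
    also have "\<dots> \<le> (C * norm u) * norm (\<Gamma>0 (u, l *\<^sub>C u))"
      by (intro mult_right_mono C uH) auto
    finally show ?thesis using False by (simp add: power2_eq_square)
  qed (use C in simp)
  then show ?thesis using that C(1) by blast
qed

text \<open>Subtracting the element of A_0 with the same shifted value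
  \<open>f' - l *\<^sub>C f\<close> leaves an element of the defect space; \<Gamma>0 does not see
  the subtraction.\<close>

lemma defect_decomposition:
  assumes R: "is_resolvent H A0 l R" and f: "(f, f') \<in> T"
  defines "u \<equiv> f - R (f' - l *\<^sub>C f)"
  shows "(u, l *\<^sub>C u) \<in> T" "\<Gamma>0 (u, l *\<^sub>C u) = \<Gamma>0 (f, f')"
    "\<Gamma>1 (u, l *\<^sub>C u) = \<Gamma>1 (f, f') - \<Gamma>1 (res_hat l R (f' - l *\<^sub>C f))"
proof -
  define h where "h = f' - l *\<^sub>C f"
  have hH: "h \<in> H" using T_mem[OF f] subspace_H
    by (auto simp: h_def intro: complex_vector.subspace_diff complex_vector.subspace_scale)
  have A: "res_hat l R h \<in> T" "\<Gamma>0 (res_hat l R h) = 0"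
    using res_hat_in[OF R hH] by (auto simp: ker_on_def)
  have e: "(f, f') - res_hat l R h = (u, l *\<^sub>C u)"
    by (simp add: u_def res_hat_def h_def complex_vector.scale_right_diff_distrib)
  show "(u, l *\<^sub>C u) \<in> T" "\<Gamma>0 (u, l *\<^sub>C u) = \<Gamma>0 (f, f')"
    "\<Gamma>1 (u, l *\<^sub>C u) = \<Gamma>1 (f, f') - \<Gamma>1 (res_hat l R (f' - l *\<^sub>C f))"
    using T_diff[OF f A(1)] Gamma0_diff[OF f A(1)] Gamma1_diff[OF f A(1)] A(2)
    unfolding e by (simp_all add: h_def)
qed

text \<open>Separability of \<open>G\<close> is not part of the definition of the triple. It is
  inherited from \<open>H\<close>, because \<open>P\<close>, the adjoint of the gamma field, is
  continuous with dense range.\<close>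

lemma separable_G:
  assumes sep: "separable_hilbert_space H" and R: "is_resolvent H A0 l R"
    and M: "\<And>u. (u, l *\<^sub>C u) \<in> T \<Longrightarrow> norm (\<Gamma>1 (u, l *\<^sub>C u)) \<le> K * norm (\<Gamma>0 (u, l *\<^sub>C u))"
  shows "separable_hilbert_space G"
proof -
  obtain R' where R': "is_resolvent H A0 (cnj l) R'"
    using self_adjoint_resolvent_cnj[OF hilbert_H self_adjoint_A0 R] by blast
  define P where "P h = \<Gamma>1 (res_hat (cnj l) R' h)" for h
  have P: "bounded_on H G P"
    unfolding P_def by (rule boundary_map_bounded(2)[OF A0_subset self_adjoint_A0 R'])
  obtain C where C: "\<And>u. (u, l *\<^sub>C u) \<in> T \<Longrightarrow> norm u \<le> C * norm (\<Gamma>0 (u, l *\<^sub>C u))"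
    using gamma_field_bounded[OF R] by blast
  have dense: "G \<subseteq> closure (P ` H)"
  proof (rule dense_of_orthogonal_trivial[OF hilbert_G])
    show "P ` H \<subseteq> G" using P by (simp add: bounded_on_def)
    show "complex_vector.subspace (P ` H)"
      by (rule subspace_image[OF subspace_H bounded_onD(1)[OF P]])
    fix x assume x: "x \<in> G" "\<And>w. w \<in> P ` H \<Longrightarrow> cinner w x = 0"
    \<comment> \<open>\<open>x\<close> is approximated by \<Gamma>0 values of defect vectors. The
      bounds on the gamma field and the Weyl function make these vectors and their \<Gamma>1 values
      Cauchy.\<close>
    obtain g where g: "\<And>n. g n \<in> T" "(\<lambda>n. \<Gamma>0 (g n)) \<longlonglongrightarrow> x"
      using Gamma_range_sequence[OF x(1) x(1)] by blast
    have "\<exists>u. (u, l *\<^sub>C u) \<in> T \<and> \<Gamma>0 (u, l *\<^sub>C u) = \<Gamma>0 (g n)" for n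
      using defect_decomposition(1,2)[OF R, of "fst (g n)" "snd (g n)"] g(1)[of n] by auto
    then obtain u where u: "\<And>n. (u n, l *\<^sub>C u n) \<in> T" "\<And>n. \<Gamma>0 (u n, l *\<^sub>C u n) = \<Gamma>0 (g n)"
      by metis
    have ud: "(u n - u m, l *\<^sub>C (u n - u m)) \<in> T"
      "\<Gamma>0 (u n - u m, l *\<^sub>C (u n - u m)) = \<Gamma>0 (g n) - \<Gamma>0 (g m)"
      "\<Gamma>1 (u n - u m, l *\<^sub>C (u n - u m)) = \<Gamma>1 (u n, l *\<^sub>C u n) - \<Gamma>1 (u m, l *\<^sub>C u m)" for n m
      using T_diff[OF u(1)[of n] u(1)[of m]] Gamma0_diff[OF u(1)[of n] u(1)[of m]]
        Gamma1_diff[OF u(1)[of n] u(1)[of m]] u(2)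
      by (simp_all add: complex_vector.scale_right_diff_distrib)
    have cg: "Cauchy (\<lambda>n. \<Gamma>0 (g n))" using g(2) by (rule LIMSEQ_imp_Cauchy)
    have "Cauchy u" using C[OF ud(1)] unfolding ud(2) by (rule Cauchy_of_Lipschitz[OF cg])
    moreover have uH: "u n \<in> H" for n using T_mem[OF u(1)] by blast
    ultimately obtain v where v: "v \<in> H" "u \<longlonglongrightarrow> v"
      using hilbert_H unfolding hilbert_space_def complete_def by blast
    have "Cauchy (\<lambda>n. \<Gamma>1 (u n, l *\<^sub>C u n))"
      using M[OF ud(1)] unfolding ud(2,3) by (rule Cauchy_of_Lipschitz[OF cg])
    moreover have "\<Gamma>1 (u n, l *\<^sub>C u n) \<in> G" for n using Gamma1_in[OF u(1)] .
    ultimately obtain y where y: "(\<lambda>n. \<Gamma>1 (u n, l *\<^sub>C u n)) \<longlonglongrightarrow> y"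
      using hilbert_G unfolding hilbert_space_def complete_def by meson
    \<comment> \<open>Testing with the limit \<open>v\<close> itself shows that the defect vectors
      tend to 0; closability then gives \<open>x = 0\<close>.\<close>
    have "cinner v v = cinner (P v) x"
    proof (rule LIMSEQ_unique)
      show "(\<lambda>n. cinner v (u n)) \<longlonglongrightarrow> cinner v v"
        by (intro tendsto_cinner tendsto_const v)
      show "(\<lambda>n. cinner v (u n)) \<longlonglongrightarrow> cinner (P v) x"
        unfolding gamma_field_green[OF R' v(1) u(1)] P_def[symmetric] u(2)
        by (intro tendsto_cinner tendsto_const g)
    qed
    then have "cinner v v = 0" using x(2) v(1) by auto
    then have "u \<longlonglongrightarrow> 0" using v(2) by simp
    then have "(\<lambda>n. l *\<^sub>C u n) \<longlonglongrightarrow> l *\<^sub>C 0" by (intro tendsto_scaleC tendsto_const)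
    then have lu: "(\<lambda>n. l *\<^sub>C u n) \<longlonglongrightarrow> 0" by simp
    show "x = 0"
      by (rule Gamma_closable(1)[of "\<lambda>n. (u n, l *\<^sub>C u n)", OF u(1)])
        (use \<open>u \<longlonglongrightarrow> 0\<close> lu g(2) y u(2) in simp_all)
  qed
  obtain D where D: "countable D" "D \<subseteq> H" "H \<subseteq> closure D"
    using sep by (auto simp: separable_hilbert_space_def)
  obtain B where B: "\<And>h. h \<in> H \<Longrightarrow> norm (P h) \<le> B * norm h"
    using bounded_on_bound[OF P] by blast
  have "P ` H \<subseteq> closure (P ` D)"
  proof
    fix y assume "y \<in> P ` H"
    then obtain h where h: "h \<in> H" "y = P h" by blast
    then obtain d where d: "\<And>n. d n \<in> D" "d \<longlonglongrightarrow> h"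
      using subsetD[OF D(3) h(1)] unfolding closure_sequential by blast
    have dH: "d n \<in> H" for n using d(1) D(2) by blast
    have "norm (P (d n) - P h) \<le> B * norm (d n - h)" for n
      using B[of "d n - h"] clinear_on_diff[OF bounded_onD(1)[OF P] subspace_H, of "d n" h]
        complex_vector.subspace_diff[OF subspace_H, of "d n" h] dH h by simp
    moreover have "(\<lambda>n. B * norm (d n - h)) \<longlonglongrightarrow> B * norm (h - h)"
      by (intro tendsto_intros d)
    ultimately have "(\<lambda>n. P (d n) - P h) \<longlonglongrightarrow> 0"
      using Lim_null_comparison[of "\<lambda>n. P (d n) - P h" "\<lambda>n. B * norm (d n - h)"] by simp
    then have "(\<lambda>n. P (d n)) \<longlonglongrightarrow> y" using h LIM_zero_iff by blast
    then show "y \<in> closure (P ` D)"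
      using d(1) unfolding closure_sequential by (intro exI[of _ "\<lambda>n. P (d n)"]) auto
  qed
  then have "G \<subseteq> closure (P ` D)" using dense closure_minimal[of "P ` H" "closure (P ` D)"] by auto
  moreover have "P ` D \<subseteq> G" using D(2) bounded_onD(2)[OF P] by blast
  ultimately show ?thesis
    using hilbert_G D(1) unfolding separable_hilbert_space_def by blast
qed

end


section \<open>Self-adjoint operators with closed range\<close>

text \<open>Induction on the generators: the new generator is replaced by its component
  \<open>b1\<close> orthogonal to the old span, which bounds its coefficient.\<close>

lemma bounded_seq_in_finite_span:
  fixes x :: "nat \<Rightarrow> 'a::complex_inner"
  assumes "finite B" "\<And>n. x n \<in> complex_vector.span B" "\<And>n. norm (x n) \<le> K"
  shows "\<exists>l\<in>complex_vector.span B. \<exists>r. strict_mono r \<and> (\<lambda>n. x (r n)) \<longlonglongrightarrow> l"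
  using assms
proof (induction B arbitrary: x K rule: finite_induct)
  case empty
  then have "x n = 0" for n by simp
  then show ?case by (intro bexI[of _ 0] exI[of _ id]) (auto simp: strict_mono_def)
next
  case (insert b B)
  let ?W = "complex_vector.span B"
  \<comment> \<open>Completeness of the old span, needed to project onto it, follows from the
    induction hypothesis.\<close>
  have "complete ?W"
    unfolding complete_def
  proof (intro allI impI)
    fix s assume s: "(\<forall>n. s n \<in> ?W) \<and> Cauchy s"
    then obtain M where "\<And>n. norm (s n) \<le> M"
      using cauchy_imp_bounded[of s] unfolding bounded_iff by auto
    then obtain l r where l: "l \<in> ?W" "strict_mono r" "(\<lambda>n. s (r n)) \<longlonglongrightarrow> l"
      using insert.IH[of s M] s by blast
    then have "s \<longlonglongrightarrow> l"
      using s Cauchy_converges_subseq[of s r l] by (simp add: o_def)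
    then show "\<exists>l\<in>?W. s \<longlonglongrightarrow> l" using l(1) by blast
  qed
  then have W: "hilbert_space ?W" by (simp add: hilbert_space_def)
  obtain b0 where b0: "b0 \<in> ?W" "\<And>v. v \<in> ?W \<Longrightarrow> cinner (b - b0) v = 0"
    using hilbert_space_projection[OF W] by blast
  define b1 where "b1 = b - b0"
  have "\<exists>k y. x n = y + k *\<^sub>C b1 \<and> y \<in> ?W \<and> cmod k \<le> K / norm b1" for n
  proof -
    obtain k where k: "x n - k *\<^sub>C b \<in> ?W"
      using insert.prems(1)[of n] complex_vector.span_breakdown_eq by blast
    define y where "y = (x n - k *\<^sub>C b) + k *\<^sub>C b0"
    have y: "y \<in> ?W" unfolding y_def
      by (intro complex_vector.span_add complex_vector.span_scale k b0)
    have xn: "x n = y + k *\<^sub>C b1"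
      by (simp add: y_def b1_def complex_vector.scale_right_diff_distrib)
    show ?thesis
    proof (cases "b1 = 0")
      \<comment> \<open>Here \<open>b\<close> already lies in the old span and the coefficient is 0;
        its bound \<open>K / norm b1\<close> also equals 0, since division by zero yields 0.\<close>
      case True
      then show ?thesis using xn y by (intro exI[of _ "0::complex"] exI[of _ y]) simp
    next
      case False
      have "cinner y b1 = 0" using b0(2)[OF y] cinner_eq_0_commute unfolding b1_def by blast
      then have "cinner (x n) b1 = k * complex_of_real ((norm b1)\<^sup>2)"
        by (simp add: xn cinner_add_left cinner_scaleC_left cinner_self)
      then have "cmod k * (norm b1)\<^sup>2 = cmod (cinner (x n) b1)"
        by (simp add: norm_mult norm_power)
      also have "\<dots> \<le> K * norm b1"
        using norm_cinner_le[of "x n" b1] mult_right_mono[OF insert.prems(2)[of n] norm_ge_zero[of b1]]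
        by linarith
      finally have "cmod k \<le> K / norm b1" using False by (simp add: power2_eq_square field_simps)
      then show ?thesis using xn y by blast
    qed
  qed
  then obtain k y where ky: "\<And>n. x n = y n + k n *\<^sub>C b1" "\<And>n. y n \<in> ?W"
    "\<And>n. cmod (k n) \<le> K / norm b1" by metis
  have "norm (y n) \<le> K + K / norm b1 * norm b1" for n
  proof -
    have "norm (y n) \<le> norm (x n) + norm (k n *\<^sub>C b1)"
      using norm_triangle_ineq4[of "x n" "k n *\<^sub>C b1"] ky(1)[of n] by simp
    then show ?thesis
      using insert.prems(2)[of n] mult_right_mono[OF ky(3)[of n], of "norm b1"]
      by (simp add: norm_scaleC)
  qed
  then obtain l r where l: "l \<in> ?W" "strict_mono r" "(\<lambda>n. y (r n)) \<longlonglongrightarrow> l"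
    using insert.IH[of y] ky(2) by blast
  have "seq_compact (cball (0::complex) (K / norm b1))"
    using compact_cball compact_eq_seq_compact_metric by blast
  moreover have "\<forall>n. k (r n) \<in> cball 0 (K / norm b1)" using ky(3) by simp
  ultimately obtain c r' where c: "strict_mono r'" "(\<lambda>n. k (r (r' n))) \<longlonglongrightarrow> c"
    by (rule seq_compactE) (simp add: o_def)
  have "(\<lambda>n. x (r (r' n))) \<longlonglongrightarrow> l + c *\<^sub>C b1"
    unfolding ky(1) using LIMSEQ_subseq_LIMSEQ[OF l(3) c(1)] c(2)
    by (intro tendsto_add tendsto_scaleC tendsto_const) (simp_all add: o_def)
  moreover have "l + c *\<^sub>C b1 \<in> complex_vector.span (insert b B)"
  proof -
    have "(l + c *\<^sub>C b1) - c *\<^sub>C b = l - c *\<^sub>C b0"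
      by (simp add: b1_def complex_vector.scale_right_diff_distrib)
    also have "\<dots> \<in> ?W"
      by (intro complex_vector.span_diff complex_vector.span_scale l b0)
    finally show ?thesis using complex_vector.span_breakdown_eq by blast
  qed
  moreover have "strict_mono (\<lambda>n. r (r' n))"
    using l(2) c(1) strict_mono_compose[of r r'] by simp
  ultimately show ?case by blast
qed

text \<open>For a symmetric operator the orthogonal complement of the range lies in the kernel;
  closedness of the range makes the projection \<open>w\<close> available.\<close>

lemma symmetric_closed_range_decomposition:
  assumes G: "hilbert_space G" and th: "bounded_on G G \<theta>"
    and sym: "\<And>x y. x \<in> G \<Longrightarrow> y \<in> G \<Longrightarrow> cinner (\<theta> x) y = cinner x (\<theta> y)"
    and cl: "closed (\<theta> ` G)" and x: "x \<in> G"
  obtains w where "w \<in> \<theta> ` G" "\<theta> (x - w) = 0" "\<And>v. v \<in> \<theta> ` G \<Longrightarrow> cinner (x - w) v = 0"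
proof -
  have sG: "complex_vector.subspace G" using G by (simp add: hilbert_space_def)
  have thG: "\<theta> ` G \<subseteq> G" using th by (simp add: bounded_on_def)
  have "complex_vector.subspace (\<theta> ` G)"
    using subspace_image[OF sG bounded_onD(1)[OF th]] .
  then have W: "hilbert_space (\<theta> ` G)" by (rule hilbert_space_closed_subspace[OF G thG _ cl])
  obtain w where w: "w \<in> \<theta> ` G" "\<And>v. v \<in> \<theta> ` G \<Longrightarrow> cinner (x - w) v = 0"
    using hilbert_space_projection[OF W] by blast
  have xw: "x - w \<in> G" using x w(1) thG sG by (auto intro: complex_vector.subspace_diff)
  then have txw: "\<theta> (x - w) \<in> G" using thG by blast
  have "cinner (\<theta> (x - w)) (\<theta> (x - w)) = cinner (x - w) (\<theta> (\<theta> (x - w)))"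
    using sym[OF xw txw] .
  also have "\<dots> = 0" using txw by (intro w(2)) blast
  finally have "\<theta> (x - w) = 0" by simp
  then show ?thesis using w that by blast
qed

text \<open>The inverse on the range is symmetric and everywhere defined, so its norm is lower
  semicontinuous and the Baire argument applies, as in the Hellinger--Toeplitz theorem.\<close>

lemma symmetric_closed_range_bounded_below:
  assumes G: "hilbert_space G" and th: "bounded_on G G \<theta>"
    and sym: "\<And>x y. x \<in> G \<Longrightarrow> y \<in> G \<Longrightarrow> cinner (\<theta> x) y = cinner x (\<theta> y)"
    and cl: "closed (\<theta> ` G)"
  obtains c where "c > 0"
    "\<And>x. x \<in> G \<Longrightarrow> (\<And>y. y \<in> G \<Longrightarrow> \<theta> y = 0 \<Longrightarrow> cinner x y = 0) \<Longrightarrow> c * norm x \<le> norm (\<theta> x)"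
proof -
  let ?W = "\<theta> ` G"
  have sG: "complex_vector.subspace G" using G by (simp add: hilbert_space_def)
  have WG: "?W \<subseteq> G" using th by (simp add: bounded_on_def)
  have sW: "complex_vector.subspace ?W"
    using subspace_image[OF sG bounded_onD(1)[OF th]] .
  then have W: "hilbert_space ?W" by (rule hilbert_space_closed_subspace[OF G WG _ cl])
  note th_diff = clinear_on_diff[OF bounded_onD(1)[OF th] sG]
  \<comment> \<open>A vector in both the range and the kernel is orthogonal to itself by
    symmetry.\<close>
  have uniq: "w = w'" if w: "w \<in> ?W" "w' \<in> ?W" "\<theta> w = \<theta> w'" for w w'
  proof -
    have d: "w - w' \<in> ?W" using sW w complex_vector.subspace_diff by blast
    then obtain v where v: "v \<in> G" "w - w' = \<theta> v" by blast
    have "cinner (w - w') (w - w') = cinner (\<theta> (w - w')) v"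
      using sym[OF subsetD[OF WG d] v(1)] v(2) by simp
    also have "\<theta> (w - w') = 0" using th_diff[of w w'] w WG by auto
    finally show ?thesis by simp
  qed
  have "\<exists>w\<in>?W. \<theta> w = y" if y: "y \<in> ?W" for y
  proof -
    obtain x where x: "x \<in> G" "y = \<theta> x" using y by blast
    obtain w where w: "w \<in> ?W" "\<theta> (x - w) = 0"
      by (rule symmetric_closed_range_decomposition[OF G th sym cl x(1)]) (assumption | rule that)+
    then show ?thesis using th_diff[of x w] x WG by (intro bexI[of _ w]) auto
  qed
  then obtain iv where iv: "\<And>y. y \<in> ?W \<Longrightarrow> iv y \<in> ?W" "\<And>y. y \<in> ?W \<Longrightarrow> \<theta> (iv y) = y" by metis
  have ivG: "iv y \<in> G" if "y \<in> ?W" for y using iv(1)[OF that] WG by blast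
  have iv_eq: "iv (\<theta> w) = w" if "w \<in> ?W" for w
    using uniq[OF iv(1) that iv(2)] that WG by blast
  have iv_closed: "closed {y \<in> ?W. norm (iv y) \<le> real n}" for n :: nat
    unfolding closed_sequential_limits
  proof (intro allI impI)
    fix s l assume s: "(\<forall>k. s k \<in> {y \<in> ?W. norm (iv y) \<le> real n}) \<and> s \<longlonglongrightarrow> l"
    have sW: "s k \<in> ?W" "norm (iv (s k)) \<le> real n" for k using s by blast+
    have l: "l \<in> ?W" using closed_sequentially[OF cl, of s l] sW(1) s by blast
    obtain v where v: "v \<in> G" "iv l = \<theta> v" using iv(1)[OF l] by blast
    \<comment> \<open>Writing \<open>iv l\<close> as a value of \<theta> takes the inverse off the
      varying argument; this makes the norm of \<open>iv\<close> lower semicontinuous.\<close>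
    have move: "cinner (iv y) (iv l) = cinner y v" if "y \<in> ?W" for y
      using sym[OF ivG[OF that] v(1)] iv(2)[OF that] v(2) by simp
    have "(\<lambda>k. cmod (cinner (s k) v)) \<longlonglongrightarrow> cmod (cinner l v)"
      by (intro tendsto_intros tendsto_cinner) (use s in blast)
    moreover have "cmod (cinner (s k) v) \<le> real n * norm (iv l)" for k
      using norm_cinner_le[of "iv (s k)" "iv l"] mult_right_mono[OF sW(2)[of k], of "norm (iv l)"]
      unfolding move[OF sW(1)] by simp
    ultimately have "cmod (cinner l v) \<le> real n * norm (iv l)"
      by (intro LIMSEQ_le_const2) auto
    then have "(norm (iv l))\<^sup>2 \<le> real n * norm (iv l)"
      by (simp add: move[OF l, symmetric] cinner_self norm_power)
    then have "norm (iv l) \<le> real n"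
      by (cases "iv l = 0") (simp_all add: power2_eq_square)
    then show "l \<in> {y \<in> ?W. norm (iv y) \<le> real n}" using l by simp
  qed
  have iv_diff: "norm (iv (x - y)) \<le> norm (iv x) + norm (iv y)" if xy: "x \<in> ?W" "y \<in> ?W" for x y
  proof -
    have "iv x - iv y \<in> ?W" by (intro complex_vector.subspace_diff[OF sW] iv(1) xy)
    moreover have "\<theta> (iv x - iv y) = x - y"
      using th_diff[OF ivG[OF xy(1)] ivG[OF xy(2)]] iv(2) xy by simp
    ultimately have "iv (x - y) = iv x - iv y" using iv_eq by metis
    then show ?thesis by (simp add: norm_triangle_ineq4)
  qed
  have iv_scale: "norm (iv (r *\<^sub>R x)) = \<bar>r\<bar> * norm (iv x)" if x: "x \<in> ?W" for r x
  proof -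
    have "r *\<^sub>R iv x \<in> ?W"
      unfolding scaleR_scaleC by (intro complex_vector.subspace_scale[OF sW] iv(1) x)
    moreover have "\<theta> (r *\<^sub>R iv x) = r *\<^sub>R x"
      unfolding scaleR_scaleC using bounded_onD(4)[OF th ivG[OF x]] iv(2)[OF x] by simp
    ultimately have "iv (r *\<^sub>R x) = r *\<^sub>R iv x" using iv_eq by metis
    then show ?thesis by simp
  qed
  obtain C where C: "C \<ge> 0" "\<And>y. y \<in> ?W \<Longrightarrow> norm (iv y) \<le> C * norm y"
    by (rule seminorm_bounded_of_closed_sublevels[of ?W "\<lambda>y. norm (iv y)", OF W iv_diff iv_scale iv_closed])
      (assumption | rule that)+
  have "1 / (C + 1) * norm x \<le> norm (\<theta> x)"
    if x: "x \<in> G" "\<And>y. y \<in> G \<Longrightarrow> \<theta> y = 0 \<Longrightarrow> cinner x y = 0" for x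
  proof -
    obtain w where w: "w \<in> ?W" "\<theta> (x - w) = 0" "\<And>v. v \<in> ?W \<Longrightarrow> cinner (x - w) v = 0"
      using symmetric_closed_range_decomposition[OF G th sym cl x(1)] by blast
    have "x - w \<in> G" using x(1) w(1) WG sG by (auto intro: complex_vector.subspace_diff)
    \<comment> \<open>The kernel component \<open>x - w\<close> is orthogonal to \<open>x\<close> by
      assumption and to \<open>w\<close> by construction, so it vanishes and \<open>x\<close> lies
      in the range.\<close>
    then have "cinner x (x - w) = 0" using x(2) w(2) by blast
    moreover have "cinner w (x - w) = 0" using w(3)[OF w(1)] cinner_eq_0_commute by blast
    ultimately have "cinner (x - w) (x - w) = 0" by (simp add: cinner_diff_left)
    then have "x = w" by simp
    then have "norm x \<le> C * norm (\<theta> x)" using C(2)[of "\<theta> x"] iv_eq[OF w(1)] x(1) by auto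
    also have "\<dots> \<le> (C + 1) * norm (\<theta> x)" by (simp add: mult_right_mono)
    finally show ?thesis using C(1) by (simp add: field_simps)
  qed
  then show ?thesis using that[of "1 / (C + 1)"] C(1) by simp
qed


section \<open>Lower bounds for the Weyl function\<close>

context quasi_triple
begin

text \<open>The factor \<open>\<parallel>u\<parallel> \<le> 2 C \<parallel>\<Gamma>0 u\<parallel>\<close> comes from absorbing \<open>\<parallel>u\<parallel>\<close> in the
  decomposition of \<open>u\<close> at the reference point \<open>l\<close>.\<close>

lemma weyl_function_perturbation:
  assumes R: "is_resolvent H A0 l R"
  obtains K d where "K > 0" "d > 0"
    "\<And>\<mu> u. cmod (\<mu> - l) \<le> d \<Longrightarrow> (u, \<mu> *\<^sub>C u) \<in> T \<Longrightarrow>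
      norm (\<Gamma>1 (res_hat l R (\<mu> *\<^sub>C u - l *\<^sub>C u))) \<le> K * cmod (\<mu> - l) * norm (\<Gamma>0 (u, \<mu> *\<^sub>C u))"
proof -
  obtain Cg where Cg: "Cg > 0" "\<And>u. (u, l *\<^sub>C u) \<in> T \<Longrightarrow> norm u \<le> Cg * norm (\<Gamma>0 (u, l *\<^sub>C u))"
    using gamma_field_bounded[OF R] by blast
  obtain C1 where C1: "C1 > 0" "\<And>h. h \<in> H \<Longrightarrow> norm (\<Gamma>1 (res_hat l R h)) \<le> C1 * norm h"
    using bounded_on_bound[OF boundary_map_bounded(2)[OF A0_subset self_adjoint_A0 R]] by blast
  have "bounded_on H H R" using R by (simp add: is_resolvent_def)
  then obtain CR where CR: "CR > 0" "\<And>h. h \<in> H \<Longrightarrow> norm (R h) \<le> CR * norm h"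
    using bounded_on_bound by blast
  have "norm (\<Gamma>1 (res_hat l R (\<mu> *\<^sub>C u - l *\<^sub>C u))) \<le> (2 * C1 * Cg) * cmod (\<mu> - l) * norm (\<Gamma>0 (u, \<mu> *\<^sub>C u))"
    if \<mu>: "cmod (\<mu> - l) \<le> 1 / (2 * CR)" and u: "(u, \<mu> *\<^sub>C u) \<in> T" for \<mu> u
  proof -
    define h where "h = \<mu> *\<^sub>C u - l *\<^sub>C u"
    have h: "h \<in> H" using T_mem[OF u] subspace_H
      by (auto simp: h_def intro: complex_vector.subspace_diff complex_vector.subspace_scale)
    have nh: "norm h = cmod (\<mu> - l) * norm u"
      by (simp add: h_def norm_scaleC flip: complex_vector.scale_left_diff_distrib)
    have "norm (u - R h) \<le> Cg * norm (\<Gamma>0 (u, \<mu> *\<^sub>C u))"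
      using Cg(2)[OF defect_decomposition(1)[OF R u]] unfolding defect_decomposition(2)[OF R u]
      by (simp add: h_def)
    \<comment> \<open>The radius \<open>1 / (2 * CR)\<close> is chosen for this factor 1/2.\<close>
    moreover have "norm (R h) \<le> norm u / 2"
    proof -
      have "norm (R h) \<le> (CR * cmod (\<mu> - l)) * norm u" using CR(2)[OF h] by (simp add: nh)
      also have "\<dots> \<le> (1 / 2) * norm u"
        using \<mu> CR(1) by (intro mult_right_mono) (auto simp: field_simps)
      finally show ?thesis by simp
    qed
    ultimately have "norm u \<le> 2 * Cg * norm (\<Gamma>0 (u, \<mu> *\<^sub>C u))"
      using norm_triangle_ineq2[of u "R h"] by linarith
    then have "C1 * cmod (\<mu> - l) * norm u \<le> C1 * cmod (\<mu> - l) * (2 * Cg * norm (\<Gamma>0 (u, \<mu> *\<^sub>C u)))"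
      using C1(1) by (intro mult_left_mono) auto
    then show ?thesis
      using C1(2)[OF h] unfolding nh h_def[symmetric] by (simp add: mult_ac)
  qed
  then show ?thesis using that[of "2 * C1 * Cg" "1 / (2 * CR)"] C1(1) Cg(1) CR(1) by simp
qed

text \<open>Only \<open>\<mu>\<close> near \<open>l\<close> is claimed: compactness of the Weyl function at a single real point does
  not propagate to other points, but a norm-small perturbation suffices here.\<close>

lemma weyl_bounded_below:
  assumes R: "is_resolvent H A0 l R"
    and cpt: "compact Kc"
      "\<And>u. (u, l *\<^sub>C u) \<in> T \<Longrightarrow> norm (\<Gamma>0 (u, l *\<^sub>C u)) \<le> 1 \<Longrightarrow> \<Gamma>1 (u, l *\<^sub>C u) \<in> Kc"
    and th: "bounded_on G G \<theta>"
      "\<And>x y. x \<in> G \<Longrightarrow> y \<in> G \<Longrightarrow> cinner (\<theta> x) y = cinner x (\<theta> y)"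
      "closed (\<theta> ` G)"
    and ker: "finite B" "{x \<in> G. \<theta> x = 0} \<subseteq> complex_vector.span B"
  obtains \<mu> C where "Im \<mu> \<noteq> 0"
    "\<And>u. (u, \<mu> *\<^sub>C u) \<in> T \<Longrightarrow>
      norm (\<Gamma>0 (u, \<mu> *\<^sub>C u)) \<le> C * norm (\<theta> (\<Gamma>0 (u, \<mu> *\<^sub>C u)) - \<Gamma>1 (u, \<mu> *\<^sub>C u))"
proof -
  obtain c where c: "c > 0"
    "\<And>x. x \<in> G \<Longrightarrow> (\<And>y. y \<in> G \<Longrightarrow> \<theta> y = 0 \<Longrightarrow> cinner x y = 0) \<Longrightarrow> c * norm x \<le> norm (\<theta> x)"
    using symmetric_closed_range_bounded_below[OF hilbert_G th] by blast
  obtain K d where K: "K > 0" "d > 0"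
    "\<And>\<mu> u. cmod (\<mu> - l) \<le> d \<Longrightarrow> (u, \<mu> *\<^sub>C u) \<in> T \<Longrightarrow>
      norm (\<Gamma>1 (res_hat l R (\<mu> *\<^sub>C u - l *\<^sub>C u))) \<le> K * cmod (\<mu> - l) * norm (\<Gamma>0 (u, \<mu> *\<^sub>C u))"
    using weyl_function_perturbation[OF R] by blast
  \<comment> \<open>\<open>d\<close> keeps \<mu> where the perturbation estimate holds; c/(2K)
    limits the perturbation to half of the lower bound \<open>c\<close>, so that it can be
    absorbed.\<close>
  define \<epsilon> where "\<epsilon> = min d (c / (2 * K))"
  have \<epsilon>: "\<epsilon> > 0" "\<epsilon> \<le> d" "K * \<epsilon> \<le> c / 2"
    using K c(1) by (auto simp: \<epsilon>_def min_def field_simps)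
  \<comment> \<open>The step leads vertically away from the real axis, so \<mu> is nonreal whatever
    the sign of \<open>Im l\<close>.\<close>
  define \<mu> where "\<mu> = l + complex_of_real (if Im l \<ge> 0 then \<epsilon> else - \<epsilon>) * \<i>"
  have Im\<mu>: "Im \<mu> \<noteq> 0" using \<epsilon>(1) by (auto simp: \<mu>_def)
  have \<mu>l: "cmod (\<mu> - l) = \<epsilon>" using \<epsilon>(1) by (simp add: \<mu>_def norm_mult)
  let ?g0 = "\<lambda>u. \<Gamma>0 (u, \<mu> *\<^sub>C u)" and ?g1 = "\<lambda>u. \<Gamma>1 (u, \<mu> *\<^sub>C u)"
  let ?N = "{x \<in> G. \<theta> x = 0}"
  note th_diff = clinear_on_diff[OF bounded_onD(1)[OF th(1)] subspace_G]
  define P where "P h = \<Gamma>1 (res_hat l R h)" for h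
  have P: "bounded_on H G P"
    unfolding P_def by (rule boundary_map_bounded(2)[OF A0_subset self_adjoint_A0 R])
  note P_diff = clinear_on_diff[OF bounded_onD(1)[OF P] subspace_H]
  have "\<exists>C. \<forall>u. (u, \<mu> *\<^sub>C u) \<in> T \<longrightarrow> norm (?g0 u) \<le> C * norm (\<theta> (?g0 u) - ?g1 u)"
  proof (rule ccontr)
    assume "\<not> ?thesis"
    then have "\<forall>n. \<exists>u. (u, \<mu> *\<^sub>C u) \<in> T \<and>
        norm (?g0 u) > real (Suc n) * norm (\<theta> (?g0 u) - ?g1 u)"
      by (meson not_le_imp_less)
    then obtain w where w: "\<And>n. (w n, \<mu> *\<^sub>C w n) \<in> T"
      "\<And>n. norm (?g0 (w n)) > real (Suc n) * norm (\<theta> (?g0 (w n)) - ?g1 (w n))" by metis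
    \<comment> \<open>Normalizing the \<Gamma>0 values gives unit vectors \<open>x n\<close> on
      which \<theta> minus the Weyl function at \<mu> takes the small values
      \<open>s n\<close>.\<close>
    define t where "t n = complex_of_real (1 / norm (?g0 (w n)))" for n
    define u where "u n = t n *\<^sub>C w n" for n
    have wpos: "norm (?g0 (w n)) > 0" for n
      using w(2)[of n] by (smt (verit) mult_nonneg_nonneg norm_ge_zero of_nat_0_le_iff)
    have ut: "(u n, \<mu> *\<^sub>C u n) = t n *\<^sub>C (w n, \<mu> *\<^sub>C w n)" for n
      by (simp add: u_def scaleC_prod_def scaleC_scaleC mult.commute)
    have uT: "(u n, \<mu> *\<^sub>C u n) \<in> T" for n
      unfolding ut using T_scale[OF w(1)] .
    define x where "x n = ?g0 (u n)" for n
    have x_t: "x n = t n *\<^sub>C ?g0 (w n)" and g1_t: "?g1 (u n) = t n *\<^sub>C ?g1 (w n)" for n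
      unfolding x_def ut using clinear_Gamma0 clinear_Gamma1 w(1) unfolding clinear_on_def by blast+
    have xG: "x n \<in> G" for n unfolding x_def using Gamma0_in[OF uT] .
    have x1: "norm (x n) = 1" for n
      using wpos[of n] by (simp add: x_t norm_scaleC t_def norm_divide)
    define s where "s n = \<theta> (x n) - ?g1 (u n)" for n
    have sle: "norm (s n) \<le> inverse (real (Suc n))" for n
    proof -
      have "s n = t n *\<^sub>C (\<theta> (?g0 (w n)) - ?g1 (w n))"
        unfolding s_def x_t g1_t
        using bounded_onD(4)[OF th(1) Gamma0_in[OF w(1)]]
        by (simp add: complex_vector.scale_right_diff_distrib)
      then have "norm (s n) = norm (\<theta> (?g0 (w n)) - ?g1 (w n)) / norm (?g0 (w n))"
        by (simp add: norm_scaleC t_def norm_divide)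
      also have "\<dots> \<le> inverse (real (Suc n))"
        using w(2)[of n] wpos[of n] by (simp add: pos_divide_le_eq pos_le_divide_eq
            inverse_eq_divide mult.commute less_imp_le del: of_nat_Suc)
      finally show ?thesis .
    qed
    have s0: "s \<longlonglongrightarrow> 0"
      by (rule Lim_null_comparison[OF _ LIMSEQ_inverse_real_of_nat])
        (rule always_eventually, rule allI, rule sle)
    define h where "h n = \<mu> *\<^sub>C u n - l *\<^sub>C u n" for n
    have hH: "h n \<in> H" for n using T_mem[OF uT[of n]] subspace_H
      by (auto simp: h_def intro: complex_vector.subspace_diff complex_vector.subspace_scale)
    \<comment> \<open>\<open>v n\<close> is the defect vector at \<open>l\<close> with the same
      \<Gamma>0 value. So \<open>k n\<close> is the Weyl function at \<open>l\<close> on a unit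
      vector, hence in \<open>Kc\<close>, and \<open>P (h n)\<close> is the increment of the Weyl
      function from \<open>l\<close> to \<mu>.\<close>
    define v where "v n = u n - R (h n)" for n
    define k where "k n = \<Gamma>1 (v n, l *\<^sub>C v n)" for n
    have v: "(v n, l *\<^sub>C v n) \<in> T" "\<Gamma>0 (v n, l *\<^sub>C v n) = x n" "?g1 (u n) = k n + P (h n)" for n
      using defect_decomposition[OF R uT[of n]] by (simp_all add: v_def k_def x_def P_def h_def)
    have thx: "\<theta> (x n) = s n + k n + P (h n)" for n
      unfolding s_def v(3) by simp
    \<comment> \<open>\<open>p\<close> is the kernel component of \<open>x n\<close>. The lower
      bound \<open>c\<close> says nothing about it, but the finite-dimensional kernel yields a
      convergent subsequence.\<close>
    have "\<exists>p. p \<in> ?N \<and> x n - p \<in> G \<and> (\<forall>y\<in>?N. cinner (x n - p) y = 0) \<and> norm p \<le> 1" for n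
    proof -
      obtain q where q: "q \<in> \<theta> ` G" "\<theta> (x n - q) = 0" "\<And>v. v \<in> \<theta> ` G \<Longrightarrow> cinner (x n - q) v = 0"
        using symmetric_closed_range_decomposition[OF hilbert_G th xG[of n]] by blast
      have qG: "q \<in> G" using q(1) bounded_onD(2)[OF th(1)] by blast
      have pG: "x n - q \<in> G" using xG qG subspace_G by (simp add: complex_vector.subspace_diff)
      have qN: "cinner q y = 0" if "y \<in> ?N" for y
      proof -
        obtain z where "z \<in> G" "q = \<theta> z" using q(1) by blast
        then show ?thesis using th(2)[of z y] that by simp
      qed
      have "cinner (x n - q) (x n - q) = cinner (x n) (x n - q)"
        using qN[of "x n - q"] pG q(2) by (simp add: cinner_diff_left)
      then have "(norm (x n - q))\<^sup>2 = cmod (cinner (x n) (x n - q))"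
        unfolding cinner_self by (metis abs_of_nonneg norm_of_real zero_le_power2)
      also have "\<dots> \<le> 1 * norm (x n - q)" using norm_cinner_le[of "x n" "x n - q"] x1 by simp
      finally have "norm (x n - q) \<le> 1"
        by (cases "x n = q") (auto simp: power2_eq_square)
      then show ?thesis using q(2) pG qG qN by (intro exI[of _ "x n - q"]) simp
    qed
    then have "\<exists>p. \<forall>n. p n \<in> ?N \<and> x n - p n \<in> G \<and>
        (\<forall>y\<in>?N. cinner (x n - p n) y = 0) \<and> norm (p n) \<le> 1"
      by (intro choice allI)
    then obtain p where p: "\<forall>n. p n \<in> ?N \<and> x n - p n \<in> G \<and>
        (\<forall>y\<in>?N. cinner (x n - p n) y = 0) \<and> norm (p n) \<le> 1"
      by (rule exE)
    define q where "q n = x n - p n" for n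
    have pq: "x n = p n + q n" "p n \<in> ?N" "q n \<in> G" "norm (p n) \<le> 1" for n
      using p[rule_format, of n] by (simp_all add: q_def)
    have q_orth: "cinner (q n) y = 0" if "y \<in> ?N" for n y
      using p[rule_format, of n] that by (simp add: q_def)
    have "seq_compact Kc" using cpt(1) by (simp add: compact_eq_seq_compact_metric)
    moreover have "\<forall>n. k n \<in> Kc" unfolding k_def using cpt(2)[OF v(1)] v(2) x1 by simp
    ultimately obtain a r where r: "strict_mono r" "(\<lambda>n. k (r n)) \<longlonglongrightarrow> a"
      by (rule seq_compactE) (simp add: o_def)
    have "p n \<in> complex_vector.span B" for n using pq(2) ker(2) by blast
    then obtain b r' where r': "strict_mono r'" "(\<lambda>n. p (r (r' n))) \<longlonglongrightarrow> b"
      using bounded_seq_in_finite_span[OF ker(1), of "\<lambda>n. p (r n)" 1] pq(4) by blast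
    define \<rho> where "\<rho> n = r (r' n)" for n
    have \<rho>: "strict_mono \<rho>" unfolding \<rho>_def using strict_mono_compose[OF r(1) r'(1)] .
    have lims: "(\<lambda>n. s (\<rho> n)) \<longlonglongrightarrow> 0" "(\<lambda>n. k (\<rho> n)) \<longlonglongrightarrow> a" "(\<lambda>n. p (\<rho> n)) \<longlonglongrightarrow> b"
      using LIMSEQ_subseq_LIMSEQ[OF s0 \<rho>] LIMSEQ_subseq_LIMSEQ[OF r(2) r'(1)] r'(2)
      by (simp_all add: o_def \<rho>_def)
    \<comment> \<open>\<open>z\<close> collects the quantities that converge along the subsequence;
      they control the differences of \<open>x\<close>.\<close>
    define z where "z n = (s n, k n, p n)" for n
    \<comment> \<open>With x, q standing for differences: c|q| \<le> 2Z + (c/2)|x| and |x| \<le> Z +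
      |q|. Absorbing (c/2)|q| gives the factor for |q|; the final 1 is the kernel component.\<close>
    have "norm (x n - x m) \<le> ((2 + c / 2) * (2 / c) + 1) * norm (z n - z m)" for n m
    proof -
      define Z where "Z = norm (z n - z m)"
      have Z: "norm (s n - s m) \<le> Z" "norm (k n - k m) \<le> Z" "norm (p n - p m) \<le> Z"
        unfolding Z_def z_def
        using norm_fst_le[of "s n - s m" "(k n - k m, p n - p m)"]
          norm_snd_le[of "(k n - k m, p n - p m)" "s n - s m"]
          norm_fst_le[of "k n - k m" "p n - p m"] norm_snd_le[of "p n - p m" "k n - k m"]
        by auto
      have d: "(u n - u m, \<mu> *\<^sub>C (u n - u m)) \<in> T" "?g0 (u n - u m) = x n - x m"
        using T_diff[OF uT[of n] uT[of m]] Gamma0_diff[OF uT[of n] uT[of m]]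
        by (simp_all add: complex_vector.scale_right_diff_distrib x_def)
      have "P (h n) - P (h m) = P (h n - h m)" using P_diff[OF hH hH] by simp
      also have "h n - h m = \<mu> *\<^sub>C (u n - u m) - l *\<^sub>C (u n - u m)"
        by (simp add: h_def complex_vector.scale_right_diff_distrib algebra_simps)
      finally have "norm (P (h n) - P (h m)) \<le> K * \<epsilon> * norm (x n - x m)"
        using K(3)[OF _ d(1)] \<epsilon>(2) unfolding \<mu>l d(2) P_def by simp
      also have "\<dots> \<le> c / 2 * norm (x n - x m)" by (rule mult_right_mono[OF \<epsilon>(3) norm_ge_zero])
      finally have e: "norm (P (h n) - P (h m)) \<le> c / 2 * norm (x n - x m)" .
      have pG: "p n \<in> G" for n using pq(2) by blast
      have qd: "q n - q m \<in> G" using pq(3) subspace_G by (simp add: complex_vector.subspace_diff)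
      have tq: "\<theta> (q n) = \<theta> (x n)" for n
        using bounded_onD(3)[OF th(1) pG pq(3)] pq(2)[of n] by (simp add: pq(1))
      have "c * norm (q n - q m) \<le> norm (\<theta> (q n - q m))"
        using q_orth by (intro c(2)[OF qd]) (simp add: cinner_diff_left)
      also have "\<theta> (q n - q m) = (s n - s m) + (k n - k m) + (P (h n) - P (h m))"
        unfolding th_diff[OF pq(3) pq(3)] tq thx by simp
      also have "norm \<dots> \<le> norm (s n - s m) + norm (k n - k m) + norm (P (h n) - P (h m))"
        using norm_triangle_ineq norm_triangle_le order_trans add_right_mono by metis
      also have "\<dots> \<le> Z + Z + c / 2 * norm (x n - x m)" using Z e by linarith
      finally have A: "c * norm (q n - q m) \<le> Z + Z + c / 2 * norm (x n - x m)" .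
      have Bx: "norm (x n - x m) \<le> Z + norm (q n - q m)"
      proof -
        have "x n - x m = (p n - p m) + (q n - q m)" by (simp add: pq(1))
        then show ?thesis using norm_triangle_ineq[of "p n - p m" "q n - q m"] Z(3) by simp
      qed
      have "c / 2 * norm (x n - x m) \<le> c / 2 * (Z + norm (q n - q m))"
        using Bx c(1) by (intro mult_left_mono) auto
      with A have "(c / 2) * norm (q n - q m) \<le> (2 + c / 2) * Z"
        by (simp add: algebra_simps)
      then have "norm (q n - q m) \<le> (2 + c / 2) * (2 / c) * Z"
        using c(1) by (simp add: field_simps)
      then show ?thesis using Bx unfolding Z_def by (simp add: algebra_simps)
    qed
    then have xle: "norm (x (\<rho> n) - x (\<rho> m)) \<le> ((2 + c / 2) * (2 / c) + 1) * norm (z (\<rho> n) - z (\<rho> m))" for n m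
      by blast
    have "Cauchy (\<lambda>n. z (\<rho> n))"
      unfolding z_def using lims by (intro LIMSEQ_imp_Cauchy[of _ "(0, a, b)"] tendsto_Pair)
    then have "Cauchy (\<lambda>n. x (\<rho> n))" by (rule Cauchy_of_Lipschitz) (rule xle)
    moreover have "complete G" using hilbert_G by (simp add: hilbert_space_def)
    moreover have "\<forall>n. x (\<rho> n) \<in> G" using xG by blast
    ultimately obtain y where y: "y \<in> G" "(\<lambda>n. x (\<rho> n)) \<longlonglongrightarrow> y"
      by (metis completeE)
    have "norm y = 1"
      using LIMSEQ_unique[OF tendsto_norm[OF y(2)], of 1] by (simp add: x1)
    obtain Ct where Ct: "\<And>x. x \<in> G \<Longrightarrow> norm (\<theta> x) \<le> Ct * norm x"
      using bounded_on_bound[OF th(1)] by blast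
    have "(\<lambda>n. \<theta> (x (\<rho> n)) - \<theta> y) \<longlonglongrightarrow> 0"
    proof (rule Lim_null_comparison)
      show "\<forall>\<^sub>F n in sequentially. norm (\<theta> (x (\<rho> n)) - \<theta> y) \<le> Ct * norm (x (\<rho> n) - y)"
        using Ct[OF complex_vector.subspace_diff[OF subspace_G xG y(1)]] th_diff[OF xG y(1)] by simp
      have "(\<lambda>n. Ct * norm (x (\<rho> n) - y)) \<longlonglongrightarrow> Ct * norm (y - y)"
        by (intro tendsto_intros y)
      then show "(\<lambda>n. Ct * norm (x (\<rho> n) - y)) \<longlonglongrightarrow> 0" by simp
    qed
    then have "(\<lambda>n. \<theta> (x (\<rho> n))) \<longlonglongrightarrow> \<theta> y" by (rule LIM_zero_cancel)
    then have "(\<lambda>n. \<theta> (x (\<rho> n)) - s (\<rho> n)) \<longlonglongrightarrow> \<theta> y - 0" using lims(1) by (rule tendsto_diff)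
    then have g1: "(\<lambda>n. ?g1 (u (\<rho> n))) \<longlonglongrightarrow> \<theta> y" by (simp add: s_def)
    \<comment> \<open>Green's identity for \<open>u n\<close> with itself: the limit is 0 by
      symmetry of \<theta>, and a nonreal \<mu> then forces the defect vectors to 0.\<close>
    have "(\<lambda>n. cinner (?g1 (u (\<rho> n))) (x (\<rho> n)) - cinner (x (\<rho> n)) (?g1 (u (\<rho> n))))
        \<longlonglongrightarrow> cinner (\<theta> y) y - cinner y (\<theta> y)"
      by (intro tendsto_diff tendsto_cinner g1 y(2))
    moreover have "cinner (?g1 (u n)) (x n) - cinner (x n) (?g1 (u n)) =
        (\<mu> - cnj \<mu>) * complex_of_real ((norm (u n))\<^sup>2)" for n
      using green[OF uT[of n] uT[of n]]
      by (simp add: x_def cinner_scaleC_left cinner_scaleC_right cinner_self algebra_simps)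
    ultimately have "(\<lambda>n. (\<mu> - cnj \<mu>) * complex_of_real ((norm (u (\<rho> n)))\<^sup>2)) \<longlonglongrightarrow> 0"
      using th(2)[OF y(1) y(1)] by simp
    then have "(\<lambda>n. norm ((\<mu> - cnj \<mu>) * complex_of_real ((norm (u (\<rho> n)))\<^sup>2))) \<longlonglongrightarrow> 0"
      by (rule tendsto_norm_zero)
    then have "(\<lambda>n. cmod (\<mu> - cnj \<mu>) * (norm (u (\<rho> n)))\<^sup>2) \<longlonglongrightarrow> 0"
      by (simp add: norm_mult norm_power)
    moreover have "cmod (\<mu> - cnj \<mu>) \<noteq> 0" using Im\<mu> by (simp add: complex_diff_cnj)
    ultimately have "(\<lambda>n. (norm (u (\<rho> n)))\<^sup>2) \<longlonglongrightarrow> 0"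
      using tendsto_mult_left_iff[of "cmod (\<mu> - cnj \<mu>)" "\<lambda>n. (norm (u (\<rho> n)))\<^sup>2" 0] by simp
    then have "(\<lambda>n. sqrt ((norm (u (\<rho> n)))\<^sup>2)) \<longlonglongrightarrow> sqrt 0" by (rule tendsto_real_sqrt)
    then have u0: "(\<lambda>n. u (\<rho> n)) \<longlonglongrightarrow> 0" by (simp add: tendsto_norm_zero_iff)
    then have "(\<lambda>n. \<mu> *\<^sub>C u (\<rho> n)) \<longlonglongrightarrow> \<mu> *\<^sub>C 0" by (intro tendsto_scaleC tendsto_const)
    then have "(\<lambda>n. \<mu> *\<^sub>C u (\<rho> n)) \<longlonglongrightarrow> 0" by simp
    then have "y = 0"
      using Gamma_closable(1)[of "\<lambda>n. (u (\<rho> n), \<mu> *\<^sub>C u (\<rho> n))", OF uT] u0 y(2) g1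
      by (simp add: x_def)
    then show False using \<open>norm y = 1\<close> by simp
  qed
  then show ?thesis using that Im\<mu> by blast
qed

text \<open>\<open>X\<close> extends the inverse of \<theta> minus the Weyl function at \<mu>,
  bounded by \<open>bd\<close>. \<open>Y\<close> collects the spectral shifts, from \<open>l\<close>
  to \<mu> for the extension and from \<mu> to \<nu> within A_0.\<close>

lemma boundary_value_factorization:
  assumes R0: "is_resolvent H A0 \<mu> R0" and R1: "is_resolvent H A0 \<nu> R1"
    and th: "bounded_on G G \<theta>"
    and bd: "\<And>u. (u, \<mu> *\<^sub>C u) \<in> T \<Longrightarrow>
      norm (\<Gamma>0 (u, \<mu> *\<^sub>C u)) \<le> C * norm (\<theta> (\<Gamma>0 (u, \<mu> *\<^sub>C u)) - \<Gamma>1 (u, \<mu> *\<^sub>C u))"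
    and R: "is_resolvent H {f \<in> T. \<Gamma>1 f = \<theta> (\<Gamma>0 f)} l R"
  obtains X Y where "bounded_on G G X" "bounded_on H H Y"
    "\<And>h. h \<in> H \<Longrightarrow> \<Gamma>0 (res_hat l R h) = X (\<Gamma>1 (res_hat \<nu> R1 (Y h)))"
proof -
  define N where "N = {f \<in> T. snd f = \<mu> *\<^sub>C fst f}"
  \<comment> \<open>The image of the defect space under \<open>j\<close> is the graph of the inverse
    to be extended.\<close>
  define j where "j f = (\<theta> (\<Gamma>0 f) - \<Gamma>1 f, \<Gamma>0 f)" for f
  have thG: "\<theta> x \<in> G" if "x \<in> G" for x using bounded_onD(2)[OF th that] .
  have sN: "complex_vector.subspace N"
  proof (rule complex_vector.subspaceI)
    show "0 \<in> N" using complex_vector.subspace_0[OF subspace_T] by (simp add: N_def)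
    show "f + g \<in> N" if "f \<in> N" "g \<in> N" for f g
      using that T_add[of f g] by (simp add: N_def scaleC_add_right)
    fix a f assume f: "f \<in> N"
    then have "snd (a *\<^sub>C f) = \<mu> *\<^sub>C fst (a *\<^sub>C f)"
      by (simp add: N_def scaleC_prod_def scaleC_scaleC mult.commute)
    then show "a *\<^sub>C f \<in> N" using f T_scale[of f a] by (simp only: N_def mem_Collect_eq)
  qed
  have "clinear_on N j"
  proof -
    have "j (f + g) = j f + j g" if "f \<in> T" "g \<in> T" for f g
    proof -
      have "\<Gamma>0 (f + g) = \<Gamma>0 f + \<Gamma>0 g" "\<Gamma>1 (f + g) = \<Gamma>1 f + \<Gamma>1 g"
        using clinear_Gamma0 clinear_Gamma1 that unfolding clinear_on_def by blast+
      then show ?thesis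
        using bounded_onD(3)[OF th Gamma0_in[OF that(1)] Gamma0_in[OF that(2)]] by (simp add: j_def)
    qed
    moreover have "j (a *\<^sub>C f) = a *\<^sub>C j f" if "f \<in> T" for a f
    proof -
      have "\<Gamma>0 (a *\<^sub>C f) = a *\<^sub>C \<Gamma>0 f" "\<Gamma>1 (a *\<^sub>C f) = a *\<^sub>C \<Gamma>1 f"
        using clinear_Gamma0 clinear_Gamma1 that unfolding clinear_on_def by blast+
      then show ?thesis
        using bounded_onD(4)[OF th Gamma0_in[OF that]]
        by (simp add: j_def scaleC_prod_def complex_vector.scale_right_diff_distrib)
    qed
    ultimately show ?thesis unfolding clinear_on_def N_def by blast
  qed
  then have sL: "complex_vector.subspace (j ` N)" by (rule subspace_image[OF sN])
  have LG: "j ` N \<subseteq> G \<times> G"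
    using Gamma0_in Gamma1_in thG subspace_G
    by (auto simp: j_def N_def intro: complex_vector.subspace_diff)
  have Lbd: "norm y \<le> C * norm x" if xy: "(x, y) \<in> j ` N" for x y
  proof -
    obtain f where f: "f \<in> N" "(x, y) = j f" using xy by blast
    have "f = (fst f, \<mu> *\<^sub>C fst f)" using f(1) by (simp add: N_def prod_eq_iff)
    then show ?thesis using bd[of "fst f"] f by (simp add: N_def j_def)
  qed
  obtain X where X: "bounded_on G G X" "\<And>x y. (x, y) \<in> j ` N \<Longrightarrow> X x = y"
    by (rule bounded_extension[OF hilbert_G hilbert_G LG sL Lbd]) (assumption | rule that)+
  have bR: "bounded_on H H R" and bR0: "bounded_on H H R0"
    using R R0 by (auto simp: is_resolvent_def)
  define Y1 where "Y1 h = h + (l - \<mu>) *\<^sub>C R h" for h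
  define Y where "Y h = Y1 h + (\<mu> - \<nu>) *\<^sub>C R0 (Y1 h)" for h
  have Y1: "bounded_on H H Y1"
    unfolding Y1_def
    by (intro bounded_on_add bounded_on_scaleC bounded_on_ident bR subspace_H)
  have Y: "bounded_on H H Y"
    unfolding Y_def
    by (intro bounded_on_add bounded_on_scaleC Y1 bounded_on_comp[OF Y1 bR0] subspace_H)
  have "\<Gamma>0 (res_hat l R h) = X (\<Gamma>1 (res_hat \<nu> R1 (Y h)))" if h: "h \<in> H" for h
  proof -
    have f: "(R h, h + l *\<^sub>C R h) \<in> T" "\<Gamma>1 (res_hat l R h) = \<theta> (\<Gamma>0 (res_hat l R h))"
      using res_hat_in[OF R h] by (auto simp: res_hat_def)
    have k: "Y1 h = (h + l *\<^sub>C R h) - \<mu> *\<^sub>C R h"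
      by (simp add: Y1_def complex_vector.scale_left_diff_distrib)
    define u where "u = R h - R0 (Y1 h)"
    have u: "(u, \<mu> *\<^sub>C u) \<in> T" "\<Gamma>0 (u, \<mu> *\<^sub>C u) = \<Gamma>0 (res_hat l R h)"
      "\<Gamma>1 (u, \<mu> *\<^sub>C u) = \<Gamma>1 (res_hat l R h) - \<Gamma>1 (res_hat \<mu> R0 (Y1 h))"
      using defect_decomposition[OF R0 f(1)] unfolding u_def k by (simp_all add: res_hat_def)
    have Y1H: "Y1 h \<in> H" using bounded_onD(2)[OF Y1 h] .
    have "(R0 (Y1 h), Y1 h + \<mu> *\<^sub>C R0 (Y1 h)) \<in> A0"
      using res_hat_in[OF R0 Y1H] by (simp add: res_hat_def)
    \<comment> \<open>The same element of A_0 is rewritten as a resolvent element at \<nu>, the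
      point where the ideal assumption will be applied.\<close>
    then have "R1 ((Y1 h + \<mu> *\<^sub>C R0 (Y1 h)) - \<nu> *\<^sub>C R0 (Y1 h)) = R0 (Y1 h)"
      using R1 unfolding is_resolvent_def by blast
    then have "R1 (Y h) = R0 (Y1 h)"
      by (simp add: Y_def complex_vector.scale_left_diff_distrib add_diff_eq)
    then have "res_hat \<nu> R1 (Y h) = res_hat \<mu> R0 (Y1 h)"
      by (simp add: res_hat_def Y_def complex_vector.scale_left_diff_distrib)
    moreover have "(\<Gamma>1 (res_hat \<mu> R0 (Y1 h)), \<Gamma>0 (res_hat l R h)) \<in> j ` N"
    proof (rule image_eqI)
      show "(u, \<mu> *\<^sub>C u) \<in> N" using u(1) by (simp add: N_def)
    qed (simp add: j_def u f)
    ultimately show ?thesis using X(2) by simp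
  qed
  then show ?thesis using that X(1) Y by blast
qed

text \<open>The duality in relational form, so that the gamma field can be exchanged for any
  relation with the same adjoint.\<close>

lemma gamma_field_adjoint_mem:
  assumes R: "is_resolvent H A0 (cnj l) R" and h: "h \<in> H"
  shows "(h, \<Gamma>1 (res_hat (cnj l) R h)) \<in> rel_adjoint G H (gamma_field T \<Gamma>0 l)"
proof -
  have "\<Gamma>1 (res_hat (cnj l) R h) \<in> G"
    using res_hat_in[OF R h] A0_subset Gamma1_in by blast
  moreover have "cinner u h = cinner (\<Gamma>0 (u, l *\<^sub>C u)) (\<Gamma>1 (res_hat (cnj l) R h))"
    if "(u, l *\<^sub>C u) \<in> T" for u
    using gamma_field_green[OF R h that] cinner_commute by metis
  ultimately show ?thesis
    using h unfolding rel_adjoint_def gamma_field_def defect_graph_def rel_ker_def rel_shift_def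
    by auto
qed

end


section \<open>Operator ideals\<close>

lemma operator_ideal_comp:
  assumes "operator_ideal_class \<AA>" "separable_hilbert_space H" "separable_hilbert_space K"
    "separable_hilbert_space H1" "separable_hilbert_space K1"
    "S \<in> \<AA> H K" "B \<in> bounded_ops H1 H" "C \<in> bounded_ops K K1"
  shows "B O S O C \<in> \<AA> H1 K1"
  using assms unfolding operator_ideal_class_def by blast

lemma operator_ideal_bounded:
  assumes "operator_ideal_class \<AA>" "separable_hilbert_space H" "separable_hilbert_space K"
  shows "\<AA> H K \<subseteq> bounded_ops H K"
  using assms unfolding operator_ideal_class_def compact_ops_def by blast

text \<open>The ideal axioms list sums but no scalar multiples; negation is composition with the
  bounded operator -1.\<close>

lemma graph_on_uminus_in_ideal:
  assumes "separable_hilbert_space K" "separable_hilbert_space L"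
    "operator_ideal_class \<AA>" "graph_on K q \<in> \<AA> K L" "q ` K \<subseteq> L"
  shows "graph_on K (\<lambda>x. (-1) *\<^sub>C q x) \<in> \<AA> K L"
proof -
  have s: "complex_vector.subspace K" "complex_vector.subspace L"
    using assms by (auto simp: separable_hilbert_space_def hilbert_space_def)
  have "graph_on K (\<lambda>x. x) O graph_on K q O graph_on L (\<lambda>x. (-1) *\<^sub>C x) \<in> \<AA> K L"
    by (rule operator_ideal_comp[OF assms(3,1,2,1,2,4)])
      (intro graph_on_bounded_ops s bounded_on_ident bounded_on_scaleC)+
  then show ?thesis using assms(5) by (simp add: graph_on_relcomp)
qed

lemma extension_graph_on:
  assumes "\<Gamma>0 ` T \<subseteq> G"
  shows "extension T \<Gamma>0 \<Gamma>1 (graph_on G \<theta>) = {f \<in> T. \<Gamma>1 f = \<theta> (\<Gamma>0 f)}"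
  using assms unfolding extension_def graph_on_def by auto

lemma bounded_self_adjointE:
  assumes "\<Theta> \<in> bounded_ops G G" "self_adjoint_relation G \<Theta>"
  obtains \<theta> where "bounded_on G G \<theta>" "\<Theta> = graph_on G \<theta>"
    "\<And>x y. x \<in> G \<Longrightarrow> y \<in> G \<Longrightarrow> cinner (\<theta> x) y = cinner x (\<theta> y)"
proof -
  obtain \<theta> where th: "bounded_on G G \<theta>" "\<Theta> = graph_on G \<theta>"
    using bounded_opsE[OF assms(1)] by blast
  have "cinner (\<theta> x) y = cinner x (\<theta> y)" if "x \<in> G" "y \<in> G" for x y
    using self_adjointD(3)[OF assms(2), of x "\<theta> x" y "\<theta> y"] that
    by (simp add: th(2) graph_on_def)
  then show ?thesis using that th by blast
qed

lemma not_ess_spectrum_0D: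
  assumes "0 \<notin> ess_spectrum G (graph_on G \<theta>)"
  shows "closed (\<theta> ` G)" "\<exists>B. finite B \<and> {x \<in> G. \<theta> x = 0} \<subseteq> complex_vector.span B"
proof -
  have "rel_shift (graph_on G \<theta>) 0 = graph_on G \<theta>" by (auto simp: rel_shift_def)
  then have "fredholm G G (graph_on G \<theta>)" using assms by (simp add: ess_spectrum_def)
  moreover have "Range (graph_on G \<theta>) = \<theta> ` G" by (auto simp: graph_on_def)
  moreover have "rel_ker (graph_on G \<theta>) = {x \<in> G. \<theta> x = 0}"
    by (auto simp: rel_ker_def graph_on_def)
  ultimately show "closed (\<theta> ` G)" "\<exists>B. finite B \<and> {x \<in> G. \<theta> x = 0} \<subseteq> complex_vector.span B"
    by (simp_all add: fredholm_def)
qed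

section \<open>Boundary values of resolvents and the ideal property\<close>

context quasi_triple
begin

lemma weyl_function_mem: "(u, l *\<^sub>C u) \<in> T \<Longrightarrow>
    (\<Gamma>0 (u, l *\<^sub>C u), \<Gamma>1 (u, l *\<^sub>C u)) \<in> weyl_function T \<Gamma>0 \<Gamma>1 l"
  unfolding weyl_function_def defect_graph_def rel_ker_def rel_shift_def by auto

text \<open>The adjoint \<open>q\<close> of the boundary map lies in the ideal, the boundary map
  itself in the adjoint ideal. The product formula needs one factor of each kind.\<close>

lemma boundary_value_in_ideal:
  assumes sepH: "separable_hilbert_space H" and sepG: "separable_hilbert_space G"
    and AA: "operator_ideal_class \<AA>"
    and l0: "l0 \<in> resolvent_set H A0" and M: "closure (weyl_function T \<Gamma>0 \<Gamma>1 l0) \<in> compact_ops G G"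
    and l1: "l1 \<in> resolvent_set H A0"
    and gamma: "rel_adjoint G H (gamma_field T \<Gamma>0 l1) \<in> ideal_adjoint \<AA> H G"
    and th: "bounded_on G G \<theta>" "\<And>x y. x \<in> G \<Longrightarrow> y \<in> G \<Longrightarrow> cinner (\<theta> x) y = cinner x (\<theta> y)"
    and fred: "0 \<notin> ess_spectrum G (graph_on G \<theta>)"
    and R: "is_resolvent H {f \<in> T. \<Gamma>1 f = \<theta> (\<Gamma>0 f)} l R"
  obtains q where "bounded_on G H q" "graph_on G q \<in> \<AA> G H"
    "\<And>h z. h \<in> H \<Longrightarrow> z \<in> G \<Longrightarrow> cinner (\<Gamma>0 (res_hat l R h)) z = cinner h (q z)"
proof -
  obtain Rl0 where Rl0: "is_resolvent H A0 l0 Rl0" using resolvent_setE[OF l0] by blast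
  obtain Rl1 where "is_resolvent H A0 l1 Rl1" using resolvent_setE[OF l1] by blast
  then obtain R1 where R1: "is_resolvent H A0 (cnj l1) R1"
    using self_adjoint_resolvent_cnj[OF hilbert_H self_adjoint_A0] by blast
  define Kc where "Kc = closure (closure (weyl_function T \<Gamma>0 \<Gamma>1 l0) `` cball 0 1)"
  have Kc: "compact Kc" using M by (simp add: compact_ops_def Kc_def)
  have inKc: "\<Gamma>1 (u, l0 *\<^sub>C u) \<in> Kc" if u: "(u, l0 *\<^sub>C u) \<in> T" "norm (\<Gamma>0 (u, l0 *\<^sub>C u)) \<le> 1" for u
  proof -
    have "\<Gamma>1 (u, l0 *\<^sub>C u) \<in> closure (weyl_function T \<Gamma>0 \<Gamma>1 l0) `` cball 0 1"
      by (rule ImageI[OF subsetD[OF closure_subset weyl_function_mem[OF u(1)]]]) (simp add: u(2))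
    then show ?thesis unfolding Kc_def by (rule subsetD[OF closure_subset])
  qed
  obtain B where B: "finite B" "{x \<in> G. \<theta> x = 0} \<subseteq> complex_vector.span B"
    using not_ess_spectrum_0D(2)[OF fred] by blast
  obtain \<mu> C where \<mu>: "Im \<mu> \<noteq> 0"
    and bd: "\<And>u. (u, \<mu> *\<^sub>C u) \<in> T \<Longrightarrow>
      norm (\<Gamma>0 (u, \<mu> *\<^sub>C u)) \<le> C * norm (\<theta> (\<Gamma>0 (u, \<mu> *\<^sub>C u)) - \<Gamma>1 (u, \<mu> *\<^sub>C u))"
    by (rule weyl_bounded_below[OF Rl0 Kc inKc th not_ess_spectrum_0D(1)[OF fred] B])
      (assumption | rule that)+
  obtain R0 where R0: "is_resolvent H A0 \<mu> R0"
    using self_adjoint_nonreal_resolvent[OF hilbert_H self_adjoint_A0 \<mu>] by blast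
  obtain X Y where X: "bounded_on G G X" and Y: "bounded_on H H Y"
    and XY: "\<And>h. h \<in> H \<Longrightarrow> \<Gamma>0 (res_hat l R h) = X (\<Gamma>1 (res_hat (cnj l1) R1 (Y h)))"
    by (rule boundary_value_factorization[OF R0 R1 th(1) bd R]) (assumption | rule that)+
  \<comment> \<open>The hypothesis provides an everywhere defined \<open>S\<close> in the ideal that
    shares its adjoint with the gamma field; the rest of the argument works with \<open>S\<close>
    through that adjoint.\<close>
  obtain S where S: "S \<in> \<AA> G H" "rel_adjoint G H (gamma_field T \<Gamma>0 l1) = rel_adjoint G H S"
    using gamma by (auto simp: ideal_adjoint_def)
  then obtain s where s: "bounded_on G H s" "S = graph_on G s"
    using operator_ideal_bounded[OF AA sepG sepH] bounded_opsE by blast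
  obtain X' where X': "bounded_on G G X'"
    "\<And>x y. x \<in> G \<Longrightarrow> y \<in> G \<Longrightarrow> cinner (X x) y = cinner x (X' y)"
    using bounded_on_adjoint[OF hilbert_G subspace_G X] by blast
  obtain Y' where Y': "bounded_on H H Y'"
    "\<And>x y. x \<in> H \<Longrightarrow> y \<in> H \<Longrightarrow> cinner (Y x) y = cinner x (Y' y)"
    using bounded_on_adjoint[OF hilbert_H subspace_H Y] by blast
  \<comment> \<open>The boundary map is \<open>X\<close>, the adjoint of \<open>s\<close> and
    \<open>Y\<close> composed; taking adjoints reverses the order.\<close>
  define q where "q z = Y' (s (X' z))" for z
  have "bounded_on G H q"
    unfolding q_def using bounded_on_comp[OF bounded_on_comp[OF X'(1) s(1)] Y'(1)] .
  moreover have "graph_on G q \<in> \<AA> G H"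
  proof -
    have im: "X' ` G \<subseteq> G" "s ` G \<subseteq> H" using X'(1) s(1) by (auto simp: bounded_on_def)
    have "graph_on G X' O S O graph_on H Y' \<in> \<AA> G H"
      by (rule operator_ideal_comp[OF AA sepG sepH sepG sepH S(1)])
        (rule graph_on_bounded_ops[OF subspace_G X'(1)], rule graph_on_bounded_ops[OF subspace_H Y'(1)])
    then show ?thesis
      unfolding s(2) graph_on_relcomp[OF im(2)] graph_on_relcomp[OF im(1)] q_def .
  qed
  moreover have "cinner (\<Gamma>0 (res_hat l R h)) z = cinner h (q z)" if h: "h \<in> H" and z: "z \<in> G" for h z
  proof -
    define g where "g = \<Gamma>1 (res_hat (cnj l1) R1 (Y h))"
    have Yh: "Y h \<in> H" using bounded_onD(2)[OF Y h] .
    have "(Y h, g) \<in> rel_adjoint G H (graph_on G s)"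
      using gamma_field_adjoint_mem[OF R1 Yh] unfolding S(2) s(2) g_def .
    then have g: "g \<in> G" "\<And>x. x \<in> G \<Longrightarrow> cinner (s x) (Y h) = cinner x g"
      unfolding rel_adjoint_def graph_on_def by auto
    have X'z: "X' z \<in> G" using bounded_onD(2)[OF X'(1) z] .
    have "cinner (\<Gamma>0 (res_hat l R h)) z = cinner g (X' z)"
      unfolding XY[OF h] g_def[symmetric] by (rule X'(2)[OF g(1) z])
    also have "\<dots> = cinner (Y h) (s (X' z))" using g(2)[OF X'z] cinner_commute by metis
    also have "\<dots> = cinner h (q z)"
      unfolding q_def by (rule Y'(2)[OF h bounded_onD(2)[OF s(1) X'z]])
    finally show ?thesis .
  qed
  ultimately show ?thesis using that by blast
qed

end

section \<open>The resolvent difference and the two ideal statements\<close>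

theorem theorem3p22:
  fixes H G :: "'u::complex_inner set"
    and A T \<Theta>1 \<Theta>2 :: "'u lrel"
    and \<Gamma>0 \<Gamma>1 :: "'u \<times> 'u \<Rightarrow> 'u"
    and \<BB> :: "'u op_class"
    and l0 :: complex
  assumes H: "separable_hilbert_space H"
    and A: "symmetric_relation H A" "closed A"
    and qbt: "quasi_boundary_triple H A G T \<Gamma>0 \<Gamma>1"
    and B: "operator_ideal_class \<BB>"
    and Theta1: "\<Theta>1 \<in> bounded_ops G G" "self_adjoint_relation G \<Theta>1"
    and Theta2: "\<Theta>2 \<in> bounded_ops G G" "self_adjoint_relation G \<Theta>2"
    and i: "l0 \<in> resolvent_set H (ker_on T \<Gamma>0)"
      "closure (weyl_function T \<Gamma>0 \<Gamma>1 l0) \<in> compact_ops G G"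
    and ii1: "0 \<notin> ess_spectrum G \<Theta>1" "self_adjoint_relation H (extension T \<Gamma>0 \<Gamma>1 \<Theta>1)"
    and ii2: "0 \<notin> ess_spectrum G \<Theta>2" "self_adjoint_relation H (extension T \<Gamma>0 \<Gamma>1 \<Theta>2)"
    and iii: "rel_diff \<Theta>1 \<Theta>2 \<in> \<BB> G G"
  shows "(\<forall>l \<in> resolvent_set H (extension T \<Gamma>0 \<Gamma>1 \<Theta>1) \<inter>
               resolvent_set H (extension T \<Gamma>0 \<Gamma>1 \<Theta>2).
            rel_diff (resolvent (extension T \<Gamma>0 \<Gamma>1 \<Theta>1) l)
                     (resolvent (extension T \<Gamma>0 \<Gamma>1 \<Theta>2) l) \<in> \<BB> H H) \<and>
         (\<forall>\<AA> l1. operator_ideal_class \<AA> \<longrightarrow>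
            l1 \<in> resolvent_set H (ker_on T \<Gamma>0) \<longrightarrow>
            rel_adjoint G H (gamma_field T \<Gamma>0 l1) \<in> ideal_adjoint \<AA> H G \<longrightarrow>
            (\<forall>l \<in> resolvent_set H (extension T \<Gamma>0 \<Gamma>1 \<Theta>1) \<inter>
                 resolvent_set H (extension T \<Gamma>0 \<Gamma>1 \<Theta>2).
              rel_diff (resolvent (extension T \<Gamma>0 \<Gamma>1 \<Theta>1) l)
                       (resolvent (extension T \<Gamma>0 \<Gamma>1 \<Theta>2) l)
                \<in> ideal_prod (ideal_prod \<AA> \<BB>) (ideal_adjoint \<AA>) H H))"
proof -
  have hH: "hilbert_space H" using H by (simp add: separable_hilbert_space_def)
  interpret quasi_triple H A G T \<Gamma>0 \<Gamma>1 using hH qbt by unfold_locales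
  obtain \<theta>1 where th1: "bounded_on G G \<theta>1" "\<Theta>1 = graph_on G \<theta>1"
    "\<And>x y. x \<in> G \<Longrightarrow> y \<in> G \<Longrightarrow> cinner (\<theta>1 x) y = cinner x (\<theta>1 y)"
    using bounded_self_adjointE[OF Theta1] by blast
  obtain \<theta>2 where th2: "bounded_on G G \<theta>2" "\<Theta>2 = graph_on G \<theta>2"
    "\<And>x y. x \<in> G \<Longrightarrow> y \<in> G \<Longrightarrow> cinner (\<theta>2 x) y = cinner x (\<theta>2 y)"
    using bounded_self_adjointE[OF Theta2] by blast
  have thG: "\<theta>1 ` G \<subseteq> G" "\<theta>2 ` G \<subseteq> G" using th1(1) th2(1) by (auto simp: bounded_on_def)
  define S1 where "S1 = {f \<in> T. \<Gamma>1 f = \<theta>1 (\<Gamma>0 f)}"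
  define S2 where "S2 = {f \<in> T. \<Gamma>1 f = \<theta>2 (\<Gamma>0 f)}"
  have "\<Gamma>0 ` T \<subseteq> G" using Gamma0_in by blast
  then have ext: "extension T \<Gamma>0 \<Gamma>1 \<Theta>1 = S1" "extension T \<Gamma>0 \<Gamma>1 \<Theta>2 = S2"
    unfolding S1_def S2_def th1(2) th2(2) by (simp_all only: extension_graph_on)
  have sa: "self_adjoint_relation H S1" "self_adjoint_relation H S2"
    using ii1(2) ii2(2) unfolding ext .
  have ST: "S1 \<subseteq> T" "S2 \<subseteq> T" by (auto simp: S1_def S2_def)
  obtain R0 where R0: "is_resolvent H A0 l0 R0" using resolvent_setE[OF i(1)] by blast
  \<comment> \<open>Boundedness of the closed Weyl function at \<open>l0\<close> is the input that
    carries separability from \<open>H\<close> to \<open>G\<close>.\<close>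
  have sepG: "separable_hilbert_space G"
  proof -
    have "closure (weyl_function T \<Gamma>0 \<Gamma>1 l0) \<in> bounded_ops G G"
      using i(2) by (simp add: compact_ops_def)
    then obtain K where K: "\<And>x y. (x, y) \<in> closure (weyl_function T \<Gamma>0 \<Gamma>1 l0) \<Longrightarrow> norm y \<le> K * norm x"
      unfolding bounded_ops_def by blast
    have "norm (\<Gamma>1 (u, l0 *\<^sub>C u)) \<le> K * norm (\<Gamma>0 (u, l0 *\<^sub>C u))" if "(u, l0 *\<^sub>C u) \<in> T" for u
      by (rule K[OF subsetD[OF closure_subset weyl_function_mem[OF that]]])
    then show ?thesis by (rule separable_G[OF H R0])
  qed
  define D where "D = graph_on G (\<lambda>x. \<theta>1 x - \<theta>2 x)"
  have D: "D \<in> \<BB> G G" using iii unfolding th1(2) th2(2) rel_diff_graph_on D_def .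
  have DG: "(\<lambda>x. \<theta>1 x - \<theta>2 x) ` G \<subseteq> G"
    using thG subspace_G by (auto intro: complex_vector.subspace_diff)
  \<comment> \<open>Relational composition lists the rightmost operator first. The Krein formula
    yields \<Theta>2 - \<Theta>1, the hypothesis concerns the opposite difference; the sign goes
    into the last factor.\<close>
  have factor: "rel_diff (resolvent S1 l) (resolvent S2 l) =
      graph_on H (\<lambda>h. \<Gamma>0 (res_hat l R2 h)) O D O graph_on G (\<lambda>z. (-1) *\<^sub>C Q z)"
    if R1: "is_resolvent H S1 l R1" "resolvent S1 l = graph_on H R1"
      and R1': "is_resolvent H S1 (cnj l) R1'"
      and R2: "is_resolvent H S2 l R2" "resolvent S2 l = graph_on H R2"
      and Q: "bounded_on G H Q"
        "\<And>h z. h \<in> H \<Longrightarrow> z \<in> G \<Longrightarrow> cinner (\<Gamma>0 (res_hat (cnj l) R1' h)) z = cinner h (Q z)"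
    for l R1 R1' R2 Q
  proof -
    have QH: "Q ` G \<subseteq> H" using Q(1) by (simp add: bounded_on_def)
    have P2: "(\<lambda>h. \<Gamma>0 (res_hat l R2 h)) ` H \<subseteq> G"
      using bounded_onD(2)[OF boundary_map_bounded(1)[OF ST(2) sa(2) R2(1)]] by blast
    have "R1 k - R2 k = (-1) *\<^sub>C Q (\<theta>1 (\<Gamma>0 (res_hat l R2 k)) - \<theta>2 (\<Gamma>0 (res_hat l R2 k)))"
      if k: "k \<in> H" for k
    proof -
      define x where "x = \<Gamma>0 (res_hat l R2 k)"
      have x: "x \<in> G" using P2 k by (auto simp: x_def)
      have "R1 k - R2 k = Q (\<theta>2 x - \<theta>1 x)"
        unfolding x_def
        by (rule resolvent_diff_factorization[OF th1(1,3) S1_def S2_def R1(1) R1' R2(1) thG(2) QH Q(2) k])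
      also have "\<theta>2 x - \<theta>1 x = (-1) *\<^sub>C (\<theta>1 x - \<theta>2 x)"
        by (simp add: complex_vector.scale_minus_left scaleC_one)
      also have "Q \<dots> = (-1) *\<^sub>C Q (\<theta>1 x - \<theta>2 x)"
        using DG x by (intro bounded_onD(4)[OF Q(1)]) blast
      finally show ?thesis unfolding x_def .
    qed
    then show ?thesis
      unfolding R1(2) R2(2) rel_diff_graph_on D_def graph_on_relcomp[OF DG] graph_on_relcomp[OF P2]
      by (rule graph_on_cong)
  qed
  show ?thesis
    unfolding ext
  proof (intro conjI ballI allI impI)
    fix l assume l: "l \<in> resolvent_set H S1 \<inter> resolvent_set H S2"
    obtain R1 where R1: "is_resolvent H S1 l R1" "resolvent S1 l = graph_on H R1"
      using resolvent_setE l by blast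
    obtain R2 where R2: "is_resolvent H S2 l R2" "resolvent S2 l = graph_on H R2"
      using resolvent_setE l by blast
    obtain R1' where R1': "is_resolvent H S1 (cnj l) R1'"
      using self_adjoint_resolvent_cnj[OF hH sa(1) R1(1)] by blast
    \<comment> \<open>For the first claim any bounded adjoint will do, as the ideal property comes
      from \<open>D\<close>.\<close>
    obtain Q where Q: "bounded_on G H Q"
      "\<And>h z. h \<in> H \<Longrightarrow> z \<in> G \<Longrightarrow> cinner (\<Gamma>0 (res_hat (cnj l) R1' h)) z = cinner h (Q z)"
      using bounded_on_adjoint[OF hH subspace_G boundary_map_bounded(1)[OF ST(1) sa(1) R1']] by blast
    have eq: "rel_diff (resolvent S1 l) (resolvent S2 l) =
        graph_on H (\<lambda>h. \<Gamma>0 (res_hat l R2 h)) O D O graph_on G (\<lambda>z. (-1) *\<^sub>C Q z)"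
      by (rule factor[OF R1 R1' R2 Q])
    show "rel_diff (resolvent S1 l) (resolvent S2 l) \<in> \<BB> H H"
      unfolding eq
      by (rule operator_ideal_comp[OF B sepG sepG H H D])
        (intro graph_on_bounded_ops subspace_H subspace_G bounded_on_scaleC Q(1)
          boundary_map_bounded(1)[OF ST(2) sa(2) R2(1)])+
  next
    fix \<AA> :: "'u op_class" and l1 l
    assume AA: "operator_ideal_class \<AA>" and l1: "l1 \<in> resolvent_set H A0"
      and gamma: "rel_adjoint G H (gamma_field T \<Gamma>0 l1) \<in> ideal_adjoint \<AA> H G"
      and l: "l \<in> resolvent_set H S1 \<inter> resolvent_set H S2"
    obtain R1 where R1: "is_resolvent H S1 l R1" "resolvent S1 l = graph_on H R1"
      using resolvent_setE l by blast
    obtain R2 where R2: "is_resolvent H S2 l R2" "resolvent S2 l = graph_on H R2"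
      using resolvent_setE l by blast
    obtain R1' where R1': "is_resolvent H S1 (cnj l) R1'"
      using self_adjoint_resolvent_cnj[OF hH sa(1) R1(1)] by blast
    \<comment> \<open>The left factor comes from the first extension at \<open>cnj l\<close>, the
      right one from the second extension at \<open>l\<close>.\<close>
    obtain Q where Q: "bounded_on G H Q" "graph_on G Q \<in> \<AA> G H"
      "\<And>h z. h \<in> H \<Longrightarrow> z \<in> G \<Longrightarrow> cinner (\<Gamma>0 (res_hat (cnj l) R1' h)) z = cinner h (Q z)"
      by (rule boundary_value_in_ideal[OF H sepG AA i l1 gamma th1(1,3) ii1(1)[unfolded th1(2)]
            R1'[unfolded S1_def]]) (assumption | rule that)+
    obtain q where q: "bounded_on G H q" "graph_on G q \<in> \<AA> G H"
      "\<And>h z. h \<in> H \<Longrightarrow> z \<in> G \<Longrightarrow> cinner (\<Gamma>0 (res_hat l R2 h)) z = cinner h (q z)"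
      by (rule boundary_value_in_ideal[OF H sepG AA i l1 gamma th2(1,3) ii2(1)[unfolded th2(2)]
            R2(1)[unfolded S2_def]]) (assumption | rule that)+
    let ?P = "\<lambda>h. \<Gamma>0 (res_hat l R2 h)"
    have P: "?P ` H \<subseteq> G"
      using bounded_onD(2)[OF boundary_map_bounded(1)[OF ST(2) sa(2) R2(1)]] by blast
    \<comment> \<open>\<open>ideal_adjoint\<close> consists of adjoints of ideal elements, so the
      boundary map has to be exhibited as the adjoint of \<open>q\<close>.\<close>
    have "rel_adjoint G H (graph_on G q) = graph_on H ?P"
    proof (rule rel_adjoint_graph_on[OF subspace_G _ P])
      show "q ` G \<subseteq> H" using q(1) by (simp add: bounded_on_def)
      show "cinner (q x) y = cinner x (?P y)" if "x \<in> G" "y \<in> H" for x y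
        using q(3)[OF that(2,1)] cinner_commute by metis
    qed
    then have P_ideal: "graph_on H ?P \<in> ideal_adjoint \<AA> H G"
      using q(2) unfolding ideal_adjoint_def by (metis imageI)
    have QH: "Q ` G \<subseteq> H" using Q(1) by (simp add: bounded_on_def)
    have "D O graph_on G (\<lambda>z. (-1) *\<^sub>C Q z) \<in> ideal_prod \<AA> \<BB> G H"
      unfolding ideal_prod_def
      using sepG D graph_on_uminus_in_ideal[OF sepG H AA Q(2) QH] by blast
    moreover have "rel_diff (resolvent S1 l) (resolvent S2 l) =
        graph_on H ?P O D O graph_on G (\<lambda>z. (-1) *\<^sub>C Q z)"
      by (rule factor[OF R1 R1' R2 Q(1,3)])
    ultimately show "rel_diff (resolvent S1 l) (resolvent S2 l)
        \<in> ideal_prod (ideal_prod \<AA> \<BB>) (ideal_adjoint \<AA>) H H"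
      unfolding ideal_prod_def[of "ideal_prod \<AA> \<BB>"]
      using sepG P_ideal by blast
  qed
qed

end
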